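(* For a non-negative integer $u$ let $p(u)$ denote the number of partitions of $u$, with $p(0)=1$. In the group $I(Q)\cong I(\mathbb{H}^n)$: (i) the number of $z$-classes of elliptic elements (the identity being counted as an elliptic element) is $$(n+1)p(0)+(n-1)p(1)+(n-3)p(2)+\cdots+\epsilon\, p\left(\left[\tfrac n2\right]\right)=\sum_{k=0}^{[n/2]}(n+1-2k)\,p(k),$$ where $\epsilon=1$ or $2$ according as $n$ is even or odd; (ii) the number of $z$-classes of hyperbolic elements is $$\left(\left[\tfrac{n-1}2\right]+1\right)p(0)+\left[\tfrac{n-1}2\right]p(1)+\left(\left[\tfrac{n-1}2\right]-1\right)p(2)+\cdots+p\left(\left[\tfrac{n-1}2\right]\right)=\sum_{k=0}^{[(n-1)/2]}\left(\left[\tfrac{n-1}2\right]+1-k\right)p(k);$$ (iii) the number of $z$-classes of parabolic elements is $$(n-1)p(0)+(n-3)p(1)+\cdots+\epsilon\, p\left(\left[\tfrac{n-2}2\right]\right)=\sum_{k=0}^{[(n-2)/2]}(n-1-2k)\,p(k),$$ where $\epsilon=1$ or $2$ according as $n$ is even or odd.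
   Context: $n$ is a positive integer, $\mathbb{V}$ is a real vector space of dimension $n+1$ with a quadratic form $Q$ of signature $(1,n)$ (one positive, $n$ negative), and $O(Q)$ is its full isometry group. The hyperboloid $\{v\in\mathbb{V}: Q(v)=1\}$ has two components; one of them is the model of the hyperbolic space $\mathbb{H}^n$. $I(Q)$ is the subgroup of $O(Q)$ preserving this component, and it is identified with the full isometry group $I(\mathbb{H}^n)$. Two elements $x,y$ of a group $G$ are $z$-equivalent if their centralizers $Z(x),Z(y)$ in $G$ are conjugate subgroups of $G$; the equivalence classes are the $z$-classes. Here $G=I(Q)$. An element $T\in I(Q)$ is elliptic if it has an eigenvector $v$ with $Q(v)>0$ (equivalently, it has a fixed point in $\mathbb{H}^n$); hyperbolic if it has a real eigenvalue $r\neq\pm1$ (equivalently, it is non-elliptic with exactly two fixed points on the ideal boundary); parabolic if it is not semisimple (equivalently, it is non-elliptic with exactly one fixed point on the ideal boundary). $[\cdot]$ denotes the integer part. *)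

theory Defs
  imports
    "HOL-Analysis.Analysis"
    "HOL-Algebra.Coset"
    "HOL-Library.Multiset"
begin

section \<open>Quadratic forms and their isometries\<close>

definition polar_form :: "('v::real_vector \<Rightarrow> real) \<Rightarrow> 'v \<Rightarrow> 'v \<Rightarrow> real" where
  "polar_form Q x y = (Q (x + y) - Q x - Q y) / 2"

definition quadratic_form :: "('v::real_vector \<Rightarrow> real) \<Rightarrow> bool" where
  "quadratic_form Q \<longleftrightarrow>
     (\<forall>c x. Q (c *\<^sub>R x) = c\<^sup>2 * Q x) \<and> bilinear (polar_form Q)"

text \<open>By Sylvester's law of inertia the two cardinalities do not depend on the orthogonal basis.
  The form is nondegenerate iff \<open>p + q\<close> is the dimension of the space.\<close>

definition has_signature :: "('v::euclidean_space \<Rightarrow> real) \<Rightarrow> nat \<Rightarrow> nat \<Rightarrow> bool" where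
  "has_signature Q p q \<longleftrightarrow>
     (\<exists>B. independent B \<and> span B = UNIV \<and>
          (\<forall>x\<in>B. \<forall>y\<in>B. x \<noteq> y \<longrightarrow> polar_form Q x y = 0) \<and>
          card {x\<in>B. Q x > 0} = p \<and> card {x\<in>B. Q x < 0} = q)"

definition isometry_group :: "('v::real_vector \<Rightarrow> real) \<Rightarrow> ('v \<Rightarrow> 'v) monoid" where
  "isometry_group Q =
     \<lparr>carrier = {T. linear T \<and> bij T \<and> (\<forall>v. Q (T v) = Q v)}, mult = (\<circ>), one = id\<rparr>"

definition hyperboloid :: "('v \<Rightarrow> real) \<Rightarrow> 'v set" where
  "hyperboloid Q = {v. Q v = 1}"

text \<open>The subgroup of isometries of \<open>Q\<close> that preserve \<open>C\<close>; for a connected component \<open>C\<close>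
  of the hyperboloid of a form of signature \<open>(1, n)\<close> this is the isometry group of the
  hyperbolic space modelled on \<open>C\<close>.\<close>

definition hyp_isometry_group :: "('v::real_vector \<Rightarrow> real) \<Rightarrow> 'v set \<Rightarrow> ('v \<Rightarrow> 'v) monoid" where
  "hyp_isometry_group Q C =
     (isometry_group Q)\<lparr>carrier := {T \<in> carrier (isometry_group Q). T ` C = C}\<rparr>"


section \<open>Types of isometries\<close>

definition elliptic :: "('v::real_vector \<Rightarrow> real) \<Rightarrow> ('v \<Rightarrow> 'v) \<Rightarrow> bool" where
  "elliptic Q T \<longleftrightarrow> (\<exists>v c. v \<noteq> 0 \<and> T v = c *\<^sub>R v \<and> Q v > 0)"

definition hyperbolic :: "('v::real_vector \<Rightarrow> 'v) \<Rightarrow> bool" where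
  "hyperbolic T \<longleftrightarrow> (\<exists>v r. v \<noteq> 0 \<and> T v = r *\<^sub>R v \<and> r \<noteq> 1 \<and> r \<noteq> -1)"

definition invariant_subspace :: "('v::real_vector \<Rightarrow> 'v) \<Rightarrow> 'v set \<Rightarrow> bool" where
  "invariant_subspace T W \<longleftrightarrow> subspace W \<and> T ` W \<subseteq> W"

definition semisimple :: "('v::real_vector \<Rightarrow> 'v) \<Rightarrow> bool" where
  "semisimple T \<longleftrightarrow>
     (\<forall>W. invariant_subspace T W \<longrightarrow>
        (\<exists>W'. invariant_subspace T W' \<and> W \<inter> W' = {0} \<and> span (W \<union> W') = UNIV))"

definition parabolic :: "('v::real_vector \<Rightarrow> 'v) \<Rightarrow> bool" where
  "parabolic T \<longleftrightarrow> \<not> semisimple T"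


section \<open>z-classes\<close>

definition centralizer :: "('a, 'b) monoid_scheme \<Rightarrow> 'a \<Rightarrow> 'a set" where
  "centralizer G x = {g \<in> carrier G. g \<otimes>\<^bsub>G\<^esub> x = x \<otimes>\<^bsub>G\<^esub> g}"

definition z_equivalent :: "('a, 'b) monoid_scheme \<Rightarrow> 'a \<Rightarrow> 'a \<Rightarrow> bool" where
  "z_equivalent G x y \<longleftrightarrow>
     (\<exists>g\<in>carrier G. centralizer G y = (g <#\<^bsub>G\<^esub> centralizer G x) #>\<^bsub>G\<^esub> inv\<^bsub>G\<^esub> g)"

definition z_class :: "('a, 'b) monoid_scheme \<Rightarrow> 'a \<Rightarrow> 'a set" where
  "z_class G x = {y \<in> carrier G. z_equivalent G x y}"

definition z_classes_of :: "('a, 'b) monoid_scheme \<Rightarrow> ('a \<Rightarrow> bool) \<Rightarrow> 'a set set" where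
  "z_classes_of G P = z_class G ` {x \<in> carrier G. P x}"


section \<open>Partitions\<close>

definition num_partitions :: "nat \<Rightarrow> nat" where
  "num_partitions u = card {M :: nat multiset. 0 \<notin># M \<and> sum_mset M = u}"

end

theory Submission
  imports Defs
begin

text \<open>
  Let \<open>T\<close> preserve the chosen sheet. The operator \<open>T + T\<^sup>-\<^sup>1\<close> is self-adjoint, so on a negative definite
  invariant subspace the spectral theorem splits \<open>T\<close> into its eigenspaces for \<open>\<plusminus>1\<close> and rotations by
  distinct angles \<open>\<theta>\<close> on \<open>E\<^sub>c\<close>, \<open>c = 2 cos \<theta>\<close>, each of which is a Hermitian space. The rest of \<open>T\<close>
  lives on a subspace \<open>P\<close> containing a vector of positive length: a fixed line (elliptic), a plane
  spanned by two null eigenvectors (hyperbolic), or a three-dimensional Jordan block (parabolic; the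
  fixed null line comes from Brouwer's theorem). The angles, and the
  dilation factor in the hyperbolic case, can be changed freely by passing to polynomials in \<open>T\<close>, which does
  not change the centralizer. So the z-class only depends on the dimensions of the summands, up to
  exchanging the eigenvalues \<open>1\<close> and \<open>-1\<close> if \<open>T\<close> is hyperbolic.

  Conversely, these dimensions are read off from the centralizer of \<open>T\<close>. For a negative vector \<open>x\<close> the
  reflection in \<open>x\<close> commutes with \<open>T\<close> iff \<open>T x = \<plusminus>x\<close>, and the half-turns in the planes spanned by
  \<open>x\<close> and \<open>T x\<close>, \<open>x \<in> E\<^sub>c\<close>, determine the family of the \<open>E\<^sub>c\<close>. What remains is to count pairs of
  a number (the dimension of the \<open>-1\<close>-eigenspace) and a partition (the half dimensions of the \<open>E\<^sub>c\<close>).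
\<close>

section \<open>Lorentzian forms\<close>

text \<open>Why only dimensions survive: on each summand, \<open>T'\<close> need only be an affine
  polynomial \<open>\<alpha> + \<beta> T\<close>, up to a common isometry \<open>g\<close>, with
  coefficients depending on the summand. This preserves commutation provided that the summand is
  invariant under both centralizers. The obstacle is that \<open>P\<close> and the negative vectors
  fixed by \<open>T\<close> are in general not invariant separately when 1 is also an eigenvalue on
  \<open>P\<close>, that is for elliptic and parabolic isometries. They are therefore treated as one
  space \<open>Gen T 2\<close>, on which \<open>T'\<close> has to be conjugate to \<open>T\<close>
  itself. This marks the eigenvalue 1, so the dimension b of the -1-eigenspace is an invariant; a
  hyperbolic isometry only yields the smaller b of the dimensions for 1 and -1. With k the sum of
  the partition, the bounds are \<open>b + 2k \<le> n\<close>, \<open>b + 2k \<le> n - 2\<close> and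
  \<open>2b + 2k \<le> n - 1\<close> in the elliptic, parabolic and hyperbolic case, which explains
  the factors n+1-2k, n-1-2k and [(n-1)/2]+1-k of p(k).\<close>

locale lorentz =
  fixes B :: "'v::euclidean_space \<Rightarrow> 'v \<Rightarrow> real" and e0 :: 'v
  assumes bil: "bilinear B"
    and sym: "B x y = B y x"
    and e0: "B e0 e0 = 1"
    and neg_orth_e0: "B x e0 = 0 \<Longrightarrow> x \<noteq> 0 \<Longrightarrow> B x x < 0"
begin

lemmas B_simps [simp] = bilinear_ladd[OF bil] bilinear_radd[OF bil] bilinear_lmul[OF bil]
  bilinear_rmul[OF bil] bilinear_lneg[OF bil] bilinear_rneg[OF bil] bilinear_lsub[OF bil]
  bilinear_rsub[OF bil] bilinear_lzero[OF bil] bilinear_rzero[OF bil]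

lemma nondegenerate: "(\<And>y. B x y = 0) \<Longrightarrow> x = 0"
  using neg_orth_e0 by force

text \<open>The difference of the two sides is orthogonal to \<open>e0\<close>, hence negative
  unless it vanishes; but for orthogonal \<open>x\<close> and \<open>y\<close> its square is a sum
  of two nonnegative terms.\<close>

lemma causal_orthogonal:
  assumes "B x x \<ge> 0" "B y y \<ge> 0" "B x y = 0"
  shows "B y e0 *\<^sub>R x = B x e0 *\<^sub>R y"
proof (rule ccontr)
  assume "\<not> ?thesis"
  then have "B (B y e0 *\<^sub>R x - B x e0 *\<^sub>R y) (B y e0 *\<^sub>R x - B x e0 *\<^sub>R y) < 0"
    by (intro neg_orth_e0) auto
  then have "(B y e0)\<^sup>2 * B x x + (B x e0)\<^sup>2 * B y y < 0"
    using assms(3) sym[of y x] by (simp add: algebra_simps power2_eq_square)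
  moreover have "(B y e0)\<^sup>2 * B x x + (B x e0)\<^sup>2 * B y y \<ge> 0"
    using assms by simp
  ultimately show False by simp
qed

lemma causal_e0: "B x x \<ge> 0 \<Longrightarrow> x \<noteq> 0 \<Longrightarrow> B x e0 \<noteq> 0"
  using neg_orth_e0 by force

lemma causal_orthogonal_parallel:
  assumes "B x x \<ge> 0" "B y y \<ge> 0" "B x y = 0" "x \<noteq> 0"
  obtains t where "y = t *\<^sub>R x"
proof
  have "B x e0 \<noteq> 0" using causal_e0 assms by blast
  then show "y = (B y e0 / B x e0) *\<^sub>R x"
    using causal_orthogonal[OF assms(1-3)]
    by (metis divideR_right divide_inverse_commute scaleR_scaleR)
qed

lemma orthogonal_timelike_neg:
  assumes "B x x > 0" "B x y = 0" "y \<noteq> 0"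
  shows "B y y < 0"
proof (rule ccontr)
  assume "\<not> ?thesis"
  moreover have "x \<noteq> 0" using assms by auto
  ultimately obtain t where "y = t *\<^sub>R x"
    using causal_orthogonal_parallel[of x y] assms by force
  then show False using assms by auto
qed

text \<open>The vector \<open>?z\<close> is orthogonal to \<open>e0\<close>, so its square is at
  most 0; a negative \<open>B x y\<close> would make it positive. This weak reversed Cauchy-Schwarz
  inequality is what makes the closed future cone convex.\<close>

lemma future_nonneg:
  assumes "B x x \<ge> 0" "B y y \<ge> 0" "B x e0 > 0" "B y e0 > 0"
  shows "B x y \<ge> 0"
proof (rule ccontr)
  assume *: "\<not> ?thesis"
  let ?z = "B y e0 *\<^sub>R x - B x e0 *\<^sub>R y"
  have "B ?z ?z = (B y e0)\<^sup>2 * B x x + (B x e0)\<^sup>2 * B y y - 2 * (B y e0 * B x e0 * B x y)"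
    using sym[of y x] by (simp add: algebra_simps power2_eq_square)
  moreover have "(B y e0)\<^sup>2 * B x x + (B x e0)\<^sup>2 * B y y \<ge> 0" using assms by simp
  moreover have "B y e0 * B x e0 * B x y < 0" using * assms by (simp add: mult_pos_neg)
  ultimately have "B ?z ?z > 0" by linarith
  moreover have "B ?z ?z \<le> 0" using neg_orth_e0[of ?z] by (cases "?z = 0") force+
  ultimately show False by simp
qed

section \<open>Orthogonal complements and nondegenerate subspaces\<close>

definition oc :: "'v set \<Rightarrow> 'v set" where
  "oc X = {v. \<forall>y\<in>X. B v y = 0}"

lemma oc_iff: "v \<in> oc X \<longleftrightarrow> (\<forall>y\<in>X. B v y = 0)"
  by (simp add: oc_def)

lemma ocD: "v \<in> oc X \<Longrightarrow> y \<in> X \<Longrightarrow> B v y = 0" "v \<in> oc X \<Longrightarrow> y \<in> X \<Longrightarrow> B y v = 0"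
  using sym by (auto simp: oc_def)

lemma subspace_oc: "subspace (oc X)"
  by (simp add: subspace_def oc_def)

lemma oc_span: "oc (span X) = oc X"
proof -
  have "B v y = 0" if "v \<in> oc X" "y \<in> span X" for v y
    using that(2)
  proof (induction rule: span_induct)
    case base
    show ?case by (simp add: subspace_def)
  next
    case (step x)
    then show ?case using that(1) by (simp add: oc_def)
  qed
  then show ?thesis by (auto simp: oc_def span_base)
qed

text \<open>The map \<open>L\<close> represents \<open>B\<close> through the Euclidean inner product
  and is injective by nondegeneracy, so \<open>oc X\<close> is the Euclidean orthogonal complement
  of the image of \<open>X\<close> under \<open>L\<close>, which has the dimension of
  \<open>X\<close>.\<close>

lemma dim_oc:
  assumes "subspace X"
  shows "dim (oc X) + dim X = DIM('v)"
proof -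
  define L where "L x = (\<Sum>b\<in>Basis. B x b *\<^sub>R b)" for x
  have L: "L x \<bullet> y = B x y" for x y
  proof -
    have "B x y = B x (\<Sum>b\<in>Basis. (y \<bullet> b) *\<^sub>R b)" by (simp add: euclidean_representation)
    also have "\<dots> = (\<Sum>b\<in>Basis. (y \<bullet> b) * B x b)"
      using bil by (simp add: bilinear_def linear_sum linear_scale o_def)
    finally show ?thesis by (simp add: L_def inner_sum_left inner_sum_right inner_commute mult.commute)
  qed
  have linL: "linear L"
    by (rule linearI) (simp_all add: L_def algebra_simps sum.distrib scaleR_sum_right)
  have "inj L"
    by (metis L inner_zero_left linL linear_injective_0 nondegenerate)
  have "oc X = {y \<in> UNIV. \<forall>x\<in>L ` X. orthogonal x y}"
    by (simp add: oc_def orthogonal_def L sym[of _ "_ :: 'v"])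
  moreover have "dim \<dots> + dim (L ` X) = dim (UNIV :: 'v set)"
    using assms linL by (intro dim_subspace_orthogonal_to_vectors) (auto intro: linear_subspace_image)
  moreover have "dim (L ` X) = dim X"
    using linL \<open>inj L\<close> by (intro dim_image_eq) (auto simp: inj_on_def)
  ultimately show ?thesis by simp
qed

definition nondeg :: "'v set \<Rightarrow> bool" where
  "nondeg X \<longleftrightarrow> subspace X \<and> X \<inter> oc X \<subseteq> {0}"

lemma nondegI:
  assumes "subspace X" "\<And>x. x \<in> X \<Longrightarrow> x \<in> oc X \<Longrightarrow> B x x = 0 \<Longrightarrow> x = 0"
  shows "nondeg X"
  using assms ocD(1) unfolding nondeg_def by fast

lemma nondeg_decompose:
  assumes "nondeg X"
  obtains p r where "p \<in> X" "r \<in> oc X" "v = p + r"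
proof -
  have X: "subspace X" using assms by (simp add: nondeg_def)
  have "dim {x + y |x y. x \<in> X \<and> y \<in> oc X} + dim (X \<inter> oc X) = dim X + dim (oc X)"
    using dim_sums_Int[OF X subspace_oc] by simp
  moreover have "dim (X \<inter> oc X) = 0" using assms by (simp add: nondeg_def)
  ultimately have "dim {x + y |x y. x \<in> X \<and> y \<in> oc X} = DIM('v)" using dim_oc[OF X] by simp
  then have "{x + y |x y. x \<in> X \<and> y \<in> oc X} = UNIV"
    using subspace_sums[OF X subspace_oc] by (simp add: dim_eq_full span_eq_iff[THEN iffD2])
  then show thesis using that by blast
qed

text \<open>The projection is first chosen pointwise; uniqueness of the decomposition then gives
  linearity.\<close>

lemma nondeg_projection:
  assumes "nondeg X"
  obtains \<pi> where "linear \<pi>" "\<And>v. \<pi> v \<in> X" "\<And>v. v - \<pi> v \<in> oc X"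
    "\<And>v. v \<in> X \<Longrightarrow> \<pi> v = v" "\<And>v. v \<in> oc X \<Longrightarrow> \<pi> v = 0"
proof -
  have X: "subspace X" using assms by (simp add: nondeg_def)
  have "\<exists>p. p \<in> X \<and> v - p \<in> oc X" for v
    by (rule nondeg_decompose[OF assms, of v]) (metis add_diff_cancel_left')
  then obtain \<pi> where \<pi>: "\<And>v. \<pi> v \<in> X \<and> v - \<pi> v \<in> oc X" by metis
  have uniq: "\<pi> v = p" if "p \<in> X" "v - p \<in> oc X" for v p
  proof -
    have "p - \<pi> v \<in> X" using that \<pi> X subspace_diff by blast
    moreover have "(v - \<pi> v) - (v - p) \<in> oc X" using that \<pi> subspace_oc subspace_diff by blast
    ultimately show ?thesis using assms by (auto simp: nondeg_def)
  qed
  have "linear \<pi>"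
  proof (rule linearI)
    show "\<pi> (x + y) = \<pi> x + \<pi> y" for x y
      using \<pi>[of x] \<pi>[of y] X subspace_add[OF subspace_oc, of "x - \<pi> x" X "y - \<pi> y"]
      by (intro uniq) (auto simp: subspace_add algebra_simps)
    show "\<pi> (c *\<^sub>R x) = c *\<^sub>R \<pi> x" for c x
      using \<pi>[of x] X subspace_scale[OF subspace_oc, of "x - \<pi> x" X c]
      by (intro uniq) (auto simp: subspace_scale algebra_simps)
  qed
  moreover have "\<pi> v = v" if "v \<in> X" for v using that subspace_oc subspace_0 by (intro uniq) auto
  moreover have "\<pi> v = 0" if "v \<in> oc X" for v using that X subspace_0 by (intro uniq) auto
  ultimately show thesis using \<pi> that by blast
qed

section \<open>Negative definite subspaces\<close>

definition negdef :: "'v set \<Rightarrow> bool" where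
  "negdef X \<longleftrightarrow> subspace X \<and> (\<forall>x\<in>X. x \<noteq> 0 \<longrightarrow> B x x < 0)"

lemma negdefD: "negdef X \<Longrightarrow> x \<in> X \<Longrightarrow> x \<noteq> 0 \<Longrightarrow> B x x < 0"
  by (simp add: negdef_def)

lemma negdef_zero: "negdef X \<Longrightarrow> x \<in> X \<Longrightarrow> B x x = 0 \<Longrightarrow> x = 0"
  by (metis negdefD less_irrefl)

lemma negdef_le: "negdef X \<Longrightarrow> x \<in> X \<Longrightarrow> B x x \<le> 0"
  by (metis negdefD less_eq_real_def bilinear_lzero[OF bil])

lemma negdef_subspace: "negdef X \<Longrightarrow> subspace X"
  by (simp add: negdef_def)

lemma negdef_mono: "negdef X \<Longrightarrow> subspace Y \<Longrightarrow> Y \<subseteq> X \<Longrightarrow> negdef Y"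
  by (auto simp: negdef_def)

lemma negdef_nondeg: "negdef X \<Longrightarrow> nondeg X"
  by (rule nondegI) (auto intro: negdef_subspace negdef_zero)

lemma timelike_nondeg:
  assumes "subspace P" "p \<in> P" "B p p > 0"
  shows "nondeg P"
proof (rule nondegI)
  show "x = 0" if "x \<in> P" "x \<in> oc P" "B x x = 0" for x
    using orthogonal_timelike_neg[OF assms(3) ocD(2)[OF that(2) assms(2)]] that(3)
    by (rule_tac ccontr) simp
qed (rule assms)

lemma timelike_oc_negdef:
  assumes "p \<in> P" "B p p > 0"
  shows "negdef (oc P)"
  unfolding negdef_def
proof (intro conjI ballI impI subspace_oc)
  fix x assume "x \<in> oc P" "x \<noteq> 0"
  then show "B x x < 0" by (intro orthogonal_timelike_neg[OF assms(2)] ocD(2)[OF _ assms(1)])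
qed

lemma negdef_unit:
  assumes "negdef X" "x \<in> X" "x \<noteq> 0"
  obtains c where "B (c *\<^sub>R x) (c *\<^sub>R x) = -1"
proof -
  define c where "c = 1 / sqrt (- B x x)"
  have "B x x < 0" using negdefD[OF assms] .
  then have "c * c * B x x = -1"
    by (simp add: c_def flip: power2_eq_square) (simp add: power_divide)
  then show thesis by (intro that[of c]) (simp add: mult.assoc)
qed


section \<open>The spectral theorem on definite subspaces\<close>

text \<open>A maximizer \<open>x\<close> of the Rayleigh quotient exists on the compact unit sphere
  of \<open>W\<close>. As \<open>B\<close> is negative there, maximality says that the form
  \<open>q\<close> of \<open>S - c\<close> is nonnegative, with \<open>q x = 0\<close>. Moving from
  \<open>x\<close> in the direction \<open>z = S x - c x\<close> changes \<open>q\<close> by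
  \<open>2 t B z z\<close> to first order, so \<open>z\<close> must vanish.\<close>

lemma rayleigh_eigenvector:
  assumes W: "negdef W" and S: "linear S" and inv: "\<And>x. x \<in> W \<Longrightarrow> S x \<in> W"
    and sa: "\<And>x y. x \<in> W \<Longrightarrow> y \<in> W \<Longrightarrow> B (S x) y = B x (S y)" and ne: "W \<noteq> {0}"
  obtains c x where "x \<in> W" "x \<noteq> 0" "S x = c *\<^sub>R x"
proof -
  have subW: "subspace W" using W by (rule negdef_subspace)
  define K where "K = sphere 0 1 \<inter> W"
  define f where "f x = B (S x) x / B x x" for x
  have normalize: "(1 / norm y) *\<^sub>R y \<in> K" if "y \<in> W" "y \<noteq> 0" for y
    using that subW by (simp add: K_def subspace_scale)
  have K: "x \<in> W" "x \<noteq> 0" if "x \<in> K" for x using that by (auto simp: K_def)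
  have "compact K" unfolding K_def by (simp add: subW closed_subspace compact_Int_closed)
  moreover have "K \<noteq> {}"
  proof -
    obtain y where "y \<in> W" "y \<noteq> 0" using ne subspace_0[OF subW] by blast
    then show ?thesis using normalize by blast
  qed
  moreover have "continuous_on K f"
  proof -
    have "continuous_on K S" by (simp add: S linear_continuous_on linear_conv_bounded_linear[symmetric])
    moreover have "B x x \<noteq> 0" if "x \<in> K" for x using negdefD[OF W K[OF that]] by simp
    ultimately show ?thesis
      unfolding f_def by (intro continuous_on_divide bilinear_continuous_on_compose[OF _ _ bil]) auto
  qed
  ultimately obtain x where x: "x \<in> K" "\<And>y. y \<in> K \<Longrightarrow> f y \<le> f x"
    using continuous_attains_sup[of K f] by blast
  define c where "c = f x"
  define q where "q y = B (S y - c *\<^sub>R y) y" for y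
  have q: "q y \<ge> 0" if "y \<in> W" for y
  proof (cases "y = 0")
    case False
    have "f ((1 / norm y) *\<^sub>R y) \<le> c" using x(2) normalize that False c_def by blast
    moreover have "f ((1 / norm y) *\<^sub>R y) = f y" using False by (simp add: f_def linear_scale[OF S])
    ultimately show ?thesis
      using negdefD[OF W that False] by (simp add: f_def q_def field_simps)
  qed (simp add: q_def)
  have xW: "x \<in> W" "x \<noteq> 0" using K x by auto
  define z where "z = S x - c *\<^sub>R x"
  have zW: "z \<in> W" unfolding z_def using subW xW inv by (intro subspace_diff subspace_scale) auto
  have "q x = 0" using negdefD[OF W xW] by (simp add: q_def c_def f_def)
  have Sx: "S x = z + c *\<^sub>R x" by (simp add: z_def)
  have expand: "q (x + t *\<^sub>R z) = 2 * t * B z z + t\<^sup>2 * q z" for t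
  proof -
    have "B (S z - c *\<^sub>R z) x = B z z"
      using sa[OF zW xW(1)] by (simp add: Sx)
    moreover have "q (x + t *\<^sub>R z) = q x + t * (B z z + B (S z - c *\<^sub>R z) x) + t\<^sup>2 * q z"
      by (simp add: q_def linear_add[OF S] linear_scale[OF S] algebra_simps power2_eq_square Sx)
    ultimately show ?thesis using \<open>q x = 0\<close> by (simp add: algebra_simps)
  qed
  have "z = 0"
  proof (rule ccontr)
    assume "z \<noteq> 0"
    then have neg: "B z z < 0" using negdefD[OF W zW] by blast
    \<comment> \<open>Chosen so that \<open>t * q z\<close> is at most \<open>- B z z\<close>; the
      \<open>+ 1\<close> keeps the denominator positive when \<open>q z = 0\<close>.\<close>
    define t where "t = - B z z / (q z + 1)"
    have "t > 0" using neg q[OF zW] by (simp add: t_def divide_neg_pos)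
    have "t * q z \<le> t * (q z + 1)" using \<open>t > 0\<close> by (simp add: algebra_simps)
    also have "\<dots> = - B z z" using q[OF zW] by (simp add: t_def)
    finally have "2 * B z z + t * q z < 0" using neg by simp
    then have "t * (2 * B z z + t * q z) < 0" using \<open>t > 0\<close> by (simp add: mult_pos_neg)
    moreover have "x + t *\<^sub>R z \<in> W" using subW xW zW by (simp add: subspace_add subspace_scale)
    ultimately show False using q[of "x + t *\<^sub>R z"] expand[of t] by (simp add: algebra_simps power2_eq_square)
  qed
  then show thesis using that[of x c] xW by (simp add: z_def)
qed

text \<open>The part \<open>Y\<close> of \<open>W\<close> orthogonal to all eigenvectors is again
  invariant; an eigenvector in it would be orthogonal to itself.\<close>

lemma selfadjoint_spectral:
  assumes W: "negdef W" and S: "linear S" and inv: "\<And>x. x \<in> W \<Longrightarrow> S x \<in> W"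
    and sa: "\<And>x y. x \<in> W \<Longrightarrow> y \<in> W \<Longrightarrow> B (S x) y = B x (S y)"
  shows "W \<subseteq> span {x \<in> W. \<exists>c. S x = c *\<^sub>R x}"
proof -
  let ?E = "{x \<in> W. \<exists>c. S x = c *\<^sub>R x}"
  have subW: "subspace W" using W by (rule negdef_subspace)
  have EW: "span ?E \<subseteq> W" using subW by (intro span_minimal) auto
  have ndE: "negdef (span ?E)" using negdef_mono[OF W _ EW] by simp
  define Y where "Y = W \<inter> oc ?E"
  have subY: "subspace Y" unfolding Y_def by (intro subspace_inter subW subspace_oc)
  have ndY: "negdef Y" by (rule negdef_mono[OF W subY]) (simp add: Y_def)
  have invY: "S y \<in> Y" if "y \<in> Y" for y
  proof -
    have "B (S y) x = 0" if "x \<in> W" "S x = c *\<^sub>R x" for x c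
      using sa[of y x] that \<open>y \<in> Y\<close> by (auto simp: Y_def oc_iff)
    then show ?thesis using that inv by (auto simp: Y_def oc_iff)
  qed
  have Y0: "Y = {0}"
  proof (rule ccontr)
    assume Y: "Y \<noteq> {0}"
    have "B (S x) y = B x (S y)" if "x \<in> Y" "y \<in> Y" for x y using that sa by (simp add: Y_def)
    from rayleigh_eigenvector[OF ndY S invY this Y]
    obtain c x where x: "x \<in> Y" "x \<noteq> 0" "S x = c *\<^sub>R x" by metis
    then have "x \<in> ?E" "x \<in> oc ?E" by (auto simp: Y_def)
    then have "B x x = 0" by (rule ocD(1)[rotated])
    then show False using negdef_zero[OF ndY x(1)] x(2) by simp
  qed
  show ?thesis
  proof
    fix w assume "w \<in> W"
    obtain p r where pr: "p \<in> span ?E" "r \<in> oc (span ?E)" "w = p + r"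
      using nondeg_decompose[OF negdef_nondeg[OF ndE]] .
    have "r = w - p" using pr by simp
    then have "r \<in> W" using \<open>w \<in> W\<close> pr EW subW subspace_diff by blast
    then have "r \<in> Y" using pr(2) by (simp add: Y_def oc_span)
    then show "w \<in> span ?E" using pr Y0 by simp
  qed
qed

section \<open>Isometries and the subgroup preserving a sheet\<close>

definition isom :: "('v \<Rightarrow> 'v) \<Rightarrow> bool" where
  "isom T \<longleftrightarrow> linear T \<and> (\<forall>x y. B (T x) (T y) = B x y)"

lemma isom_linear: "isom T \<Longrightarrow> linear T"
  by (simp add: isom_def)

lemma isom_B: "isom T \<Longrightarrow> B (T x) (T y) = B x y"
  by (simp add: isom_def)

lemma isom_eq_0: assumes "isom T" shows "T x = 0 \<longleftrightarrow> x = 0"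
proof
  assume "T x = 0"
  then have "B x y = 0" for y using isom_B[OF assms, of x y] by simp
  then show "x = 0" by (rule nondegenerate)
qed (simp add: linear_0[OF isom_linear[OF assms]])

lemma isom_polarize:
  assumes "linear T" "\<And>x. B (T x) (T x) = B x x"
  shows "isom T"
proof -
  have "B (T x) (T y) = B x y" for x y
    using assms(2)[of "x + y"] assms(2)[of x] assms(2)[of y] sym[of y x] sym[of "T y" "T x"]
    by (simp add: linear_add[OF assms(1)])
  then show ?thesis using assms by (simp add: isom_def)
qed

lemma isom_bij: assumes "isom T" shows "bij T"
proof -
  have "inj T" using isom_linear[OF assms] isom_eq_0[OF assms] by (simp add: linear_injective_0)
  then show ?thesis
    using isom_linear[OF assms] by (simp add: bij_def linear_inj_imp_surj)
qed

text \<open>In the presence of HOL-Algebra, plain \<open>inv\<close> denotes the inverse in a group.\<close>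
abbreviation iv :: "('v \<Rightarrow> 'v) \<Rightarrow> 'v \<Rightarrow> 'v" where
  "iv \<equiv> inv_into UNIV"

lemma isom_inv_f [simp]: "isom T \<Longrightarrow> iv T (T x) = x"
  by (simp add: bij_is_inj isom_bij)

lemma isom_f_inv [simp]: "isom T \<Longrightarrow> T (iv T x) = x"
  by (simp add: bij_is_surj isom_bij surj_f_inv_f)

lemma isom_inv: assumes "isom T" shows "isom (iv T)"
proof -
  have "linear (iv T)"
  proof (rule linearI)
    show "iv T (x + y) = iv T x + iv T y" for x y
      using isom_inv_f[OF assms, of "iv T x + iv T y"] assms
      by (simp add: linear_add[OF isom_linear[OF assms]])
    show "iv T (c *\<^sub>R x) = c *\<^sub>R iv T x" for c x
      using isom_inv_f[OF assms, of "c *\<^sub>R iv T x"] assms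
      by (simp add: linear_scale[OF isom_linear[OF assms]])
  qed
  moreover have "B (iv T x) (iv T y) = B x y" for x y
    using isom_B[OF assms, of "iv T x" "iv T y"] assms by simp
  ultimately show ?thesis by (simp add: isom_def)
qed

lemma isom_adjoint: "isom T \<Longrightarrow> B (T x) y = B x (iv T y)"
  using isom_B[of T x "iv T y"] by simp

lemma isom_comp: "isom T \<Longrightarrow> isom U \<Longrightarrow> isom (T \<circ> U)"
  by (simp add: isom_def linear_compose)

lemma isom_uminus: "isom T \<Longrightarrow> isom (\<lambda>x. - T x)"
  by (simp add: isom_def linear_compose_neg)

lemma isom_id: "isom id"
  by (simp add: isom_def linear_id[unfolded id_def[symmetric]])

text \<open>By the reversed Cauchy-Schwarz inequality these are the isometries preserving the sheet of \<open>e0\<close>.\<close>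
definition ortho :: "('v \<Rightarrow> 'v) set" where
  "ortho = {T. isom T \<and> B (T e0) e0 > 0}"

lemma orthoD: "T \<in> ortho \<Longrightarrow> isom T" "T \<in> ortho \<Longrightarrow> linear T" "T \<in> ortho \<Longrightarrow> B (T e0) e0 > 0"
  by (simp_all add: ortho_def isom_linear)

lemma ortho_or_uminus:
  assumes "isom T"
  shows "T \<in> ortho \<or> (\<lambda>x. - T x) \<in> ortho"
proof -
  have "B (T e0) (T e0) = 1" using isom_B[OF assms] e0 by simp
  then have "B (T e0) e0 \<noteq> 0" by (intro causal_e0) auto
  then show ?thesis using assms isom_uminus[OF assms] by (simp add: ortho_def) linarith
qed

lemma ortho_inv: assumes "T \<in> ortho" shows "iv T \<in> ortho"
proof -
  have "isom T" using assms by (rule orthoD)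
  moreover have "B (iv T e0) e0 > 0"
    using orthoD(3)[OF assms] isom_adjoint[OF \<open>isom T\<close>, of e0 e0] sym[of e0 "iv T e0"] by simp
  ultimately show ?thesis using isom_inv by (simp add: ortho_def)
qed

text \<open>Moving \<open>T\<close> across the form turns \<open>B (T x) e0\<close> into the product
  of \<open>x\<close> with the preimage of \<open>e0\<close>, and both lie in the closed future
  cone.\<close>

lemma ortho_future:
  assumes T: "T \<in> ortho" and x: "B x x \<ge> 0" "B x e0 > 0"
  shows "B (T x) e0 > 0"
proof -
  have "B (iv T e0) (iv T e0) = 1"
    using isom_B[OF isom_inv[OF orthoD(1)[OF T]]] e0 by simp
  then have "B x (iv T e0) \<ge> 0"
    using x orthoD(3)[OF ortho_inv[OF T]] by (simp add: future_nonneg)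
  then have "B (T x) e0 \<ge> 0" using isom_adjoint[OF orthoD(1)[OF T]] by simp
  moreover have "B (T x) e0 \<noteq> 0"
  proof (rule causal_e0)
    show "B (T x) (T x) \<ge> 0" unfolding isom_B[OF orthoD(1)[OF T]] by (rule x(1))
    have "x \<noteq> 0" using x(2) by auto
    then show "T x \<noteq> 0" unfolding isom_eq_0[OF orthoD(1)[OF T]] .
  qed
  ultimately show ?thesis by simp
qed

lemma ortho_causal_sign:
  assumes T: "T \<in> ortho" and x: "B x x \<ge> 0" "x \<noteq> 0"
  shows "B (T x) e0 * B x e0 > 0"
proof (cases "B x e0 > 0")
  case True
  then show ?thesis using ortho_future[OF T x(1)] by simp
next
  case False
  then have "B (- x) e0 > 0" using causal_e0[OF x] by simp
  then have "B (T (- x)) e0 > 0" using ortho_future[OF T, of "- x"] x by simp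
  then show ?thesis
    using \<open>B (- x) e0 > 0\<close> by (simp add: linear_neg[OF orthoD(2)[OF T]] mult_neg_neg)
qed

text \<open>This is the form in which preservation of the sheet enters most later arguments: in
  particular, -1 has no causal eigenvector.\<close>

lemma ortho_causal_eigenvalue_pos:
  assumes T: "T \<in> ortho" and x: "B x x \<ge> 0" "x \<noteq> 0" and "T x = r *\<^sub>R x"
  shows "r > 0"
proof -
  have "r * (B x e0)\<^sup>2 > 0"
    using ortho_causal_sign[OF T x] assms(4) by (simp add: power2_eq_square mult.assoc)
  then show ?thesis by (simp add: zero_less_mult_iff)
qed

lemma isom_in_ortho:
  assumes "isom T" "B x x \<ge> 0" "x \<noteq> 0" "T x = r *\<^sub>R x" "r > 0"
  shows "T \<in> ortho"
proof (rule ccontr)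
  assume "T \<notin> ortho"
  then have "(\<lambda>x. - T x) \<in> ortho" using ortho_or_uminus[OF assms(1)] by blast
  from ortho_causal_eigenvalue_pos[OF this assms(2,3), of "- r"]
  show False using assms by simp
qed

lemma ortho_comp: assumes "T \<in> ortho" "U \<in> ortho" shows "T \<circ> U \<in> ortho"
proof -
  have "B (U e0) (U e0) = 1" using isom_B[OF orthoD(1)[OF assms(2)]] e0 by simp
  then have "B (T (U e0)) e0 > 0" using ortho_future[OF assms(1)] orthoD(3)[OF assms(2)] by simp
  then show ?thesis using isom_comp assms by (auto simp: ortho_def)
qed

lemma ortho_id: "id \<in> ortho"
  using isom_id e0 by (simp add: ortho_def)

end

section \<open>Isometries between definite subspaces\<close>

lemma subspace_dim_0_iff: "subspace X \<Longrightarrow> dim X = 0 \<longleftrightarrow> X = {0 :: 'a :: euclidean_space}"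
  using subspace_0[of X] dim_eq_0[of X] by auto

context lorentz
begin

lemma negdef_unit_vector:
  assumes X: "negdef X" "X \<noteq> {0}"
  obtains x where "x \<in> X" "B x x = -1"
proof -
  have subX: "subspace X" using X negdef_subspace by blast
  then obtain x where x: "x \<in> X" "x \<noteq> 0" using X(2) subspace_0[OF subX] by blast
  obtain c where "B (c *\<^sub>R x) (c *\<^sub>R x) = -1" using negdef_unit[OF X(1) x] .
  then show thesis using that subspace_scale[OF subX x(1)] by blast
qed

text \<open>Because \<open>B x x = -1\<close>, removing the component along \<open>x\<close> means
  adding \<open>B v x\<close> times \<open>x\<close>; this explains the signs here and in the
  constructions that follow.\<close>

lemma dim_split_unit:
  assumes X: "subspace X" and x: "x \<in> X" "B x x = -1"
  defines "Y \<equiv> X \<inter> oc {x}"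
  shows "subspace Y" "dim X = dim Y + 1" "\<And>v. v \<in> X \<Longrightarrow> v + B v x *\<^sub>R x \<in> Y"
proof -
  show subY: "subspace Y" unfolding Y_def by (intro subspace_inter X subspace_oc)
  show Yproj: "v + B v x *\<^sub>R x \<in> Y" if "v \<in> X" for v
    using that x X by (simp add: Y_def oc_iff subspace_add subspace_scale)
  have "X = span (insert x Y)"
  proof
    show "span (insert x Y) \<subseteq> X" using x X by (intro span_minimal) (auto simp: Y_def)
    show "X \<subseteq> span (insert x Y)"
    proof
      fix v assume "v \<in> X"
      then have "(v + B v x *\<^sub>R x) - B v x *\<^sub>R x \<in> span (insert x Y)"
        using Yproj by (intro span_diff span_scale) (auto intro: span_base)
      then show "v \<in> span (insert x Y)" by simp
    qed
  qed
  moreover have "x \<notin> span Y" using x subY by (simp add: span_eq_iff[THEN iffD2] Y_def oc_iff)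
  ultimately show "dim X = dim Y + 1" by (metis dim_insert dim_span)
qed

text \<open>Orthonormal bases are matched one vector at a time. The map is linear on the whole space
  but controlled only on \<open>X\<close>, so that it can later be composed with a projection onto
  \<open>X\<close>.\<close>

lemma negdef_isometry:
  assumes "negdef X" "negdef X'" "dim X = dim X'"
  shows "\<exists>f. linear f \<and> f ` X = X' \<and> (\<forall>x\<in>X. B (f x) (f x) = B x x)"
  using assms
proof (induction "dim X" arbitrary: X X')
  case 0
  then have "dim X = 0" "dim X' = 0" by simp_all
  then have "X = {0}" "X' = {0}"
    using subspace_dim_0_iff negdef_subspace[OF 0(2)] negdef_subspace[OF 0(3)] by blast+
  then show ?case by (intro exI[of _ id] conjI isom_linear[OF isom_id]) simp_all
next
  case (Suc d)
  have sub: "subspace X" "subspace X'" using Suc.prems negdef_subspace by auto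
  have ne: "X \<noteq> {0}" "X' \<noteq> {0}"
    using Suc.hyps(2) Suc.prems(3) subspace_dim_0_iff[OF sub(1)] subspace_dim_0_iff[OF sub(2)]
    by (metis nat.distinct(1))+
  obtain x where x: "x \<in> X" "B x x = -1" by (rule negdef_unit_vector[OF Suc.prems(1) ne(1)])
  obtain x' where x': "x' \<in> X'" "B x' x' = -1" by (rule negdef_unit_vector[OF Suc.prems(2) ne(2)])
  define Y where "Y = X \<inter> oc {x}"
  define Y' where "Y' = X' \<inter> oc {x'}"
  note Y = dim_split_unit[OF sub(1) x, folded Y_def] and Y' = dim_split_unit[OF sub(2) x', folded Y'_def]
  have dY: "d = dim Y" "dim Y = dim Y'" using Suc.hyps(2) Suc.prems(3) Y(2) Y'(2) by auto
  have ndY: "negdef Y" "negdef Y'"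
    using negdef_mono[OF Suc.prems(1) Y(1)] negdef_mono[OF Suc.prems(2) Y'(1)] by (auto simp: Y_def Y'_def)
  obtain f where f: "linear f" "f ` Y = Y'" "\<And>y. y \<in> Y \<Longrightarrow> B (f y) (f y) = B y y"
    using Suc.hyps(1)[OF dY(1) ndY dY(2)] by blast
  define g where "g v = f (v + B v x *\<^sub>R x) - B v x *\<^sub>R x'" for v
  have lin: "linear g"
    by (rule linearI) (simp_all add: g_def linear_add[OF f(1)] linear_scale[OF f(1)] algebra_simps)
  have "g v \<in> X' \<and> B (g v) (g v) = B v v" if "v \<in> X" for v
  proof -
    let ?y = "v + B v x *\<^sub>R x"
    have "f ?y \<in> Y'" using f(2) Y(3)[OF that] by blast
    then have fy: "f ?y \<in> X'" "B (f ?y) x' = 0" "B x' (f ?y) = 0" by (auto simp: Y'_def oc_iff sym[of x'])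
    moreover have "B (f ?y) (f ?y) = B ?y ?y" using f(3) Y(3)[OF that] .
    ultimately show ?thesis
      using sub(2) x' x sym[of x v]
      by (simp add: g_def subspace_diff subspace_scale)
  qed
  moreover have "v \<in> g ` X" if v: "v \<in> X'" for v
  proof -
    obtain y where y: "y \<in> Y" "f y = v + B v x' *\<^sub>R x'" using f(2) Y'(3)[OF v] by (metis imageE)
    have yx: "y \<in> X" "B y x = 0" using y(1) by (auto simp: Y_def oc_iff)
    have "g (y - B v x' *\<^sub>R x) = f y - B v x' *\<^sub>R x'"
      using yx x by (simp add: g_def)
    moreover have "y - B v x' *\<^sub>R x \<in> X"
      using sub(1) yx x by (simp add: subspace_diff subspace_add subspace_scale)
    ultimately show ?thesis using y(2) by (metis add_diff_cancel_right' imageI)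
  qed
  ultimately show ?case using lin by (intro exI[of _ g]) blast
qed

text \<open>The form and \<open>J\<close> make \<open>X\<close> a Hermitian space.\<close>
definition cstruct :: "'v set \<Rightarrow> ('v \<Rightarrow> 'v) \<Rightarrow> bool" where
  "cstruct X J \<longleftrightarrow> negdef X \<and> linear J \<and>
     (\<forall>x\<in>X. J x \<in> X \<and> J (J x) = - x \<and> B (J x) (J x) = B x x \<and> B (J x) x = 0)"

text \<open>Polarizing \<open>B (J x) x = 0\<close> makes \<open>J\<close> skew; this keeps the
  complement of a complex line invariant under \<open>J\<close>.\<close>

lemma cstruct_skew:
  assumes "cstruct X J" "x \<in> X" "y \<in> X"
  shows "B (J x) y = - B x (J y)"
proof -
  have J: "\<And>x. x \<in> X \<Longrightarrow> B (J x) x = 0" "linear J" "subspace X"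
    using assms(1) negdef_subspace by (auto simp: cstruct_def)
  have "B (J (x + y)) (x + y) = 0" by (intro J(1) subspace_add J(3) assms(2,3))
  then show ?thesis using J(1)[OF assms(2)] J(1)[OF assms(3)] sym[of "J y" x] by (simp add: linear_add[OF J(2)])
qed

lemma cstruct_split:
  assumes J: "cstruct X J" and x: "x \<in> X" "B x x = -1"
  defines "Y \<equiv> X \<inter> oc {x} \<inter> oc {J x}"
  shows "cstruct Y J" "dim X = dim Y + 2"
    "\<And>v. v \<in> X \<Longrightarrow> v + B v x *\<^sub>R x + B v (J x) *\<^sub>R J x \<in> Y"
proof -
  have JX: "negdef X" "linear J" "subspace X" 
    "\<And>x. x \<in> X \<Longrightarrow> J x \<in> X" "\<And>x. x \<in> X \<Longrightarrow> J (J x) = - x"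
    "\<And>x. x \<in> X \<Longrightarrow> B (J x) (J x) = B x x" "\<And>x. x \<in> X \<Longrightarrow> B (J x) x = 0"
    using J negdef_subspace by (auto simp: cstruct_def)
  have Jx: "J x \<in> X \<inter> oc {x}" "B (J x) (J x) = -1" using JX x by (auto simp: oc_iff)
  note s1 = dim_split_unit[OF JX(3) x] and s2 = dim_split_unit[OF dim_split_unit(1)[OF JX(3) x] Jx]
  have subY: "subspace Y" using s2(1) by (simp add: Y_def)
  show "dim X = dim Y + 2" using s1(2) s2(2) by (simp add: Y_def)
  show "v + B v x *\<^sub>R x + B v (J x) *\<^sub>R J x \<in> Y" if "v \<in> X" for v
    using s2(3)[OF s1(3)[OF that]] JX(7)[OF x(1)] sym[of x "J x"] by (simp add: Y_def)
  have "negdef Y" using negdef_mono[OF JX(1) subY] by (auto simp: Y_def)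
  moreover have "J y \<in> Y" if "y \<in> Y" for y
  proof -
    have y: "y \<in> X" "B y x = 0" "B y (J x) = 0" using that by (auto simp: Y_def oc_iff)
    then show ?thesis
      using cstruct_skew[OF J y(1) x(1)] cstruct_skew[OF J y(1) JX(4)[OF x(1)]] JX(4)[OF y(1)]
      by (simp add: Y_def oc_iff JX(5)[OF x(1)])
  qed
  ultimately show "cstruct Y J" using JX by (auto simp: cstruct_def Y_def)
qed

text \<open>Unitary bases are matched one complex line \<open>span {x, J x}\<close> at a time:
  Hermitian spaces of equal dimension are unitarily equivalent.\<close>

lemma cstruct_isometry:
  assumes "cstruct X J" "cstruct X' J'" "dim X = dim X'"
  shows "\<exists>f. linear f \<and> f ` X = X' \<and> (\<forall>x\<in>X. B (f x) (f x) = B x x \<and> f (J x) = J' (f x))"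
  using assms
proof (induction "dim X" arbitrary: X X' rule: less_induct)
  case less
  have JX: "negdef X" "linear J" "subspace X" 
    "\<And>x. x \<in> X \<Longrightarrow> J x \<in> X" "\<And>x. x \<in> X \<Longrightarrow> J (J x) = - x"
    "\<And>x. x \<in> X \<Longrightarrow> B (J x) (J x) = B x x" "\<And>x. x \<in> X \<Longrightarrow> B (J x) x = 0"
    using less.prems(1) negdef_subspace by (auto simp: cstruct_def)
  have JX': "negdef X'" "linear J'" "subspace X'" 
    "\<And>x. x \<in> X' \<Longrightarrow> J' x \<in> X'" "\<And>x. x \<in> X' \<Longrightarrow> J' (J' x) = - x"
    "\<And>x. x \<in> X' \<Longrightarrow> B (J' x) (J' x) = B x x" "\<And>x. x \<in> X' \<Longrightarrow> B (J' x) x = 0"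
    using less.prems(2) negdef_subspace by (auto simp: cstruct_def)
  show ?case
  proof (cases "X = {0}")
    case True
    then have "X' = {0}" using less.prems(3) subspace_dim_0_iff[OF JX'(3)] by simp
    then show ?thesis using True JX(2) JX'(2)
      by (intro exI[of _ id] conjI isom_linear[OF isom_id]) (simp_all add: linear_0)
  next
    case False
    then have "X' \<noteq> {0}" using less.prems(3) subspace_dim_0_iff[OF JX(3)] by auto
    obtain x where x: "x \<in> X" "B x x = -1" by (rule negdef_unit_vector[OF JX(1) False])
    obtain x' where x': "x' \<in> X'" "B x' x' = -1" by (rule negdef_unit_vector[OF JX'(1) \<open>X' \<noteq> {0}\<close>])
    define Y where "Y = X \<inter> oc {x} \<inter> oc {J x}"
    define Y' where "Y' = X' \<inter> oc {x'} \<inter> oc {J' x'}"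
    note Y = cstruct_split[OF less.prems(1) x, folded Y_def]
    note Y' = cstruct_split[OF less.prems(2) x', folded Y'_def]
    have "dim Y < dim X" "dim Y = dim Y'" using less.prems(3) Y(2) Y'(2) by auto
    obtain f where f: "linear f" "f ` Y = Y'" "\<And>y. y \<in> Y \<Longrightarrow> B (f y) (f y) = B y y"
      "\<And>y. y \<in> Y \<Longrightarrow> f (J y) = J' (f y)"
      using less.hyps[OF \<open>dim Y < dim X\<close> Y(1) Y'(1) \<open>dim Y = dim Y'\<close>] by blast
    define p where "p v = v + B v x *\<^sub>R x + B v (J x) *\<^sub>R J x" for v
    have pY: "p v \<in> Y" if "v \<in> X" for v using Y(3)[OF that] by (simp add: p_def)
    define g where "g v = f (p v) - B v x *\<^sub>R x' - B v (J x) *\<^sub>R J' x'" for v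
    have lin: "linear g"
      by (rule linearI)
        (simp_all add: g_def p_def linear_add[OF f(1)] linear_scale[OF f(1)] algebra_simps)
    have xJ: "B x (J x) = 0" "B (J x) x = 0" "B (J x) (J x) = -1" "J (J x) = - x"
      "B x' (J' x') = 0" "B (J' x') x' = 0" "B (J' x') (J' x') = -1" "J' (J' x') = - x'"
      using JX(5-7)[OF x(1)] JX'(5-7)[OF x'(1)] x(2) x'(2) sym[of x "J x"] sym[of x' "J' x'"] by auto
    have "g v \<in> X' \<and> B (g v) (g v) = B v v \<and> g (J v) = J' (g v)" if v: "v \<in> X" for v
    proof (intro conjI)
      have "f (p v) \<in> Y'" using f(2) pY[OF v] by blast
      then have fp: "f (p v) \<in> X'" "B (f (p v)) x' = 0" "B x' (f (p v)) = 0"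
        "B (f (p v)) (J' x') = 0" "B (J' x') (f (p v)) = 0"
        by (auto simp: Y'_def oc_iff sym[of x'] sym[of "J' x'"])
      show "g v \<in> X'"
        unfolding g_def using fp(1) x' JX'(3,4) by (intro subspace_diff subspace_scale) auto
      have "B (g v) (g v) = B (f (p v)) (f (p v)) - B v x * B v x - B v (J x) * B v (J x)"
        by (simp add: g_def fp xJ x')
      also have "B (f (p v)) (f (p v)) = B (p v) (p v)" using f(3) pY[OF v] .
      also have "B (p v) (p v) = B v v + B v x * B v x + B v (J x) * B v (J x)"
        by (simp add: p_def x xJ sym[of x v] sym[of "J x" v])
      finally show "B (g v) (g v) = B v v" by simp
      have "B (J v) x = - B v (J x)" "B (J v) (J x) = B v x"
        using cstruct_skew[OF less.prems(1) v x(1)] cstruct_skew[OF less.prems(1) v JX(4)[OF x(1)]]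
        by (simp_all add: xJ)
      moreover from this have pJ: "p (J v) = J (p v)"
        by (simp add: p_def linear_add[OF JX(2)] linear_scale[OF JX(2)] xJ)
      ultimately show "g (J v) = J' (g v)"
        by (simp add: pJ f(4)[OF pY[OF v]] g_def linear_diff[OF JX'(2)] linear_scale[OF JX'(2)] xJ)
    qed
    moreover have "v \<in> g ` X" if v: "v \<in> X'" for v
    proof -
      let ?v = "v + B v x' *\<^sub>R x' + B v (J' x') *\<^sub>R J' x'"
      obtain y where y: "y \<in> Y" "f y = ?v" using f(2) Y'(3)[OF v] by (metis imageE)
      have yx: "y \<in> X" "B y x = 0" "B y (J x) = 0" using y(1) by (auto simp: Y_def oc_iff)
      have "g (y - B v x' *\<^sub>R x - B v (J' x') *\<^sub>R J x) = v"
        by (simp add: g_def p_def yx y(2) x xJ)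
      moreover have "y - B v x' *\<^sub>R x - B v (J' x') *\<^sub>R J x \<in> X"
        using JX yx x by (simp add: subspace_diff subspace_scale)
      ultimately show ?thesis by (metis imageI)
    qed
    ultimately show ?thesis using lin by (intro exI[of _ g]) blast
  qed
qed

lemma even_dim_cstruct:
  assumes "cstruct X J"
  shows "even (dim X)"
  using assms
proof (induction "dim X" arbitrary: X rule: less_induct)
  case less
  show ?case
  proof (cases "X = {0}")
    case False
    have "negdef X" using less.prems by (simp add: cstruct_def)
    then obtain x where x: "x \<in> X" "B x x = -1" by (rule negdef_unit_vector[OF _ False])
    note Y = cstruct_split[OF less.prems x]
    show ?thesis using less.hyps[OF _ Y(1)] Y(2) by simp
  qed simp
qed

lemma cstruct_exists:
  assumes "negdef X" "even (dim X)"
  shows "\<exists>J. cstruct X J"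
  using assms
proof (induction "dim X" arbitrary: X rule: less_induct)
  case less
  have subX: "subspace X" using less.prems negdef_subspace by auto
  show ?case
  proof (cases "X = {0}")
    case True
    then show ?thesis
      using less.prems isom_linear[OF isom_id] by (intro exI[of _ id]) (simp add: cstruct_def)
  next
    case False
    obtain x where x: "x \<in> X" "B x x = -1" by (rule negdef_unit_vector[OF less.prems(1) False])
    define Z where "Z = X \<inter> oc {x}"
    note Z = dim_split_unit[OF subX x, folded Z_def]
    have "Z \<noteq> {0}"
    proof
      assume "Z = {0}"
      then have "dim Z = 0" by simp
      then show False using Z(2) less.prems(2) by presburger
    qed
    moreover have "negdef Z" using negdef_mono[OF less.prems(1) Z(1)] by (auto simp: Z_def)
    ultimately obtain y where y: "y \<in> Z" "B y y = -1" using negdef_unit_vector by blast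
    define Y where "Y = Z \<inter> oc {y}"
    note Y = dim_split_unit[OF Z(1) y, folded Y_def]
    have "negdef Y" using negdef_mono[OF less.prems(1) Y(1)] by (auto simp: Y_def Z_def)
    then obtain J where J: "cstruct Y J" using less.hyps[of Y] Y(2) Z(2) less.prems by auto
    have yx: "y \<in> X" "B y x = 0" "B x y = 0" using y sym[of x y] by (auto simp: Z_def oc_iff)
    define p where "p v = v + B v x *\<^sub>R x + B v y *\<^sub>R y" for v
    have pY: "p v \<in> Y" if "v \<in> X" for v using Y(3)[OF Z(3)[OF that]] yx by (simp add: p_def)
    \<comment> \<open>On the new plane this is the quarter turn sending \<open>x\<close> to
      \<open>y\<close> and \<open>y\<close> to \<open>-x\<close>; the signs reflect
      \<open>B x x = B y y = -1\<close>.\<close>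
    define K where "K v = J (p v) - B v x *\<^sub>R y + B v y *\<^sub>R x" for v
    have linJ: "linear J" using J by (simp add: cstruct_def)
    have "linear K"
      by (rule linearI)
        (simp_all add: K_def p_def linear_add[OF linJ] linear_scale[OF linJ] algebra_simps)
    moreover have "K v \<in> X \<and> K (K v) = - v \<and> B (K v) (K v) = B v v \<and> B (K v) v = 0" if v: "v \<in> X" for v
    proof -
      have JY: "J (p v) \<in> Y" "J (J (p v)) = - p v" "B (J (p v)) (J (p v)) = B (p v) (p v)" "B (J (p v)) (p v) = 0"
        using J pY[OF v] by (auto simp: cstruct_def)
      then have Jp: "J (p v) \<in> X" "B (J (p v)) x = 0" "B x (J (p v)) = 0" "B (J (p v)) y = 0" "B y (J (p v)) = 0"
        by (auto simp: Y_def Z_def oc_iff sym[of x] sym[of y])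
      have KX: "K v \<in> X" unfolding K_def using Jp(1) x(1) yx(1) subX
        by (intro subspace_diff subspace_add subspace_scale) auto
      have Kx: "B (K v) x = - B v y" "B (K v) y = B v x"
        using Jp yx x y by (simp_all add: K_def)
      have pK: "p (K v) = J (p v)" unfolding p_def[of "K v"] Kx by (simp add: K_def)
      then have "K (K v) = - v"
        unfolding K_def[of "K v"] Kx pK JY by (simp add: p_def)
      moreover have "B (K v) (K v) = B v v"
      proof -
        have "B (K v) (K v) = B (J (p v)) (J (p v)) - B v x * B v x - B v y * B v y"
          by (simp add: K_def Jp yx x y)
        also have "\<dots> = B (p v) (p v) - B v x * B v x - B v y * B v y" by (simp add: JY)
        also have "\<dots> = B v v" by (simp add: p_def yx x y sym[of x v] sym[of y v])
        finally show ?thesis .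
      qed
      moreover have "B (K v) v = 0"
      proof -
        have xp: "B x (p v) = 0" "B y (p v) = 0" by (simp_all add: p_def yx x y sym[of x v] sym[of y v])
        have "v = p v - B v x *\<^sub>R x - B v y *\<^sub>R y" by (simp add: p_def)
        then have "B (K v) v = B (K v) (p v - B v x *\<^sub>R x - B v y *\<^sub>R y)" by simp
        also have "\<dots> = B (K v) (p v) - B v x * B (K v) x - B v y * B (K v) y"
          by (simp only: B_simps real_scaleR_def)
        also have "\<dots> = B (K v) (p v)" by (simp add: Kx)
        also have "\<dots> = B (J (p v)) (p v) - B v x * B y (p v) + B v y * B x (p v)"
          by (simp add: K_def)
        finally show ?thesis by (simp add: xp JY)
      qed
      ultimately show ?thesis using KX by blast
    qed
    ultimately show ?thesis using less.prems by (intro exI[of _ K]) (simp add: cstruct_def)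
  qed
qed


section \<open>The eigenspaces of \<open>T + T\<^sup>-\<^sup>1\<close>\<close>

lemma dim_orthogonal_sum:
  assumes "finite K" "\<And>k. k \<in> K \<Longrightarrow> nondeg (X k)"
    "\<And>j k x y. j \<in> K \<Longrightarrow> k \<in> K \<Longrightarrow> j \<noteq> k \<Longrightarrow> x \<in> X j \<Longrightarrow> y \<in> X k \<Longrightarrow> B x y = 0"
  shows "dim (span (\<Union>k\<in>K. X k)) = (\<Sum>k\<in>K. dim (X k))"
  using assms
proof (induction K rule: finite_induct)
  case (insert k K)
  let ?U = "\<Union>k\<in>K. X k"
  have nd: "nondeg (X k)" using insert.prems(1) by simp
  have sub: "subspace (X k)" using nd by (simp add: nondeg_def)
  have orth: "X k \<subseteq> oc ?U"
  proof
    fix x assume x: "x \<in> X k"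
    have "B x y = 0" if "j \<in> K" "y \<in> X j" for j y
      by (rule insert.prems(2)[of k j]) (use that x insert.hyps in auto)
    then show "x \<in> oc ?U" by (auto simp: oc_iff)
  qed
  have "X k \<inter> span ?U = {0}"
  proof -
    have "x = 0" if "x \<in> X k" "x \<in> span ?U" for x
    proof -
      have "B x y = 0" if "y \<in> X k" for y
        using orth that \<open>x \<in> span ?U\<close> by (metis ocD(2) oc_span subsetD)
      then have "x \<in> oc (X k)" by (simp add: oc_iff)
      then show ?thesis using nd \<open>x \<in> X k\<close> by (auto simp: nondeg_def)
    qed
    then show ?thesis using subspace_0[OF sub] span_zero by auto
  qed
  then have "dim {x + y |x y. x \<in> X k \<and> y \<in> span ?U} = dim (X k) + dim (span ?U)"
    using dim_sums_Int[OF sub subspace_span[of ?U]] by simp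
  moreover have "span (\<Union>k\<in>insert k K. X k) = {x + y |x y. x \<in> X k \<and> y \<in> span ?U}"
    using sub by (simp add: span_Un span_eq_iff[THEN iffD2])
  moreover have "dim (span ?U) = (\<Sum>k\<in>K. dim (X k))"
    by (rule insert.IH; rule insert.prems[OF insertI2] insert.prems(2)[OF insertI2 insertI2])
  ultimately show ?case using insert.hyps by simp
qed simp

text \<open>The glued map is the sum of the \<open>f k\<close> composed with the projections onto
  the \<open>X k\<close>. Each \<open>f k\<close> preserves squares on its summand, hence products
  by polarization, and the two orthogonality assumptions settle the mixed products.\<close>

lemma glue_isometries:
  assumes K: "finite K" and nd: "\<And>k. k \<in> K \<Longrightarrow> nondeg (X k)"
    and orth: "\<And>j k x y. j \<in> K \<Longrightarrow> k \<in> K \<Longrightarrow> j \<noteq> k \<Longrightarrow> x \<in> X j \<Longrightarrow> y \<in> X k \<Longrightarrow> B x y = 0"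
    and span: "span (\<Union>k\<in>K. X k) = UNIV"
    and f: "\<And>k. k \<in> K \<Longrightarrow> linear (f k)" "\<And>k x. k \<in> K \<Longrightarrow> x \<in> X k \<Longrightarrow> B (f k x) (f k x) = B x x"
    and orth': "\<And>j k x y. j \<in> K \<Longrightarrow> k \<in> K \<Longrightarrow> j \<noteq> k \<Longrightarrow> x \<in> X j \<Longrightarrow> y \<in> X k \<Longrightarrow> B (f j x) (f k y) = 0"
  obtains g where "isom g" "\<And>k x. k \<in> K \<Longrightarrow> x \<in> X k \<Longrightarrow> g x = f k x"
proof -
  have "\<forall>k\<in>K. \<exists>\<pi>. linear \<pi> \<and> (\<forall>v\<in>X k. \<pi> v = v) \<and> (\<forall>v\<in>oc (X k). \<pi> v = 0)"
    using nondeg_projection[OF nd] by metis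
  then obtain \<pi> where \<pi>: "\<And>k. k \<in> K \<Longrightarrow> linear (\<pi> k)" "\<And>k v. k \<in> K \<Longrightarrow> v \<in> X k \<Longrightarrow> \<pi> k v = v"
    "\<And>k v. k \<in> K \<Longrightarrow> v \<in> oc (X k) \<Longrightarrow> \<pi> k v = 0" by metis
  define g where "g v = (\<Sum>k\<in>K. f k (\<pi> k v))" for v
  have "linear (\<lambda>v. f k (\<pi> k v))" if "k \<in> K" for k
    using linear_compose[OF \<pi>(1)[OF that] f(1)[OF that]] by (simp add: o_def)
  then have lin: "linear g" unfolding g_def by (intro linear_compose_sum) auto
  have gf: "g x = f k x" if k: "k \<in> K" and x: "x \<in> X k" for k x
  proof -
    have "f j (\<pi> j x) = (if j = k then f k x else 0)" if j: "j \<in> K" for j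
    proof (cases "j = k")
      case False
      have "x \<in> oc (X j)" unfolding oc_iff using orth[OF k j False[symmetric] x] by blast
      then show ?thesis using \<pi>(3)[OF j] linear_0[OF f(1)[OF j]] False by simp
    qed (simp add: \<pi>(2) k x)
    then have "g x = (\<Sum>j\<in>K. if j = k then f k x else 0)" unfolding g_def by (rule sum.cong[OF refl])
    then show ?thesis using k K by simp
  qed
  have ff: "B (f k x) (f k y) = B x y" if k: "k \<in> K" and xy: "x \<in> X k" "y \<in> X k" for k x y
  proof -
    have "x + y \<in> X k" using nd[OF k] xy by (simp add: nondeg_def subspace_add)
    then have "B (f k (x + y)) (f k (x + y)) = B (x + y) (x + y)" by (rule f(2)[OF k])
    then show ?thesis using f(2)[OF k xy(1)] f(2)[OF k xy(2)] sym[of y x] sym[of "f k y" "f k x"]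
      by (simp add: linear_add[OF f(1)[OF k]])
  qed
  have "bilinear (\<lambda>x y. B (g x) (g y))"
    unfolding bilinear_def by (auto intro!: linearI simp: linear_add[OF lin] linear_scale[OF lin])
  then have "B (g x) (g y) = B x y" for x y
  proof (rule bilinear_eq[OF _ bil, where S = UNIV and T = UNIV])
    show "B (g x) (g y) = B x y" if xy: "x \<in> (\<Union>k\<in>K. X k)" "y \<in> (\<Union>k\<in>K. X k)" for x y
    proof -
      obtain j k where jk: "j \<in> K" "x \<in> X j" "k \<in> K" "y \<in> X k" using xy by blast
      show ?thesis
      proof (cases "j = k")
        case True
        then show ?thesis using ff[OF jk(1,2)] jk gf by simp
      next
        case False
        then show ?thesis using orth[OF jk(1,3) False jk(2,4)] orth'[OF jk(1,3) False jk(2,4)] jk gf by simp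
      qed
    qed
  qed (use span in auto)
  then have "isom g" using lin by (simp add: isom_def)
  then show thesis using gf that by blast
qed

text \<open>For \<open>\<bar>c\<bar> < 2\<close> this is the real form of the eigenspaces for \<open>exp (\<plusminus>i\<theta>)\<close>, \<open>c = 2 cos \<theta>\<close>.\<close>
definition E :: "('v \<Rightarrow> 'v) \<Rightarrow> real \<Rightarrow> 'v set" where
  "E T c = {v. T v + iv T v = c *\<^sub>R v}"

definition fixed :: "('v \<Rightarrow> 'v) \<Rightarrow> 'v set" where
  "fixed T = {v. T v = v}"

definition flipped :: "('v \<Rightarrow> 'v) \<Rightarrow> 'v set" where
  "flipped T = {v. T v = - v}"

text \<open>The values 2 and -2 are left to \<open>fixed\<close> and \<open>flipped\<close>, because
  \<open>E T 2\<close> may contain vectors that \<open>T\<close> moves, such as the middle vector of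
  a parabolic block.\<close>

definition rot :: "('v \<Rightarrow> 'v) \<Rightarrow> real set" where
  "rot T = {c. \<bar>c\<bar> < 2 \<and> E T c \<noteq> {0}}"

lemma subspace_E: assumes "isom T" shows "subspace (E T c)"
proof -
  have lin: "linear (\<lambda>v. T v + iv T v - c *\<^sub>R v)"
    using isom_linear[OF assms] isom_linear[OF isom_inv[OF assms]]
    by (intro linear_compose_sub linear_compose_add linear_scale_self)
  have "E T c = {v. T v + iv T v - c *\<^sub>R v = 0}" by (simp add: E_def)
  then show ?thesis using linear_subspace_kernel[OF lin] by simp
qed

lemma subspace_fixed: "isom T \<Longrightarrow> subspace (fixed T)"
  using isom_linear by (auto simp: subspace_def fixed_def linear_0 linear_add linear_scale)

lemma subspace_flipped: "isom T \<Longrightarrow> subspace (flipped T)"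
  using isom_linear by (auto simp: subspace_def flipped_def linear_0 linear_add linear_scale)

lemma isom_inv_eqI: "isom T \<Longrightarrow> T y = x \<Longrightarrow> iv T x = y"
  by auto

lemma fixed_subset_E: assumes "isom T" shows "fixed T \<subseteq> E T 2"
proof
  fix v assume "v \<in> fixed T"
  then have "T v = v" "iv T v = v" using isom_inv_eqI[OF assms, of v v] by (simp_all add: fixed_def)
  then show "v \<in> E T 2" by (simp add: E_def scaleR_2)
qed

lemma flipped_subset_E: assumes "isom T" shows "flipped T \<subseteq> E T (-2)"
proof
  fix v assume "v \<in> flipped T"
  then have "T v = - v" "iv T v = - v"
    using isom_inv_eqI[OF assms, of "- v" v] isom_linear[OF assms] by (simp_all add: flipped_def linear_neg)
  then show "v \<in> E T (-2)" by (simp add: E_def scaleR_2)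
qed

lemma E_selfadjoint:
  assumes "isom T"
  shows "B (T x + iv T x) y = B x (T y + iv T y)"
  using isom_adjoint[OF assms, of x y] isom_adjoint[OF assms, of y x] sym[of "T y" x] sym[of y "iv T x"]
  by simp

lemma E_orthogonal:
  assumes "isom T" "x \<in> E T c" "y \<in> E T d" "c \<noteq> d"
  shows "B x y = 0"
proof -
  have eq: "T x + iv T x = c *\<^sub>R x" "T y + iv T y = d *\<^sub>R y" using assms(2,3) by (simp_all add: E_def)
  have "c * B x y = d * B x y" using E_selfadjoint[OF assms(1), of x y] unfolding eq by simp
  then show ?thesis using assms(4) by simp
qed

lemma commute_inv:
  assumes "isom T" "\<And>v. h (T v) = T (h v)"
  shows "h (iv T v) = iv T (h v)"
  using isom_inv_eqI[OF assms(1), of "h (iv T v)" "h v"] assms(2)[of "iv T v"] assms(1) by simp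

lemma commute_E:
  assumes "isom T" "isom h" "\<And>v. h (T v) = T (h v)" "v \<in> E T c"
  shows "h v \<in> E T c"
proof -
  have "h (iv T v) = iv T (h v)" by (rule commute_inv[OF assms(1)]) (rule assms(3))
  then have "T (h v) + iv T (h v) = h (T v + iv T v)"
    using assms(3) by (simp add: linear_add[OF isom_linear[OF assms(2)]])
  also have "\<dots> = c *\<^sub>R h v"
    using assms(4) by (simp add: E_def linear_scale[OF isom_linear[OF assms(2)]])
  finally show ?thesis by (simp add: E_def)
qed

lemma T_E: "isom T \<Longrightarrow> v \<in> E T c \<Longrightarrow> T v \<in> E T c"
  by (rule commute_E) auto

lemma E_quadratic:
  assumes "isom T" "v \<in> E T c"
  shows "T (T v) = c *\<^sub>R T v - v" "iv T v = c *\<^sub>R v - T v" "2 * B (T v) v = c * B v v"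
proof -
  have eq: "T v + iv T v = c *\<^sub>R v" using assms(2) by (simp add: E_def)
  then show i: "iv T v = c *\<^sub>R v - T v" by (simp add: algebra_simps)
  have "T (iv T v) = c *\<^sub>R T v - T (T v)"
    unfolding i using isom_linear[OF assms(1)] by (simp add: linear_diff linear_scale)
  then show "T (T v) = c *\<^sub>R T v - v" using assms(1) by (simp add: algebra_simps)
  have "B (iv T v) v = B (T v) v" using isom_adjoint[OF assms(1), of v v] sym by simp
  then have "2 * B (T v) v = B (T v + iv T v) v" by simp
  then show "2 * B (T v) v = c * B v v" unfolding eq by simp
qed

text \<open>Suppose \<open>B v v \<ge> 0\<close>. Then \<open>T v - v\<close> and
  \<open>T v + v\<close> are orthogonal, because \<open>T\<close> is an isometry, and their squares
  \<open>(2 - c) B v v\<close> and \<open>(2 + c) B v v\<close> are nonnegative, so they are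
  parallel. Hence \<open>v\<close> is an eigenvector for some \<open>r > 0\<close> with
  \<open>r^2 - c r + 1 = 0\<close>, impossible as \<open>c < 2\<close>.\<close>

lemma E_negdef:
  assumes T: "T \<in> ortho" and c: "\<bar>c\<bar> < 2"
  shows "negdef (E T c)"
  unfolding negdef_def
proof (intro conjI ballI impI subspace_E orthoD(1)[OF T])
  fix v assume v: "v \<in> E T c" "v \<noteq> 0"
  note T1 = orthoD(1)[OF T]
  show "B v v < 0"
  proof (rule ccontr)
    assume "\<not> B v v < 0"
    then have pos: "B v v \<ge> 0" by simp
    have TT: "B (T v) (T v) = B v v" by (rule isom_B[OF T1])
    have Bc: "2 * B (T v) v = c * B v v" by (rule E_quadratic(3)[OF T1 v(1)])
    have eq: "B (T v - v) (T v - v) = (2 - c) * B v v"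
      using TT Bc sym[of v "T v"] by (simp add: algebra_simps)
    have eq': "B (T v + v) (T v + v) = (2 + c) * B v v"
      using TT Bc sym[of v "T v"] by (simp add: algebra_simps)
    have orth: "B (T v - v) (T v + v) = 0" using TT sym[of v "T v"] by (simp add: algebra_simps)
    have nn: "B (T v + v) (T v + v) \<ge> 0" "B (T v - v) (T v - v) \<ge> 0"
      unfolding eq eq' using pos c by (auto intro: mult_nonneg_nonneg)
    have ne: "T v + v \<noteq> 0"
    proof
      assume "T v + v = 0"
      then have "T v = (-1) *\<^sub>R v" by (simp add: eq_neg_iff_add_eq_0)
      from ortho_causal_eigenvalue_pos[OF T pos v(2) this] show False by simp
    qed
    have "B (T v + v) (T v - v) = 0" using orth sym by simp
    then obtain t where t: "T v - v = t *\<^sub>R (T v + v)"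
      using causal_orthogonal_parallel[OF nn] ne by metis
    have "t \<noteq> 1"
    proof
      assume "t = 1"
      then have "2 *\<^sub>R v = 0" using t by (simp add: scaleR_2 algebra_simps)
      then show False using v(2) by simp
    qed
    have "(1 - t) *\<^sub>R T v = (1 + t) *\<^sub>R v" using t by (simp add: algebra_simps)
    then have "inverse (1 - t) *\<^sub>R ((1 - t) *\<^sub>R T v) = inverse (1 - t) *\<^sub>R ((1 + t) *\<^sub>R v)" by (rule arg_cong)
    moreover have "inverse (1 - t) *\<^sub>R ((1 - t) *\<^sub>R T v) = T v"
      using \<open>t \<noteq> 1\<close> by (simp only: scaleR_scaleR) simp
    moreover define r where "r = inverse (1 - t) * (1 + t)"
    ultimately have r: "T v = r *\<^sub>R v" by simp
    have "r > 0" using ortho_causal_eigenvalue_pos[OF T pos v(2) r] .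
    have "T (T v) = (r * r) *\<^sub>R v" using r orthoD(2)[OF T] by (simp add: linear_scale)
    then have "(r * r - c * r + 1) *\<^sub>R v = 0"
      using E_quadratic(1)[OF T1 v(1)] r by (simp add: algebra_simps)
    then have "r * r - c * r + 1 = 0" using v(2) by simp
    moreover have "c * r < 2 * r" using c \<open>r > 0\<close> by simp
    moreover have "(r - 1)\<^sup>2 \<ge> 0" by simp
    ultimately show False by (simp add: power2_eq_square algebra_simps)
  qed
qed

lemma flipped_negdef:
  assumes T: "T \<in> ortho"
  shows "negdef (flipped T)"
  unfolding negdef_def
proof (intro conjI ballI impI subspace_flipped orthoD(1)[OF T])
  fix v assume v: "v \<in> flipped T" "v \<noteq> 0"
  show "B v v < 0"
    using ortho_causal_eigenvalue_pos[OF T _ v(2), of "-1"] v(1) by (auto simp: flipped_def not_less[symmetric])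
qed

text \<open>The squares \<open>(2 - c) B v v\<close> and \<open>(2 + c) B v v\<close> of
  \<open>T v - v\<close> and \<open>T v + v\<close> are at most 0 inside \<open>W\<close>, which
  bounds \<open>c\<close>; at the ends one of the two vectors is null and therefore zero.\<close>

lemma negdef_eigen:
  assumes T: "isom T" and W: "negdef W" "\<And>w. w \<in> W \<Longrightarrow> T w \<in> W" and v: "v \<in> W" "v \<in> E T c" "v \<noteq> 0"
  shows "\<bar>c\<bar> \<le> 2" "c = 2 \<Longrightarrow> T v = v" "c = -2 \<Longrightarrow> T v = - v"
proof -
  have TT: "B (T v) (T v) = B v v" by (rule isom_B[OF T])
  have Bc: "2 * B (T v) v = c * B v v" by (rule E_quadratic(3)[OF T v(2)])
  have eq: "B (T v - v) (T v - v) = (2 - c) * B v v" "B (T v + v) (T v + v) = (2 + c) * B v v"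
    using TT Bc sym[of v "T v"] by (simp_all add: algebra_simps)
  have in_W: "T v - v \<in> W" "T v + v \<in> W"
    using W v negdef_subspace by (auto intro: subspace_add subspace_diff)
  have "(2 - c) * B v v \<le> 0" "(2 + c) * B v v \<le> 0"
    using negdef_le[OF W(1)] in_W eq by metis+
  then show "\<bar>c\<bar> \<le> 2" using negdefD[OF W(1) v(1,3)] by (auto simp: mult_le_0_iff)
  show "T v = v" if "c = 2"
    using negdef_zero[OF W(1) in_W(1)] eq(1) that by simp
  show "T v = - v" if "c = -2"
    using negdef_zero[OF W(1) in_W(2)] eq(2) that by (simp add: eq_neg_iff_add_eq_0)
qed

text \<open>The spaces \<open>E T c\<close> for different \<open>c\<close> are orthogonal and
  definite, so their dimensions, each at least 1, add up to at most that of the whole space.\<close>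

lemma finite_rot:
  assumes T: "T \<in> ortho"
  shows "finite (rot T)"
proof -
  have "card K \<le> DIM('v)" if K: "K \<subseteq> rot T" "finite K" for K
  proof -
    have E: "negdef (E T c)" "dim (E T c) \<ge> 1" if "c \<in> K" for c
    proof -
      show nd: "negdef (E T c)" using that K E_negdef[OF T] by (auto simp: rot_def)
      have "dim (E T c) \<noteq> 0"
        using subspace_dim_0_iff[OF negdef_subspace[OF nd]] that K by (auto simp: rot_def)
      then show "dim (E T c) \<ge> 1" by linarith
    qed
    have "card K = (\<Sum>c\<in>K. 1)" by simp
    also have "\<dots> \<le> (\<Sum>c\<in>K. dim (E T c))" by (intro sum_mono E)
    also have "\<dots> = dim (span (\<Union>c\<in>K. E T c))"
      by (rule dim_orthogonal_sum[symmetric])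
        (use K E_orthogonal[OF orthoD(1)[OF T]] E negdef_nondeg in auto)
    also have "\<dots> \<le> DIM('v)" by (rule dim_subset_UNIV)
    finally show ?thesis .
  qed
  then show ?thesis using finite_if_finite_subsets_card_bdd by blast
qed

end

section \<open>Linked isometries have conjugate centralizers\<close>

text \<open>Its purpose is to turn equal multisets \<open>lam\<close> into a matching of the
  rotation parameters of two isometries that respects the dimensions.\<close>

lemma image_mset_mset_set_eq_bij:
  assumes "finite A" "finite A'" "image_mset f (mset_set A) = image_mset g (mset_set A')"
  shows "\<exists>\<tau>. bij_betw \<tau> A A' \<and> (\<forall>a\<in>A. g (\<tau> a) = f a)"
  using assms
proof (induction A arbitrary: A' rule: finite_induct)
  case empty
  then have "mset_set A' = {#}" by simp
  then have "A' = {}" using empty.prems(1) by (simp add: mset_set_empty_iff)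
  then show ?case by (simp add: bij_betw_def)
next
  case (insert a A)
  have "f a \<in># image_mset g (mset_set A')"
    unfolding insert.prems(2)[symmetric] using insert.hyps by simp
  then obtain b where b: "b \<in> A'" "g b = f a" using insert.prems(1) by auto
  have "mset_set A' = add_mset b (mset_set (A' - {b}))"
    using b(1) insert.prems(1) by (simp add: mset_set.remove)
  then have "image_mset f (mset_set A) = image_mset g (mset_set (A' - {b}))"
    using insert.prems(2) insert.hyps b(2) by simp
  then obtain \<tau> where \<tau>: "bij_betw \<tau> A (A' - {b})" "\<forall>a\<in>A. g (\<tau> a) = f a"
    using insert.IH[of "A' - {b}"] insert.prems(1) by auto
  have "bij_betw (\<tau>(a := b)) (insert a A) (insert b (A' - {b}))"
    using \<tau>(1) insert.hyps(2) by (auto simp: bij_betw_def inj_on_def)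
  moreover have "insert b (A' - {b}) = A'" using b(1) by blast
  moreover have "\<forall>c\<in>insert a A. g ((\<tau>(a := b)) c) = f c" using \<tau>(2) b(2) by simp
  ultimately show ?case by metis
qed

context lorentz
begin

text \<open>The dimensions are even, so nothing is lost in the division.\<close>
definition lam :: "('v \<Rightarrow> 'v) \<Rightarrow> nat multiset" where
  "lam T = image_mset (\<lambda>c. dim (E T c) div 2) (mset_set (rot T))"

definition centr :: "('v \<Rightarrow> 'v) \<Rightarrow> ('v \<Rightarrow> 'v) set" where
  "centr T = {h \<in> ortho. \<forall>v. h (T v) = T (h v)}"

text \<open>\<open>centr\<close> and \<open>zeq\<close> are \<open>centralizer\<close> and \<open>z_equivalent\<close> for the group on \<open>ortho\<close>.\<close>
definition zeq :: "('v \<Rightarrow> 'v) \<Rightarrow> ('v \<Rightarrow> 'v) \<Rightarrow> bool" where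
  "zeq T T' \<longleftrightarrow> (\<exists>g\<in>ortho. centr T' = (\<lambda>h. g \<circ> h \<circ> iv g) ` centr T)"

text \<open>If \<open>c = 2 cos \<theta>\<close> then \<open>T\<close> acts on \<open>E T c\<close> as \<open>cos \<theta> + sin \<theta> J\<close>.\<close>
definition rotJ :: "('v \<Rightarrow> 'v) \<Rightarrow> real \<Rightarrow> 'v \<Rightarrow> 'v" where
  "rotJ T c x = (1 / sqrt (1 - c\<^sup>2 / 4)) *\<^sub>R (T x - (c / 2) *\<^sub>R x)"

lemma rotJ_sin_pos: "\<bar>c\<bar> < 2 \<Longrightarrow> sqrt (1 - c\<^sup>2 / 4) > (0::real)"
  by (simp add: abs_square_less_1[of "c/2", simplified power_divide, simplified])

text \<open>Completing the square in \<open>T^2 - c T + 1 = 0\<close> on \<open>E T c\<close> gives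
  \<open>(T - c/2)^2 = -(1 - c^2/4)\<close>, so division by the sine of the angle yields a map of
  square -1.\<close>

lemma cstruct_E:
  assumes T: "T \<in> ortho" and c: "\<bar>c\<bar> < 2"
  shows "cstruct (E T c) (rotJ T c)"
proof -
  note T1 = orthoD(1)[OF T] and lin = orthoD(2)[OF T]
  define s where "s = sqrt (1 - c\<^sup>2 / 4)"
  have s: "s > 0" "s * s = 1 - c\<^sup>2 / 4" using rotJ_sin_pos[OF c] by (auto simp: s_def)
  have J: "rotJ T c x = (1 / s) *\<^sub>R (T x - (c / 2) *\<^sub>R x)" for x by (simp add: rotJ_def s_def)
  have linJ: "linear (rotJ T c)"
    unfolding J by (intro linear_compose_scale_right linear_compose_sub linear_scale_self lin)
  have "rotJ T c x \<in> E T c \<and> rotJ T c (rotJ T c x) = - x \<and>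
      B (rotJ T c x) (rotJ T c x) = B x x \<and> B (rotJ T c x) x = 0" if x: "x \<in> E T c" for x
  proof (intro conjI)
    note q = E_quadratic[OF T1 x]
    show "rotJ T c x \<in> E T c"
      unfolding J by (intro subspace_scale subspace_diff subspace_E T1 T_E x)
    have "rotJ T c (rotJ T c x) = (1 / (s * s)) *\<^sub>R (T (T x) - c *\<^sub>R T x + (c\<^sup>2 / 4) *\<^sub>R x)"
      unfolding J by (simp add: linear_diff[OF lin] linear_scale[OF lin] algebra_simps power2_eq_square flip: scaleR_add_left)
    also have "T (T x) - c *\<^sub>R T x + (c\<^sup>2 / 4) *\<^sub>R x = (- (s * s)) *\<^sub>R x"
      by (simp add: q(1) s(2) algebra_simps)
    finally show "rotJ T c (rotJ T c x) = - x" using s(1) by simp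
    have "B (T x - (c / 2) *\<^sub>R x) x = 0" using q(3) by simp
    then show "B (rotJ T c x) x = 0" by (simp add: J)
    have "B (T x - (c / 2) *\<^sub>R x) (T x - (c / 2) *\<^sub>R x) = B (T x) (T x) - c * B (T x) x + (c\<^sup>2 / 4) * B x x"
      using sym[of x "T x"] by (simp add: algebra_simps power2_eq_square)
    also have "c * B (T x) x = c\<^sup>2 / 2 * B x x" using q(3) by (simp add: power2_eq_square)
    finally have "B (T x - (c / 2) *\<^sub>R x) (T x - (c / 2) *\<^sub>R x) = s * s * B x x"
      by (simp add: s(2) isom_B[OF T1] algebra_simps)
    moreover have "B (rotJ T c x) (rotJ T c x) =
        (1 / (s * s)) * B (T x - (c / 2) *\<^sub>R x) (T x - (c / 2) *\<^sub>R x)"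
      unfolding J bilinear_lmul[OF bil] bilinear_rmul[OF bil] by simp
    ultimately show "B (rotJ T c x) (rotJ T c x) = B x x" using s(1) by simp
  qed
  then show ?thesis using E_negdef[OF T c] linJ by (simp add: cstruct_def)
qed

text \<open>A unitary map \<open>f\<close> intertwines the two complex structures. As each isometry
  is cosine plus sine times its structure, \<open>T'\<close> corresponds to an affine function of
  \<open>T\<close> whose slope is the quotient of the two sines, hence nonzero.\<close>

lemma E_isometry:
  assumes T: "T \<in> ortho" "\<bar>c\<bar> < 2" and T': "T' \<in> ortho" "\<bar>c'\<bar> < 2" and dim: "dim (E T c) = dim (E T' c')"
  shows "\<exists>f \<alpha> \<beta>. linear f \<and> f ` E T c = E T' c' \<and> (\<forall>x\<in>E T c. B (f x) (f x) = B x x) \<and>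
    \<beta> \<noteq> 0 \<and> (\<forall>x\<in>E T c. T' (f x) = f (\<alpha> *\<^sub>R x + \<beta> *\<^sub>R T x))"
proof -
  obtain f where f: "linear f" "f ` E T c = E T' c'"
    "\<forall>x\<in>E T c. B (f x) (f x) = B x x \<and> f (rotJ T c x) = rotJ T' c' (f x)"
    using cstruct_isometry[OF cstruct_E[OF T] cstruct_E[OF T'] dim] by blast
  define s where "s = sqrt (1 - c\<^sup>2 / 4)"
  define s' where "s' = sqrt (1 - c'\<^sup>2 / 4)"
  have s: "s > 0" "s' > 0" using rotJ_sin_pos T(2) T'(2) by (simp_all add: s_def s'_def)
  have "T' (f x) = f ((c' / 2 - s' / s * (c / 2)) *\<^sub>R x + (s' / s) *\<^sub>R T x)" if "x \<in> E T c" for x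
  proof -
    have "s' *\<^sub>R rotJ T' c' (f x) = T' (f x) - (c' / 2) *\<^sub>R f x" using s by (simp add: rotJ_def s'_def)
    then have "T' (f x) = (c' / 2) *\<^sub>R f x + s' *\<^sub>R rotJ T' c' (f x)" by (simp add: algebra_simps)
    also have "\<dots> = f ((c' / 2) *\<^sub>R x + s' *\<^sub>R rotJ T c x)"
      using f that by (simp add: linear_add linear_scale)
    also have "(c' / 2) *\<^sub>R x + s' *\<^sub>R rotJ T c x = (c' / 2 - s' / s * (c / 2)) *\<^sub>R x + (s' / s) *\<^sub>R T x"
      by (simp add: rotJ_def s_def[symmetric] algebra_simps)
    finally show ?thesis .
  qed
  moreover have "s' / s \<noteq> 0" using s by simp
  ultimately show ?thesis using f by blast
qed

text \<open>On \<open>X\<close>, up to \<open>g\<close>, the isometry \<open>T'\<close> is a polynomial in \<open>T\<close>; \<open>\<beta> \<noteq> 0\<close> makes the relation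
  symmetric.\<close>
definition link_on :: "('v \<Rightarrow> 'v) \<Rightarrow> ('v \<Rightarrow> 'v) \<Rightarrow> ('v \<Rightarrow> 'v) \<Rightarrow> 'v set \<Rightarrow> bool" where
  "link_on T T' g X \<longleftrightarrow>
     (\<forall>h\<in>centr T. h ` X \<subseteq> X) \<and> (\<forall>h\<in>centr T'. h ` g ` X \<subseteq> g ` X) \<and>
     (\<exists>\<alpha> \<beta>. \<beta> \<noteq> 0 \<and> (\<forall>x\<in>X. T' (g x) = g (\<alpha> *\<^sub>R x + \<beta> *\<^sub>R T x)))"

definition linked :: "('v \<Rightarrow> 'v) \<Rightarrow> ('v \<Rightarrow> 'v) \<Rightarrow> ('v \<Rightarrow> 'v) \<Rightarrow> bool" where
  "linked T T' g \<longleftrightarrow> (\<exists>\<X>. span (\<Union>\<X>) = UNIV \<and> (\<forall>X\<in>\<X>. link_on T T' g X))"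

lemma link_on_inv:
  assumes g: "isom g" and link: "link_on T T' g X"
  shows "link_on T' T (iv g) (g ` X)"
proof -
  note lini = isom_linear[OF isom_inv[OF g]]
  have igg: "iv g ` g ` X = X" using g by (simp add: image_image)
  obtain \<alpha> \<beta> where ab: "\<beta> \<noteq> 0" "\<And>x. x \<in> X \<Longrightarrow> T' (g x) = g (\<alpha> *\<^sub>R x + \<beta> *\<^sub>R T x)"
    using link by (auto simp: link_on_def)
  have "T x = iv g ((- \<alpha> / \<beta>) *\<^sub>R g x + (1 / \<beta>) *\<^sub>R T' (g x))" if "x \<in> X" for x
  proof -
    have "iv g ((- \<alpha> / \<beta>) *\<^sub>R g x + (1 / \<beta>) *\<^sub>R T' (g x)) = (- \<alpha> / \<beta>) *\<^sub>R x + (1 / \<beta>) *\<^sub>R (\<alpha> *\<^sub>R x + \<beta> *\<^sub>R T x)"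
      unfolding ab(2)[OF that] linear_add[OF lini] linear_scale[OF lini] isom_inv_f[OF g] ..
    then show ?thesis using ab(1) by (simp add: scaleR_right_distrib)
  qed
  then have "\<forall>y\<in>g ` X. T (iv g y) = iv g ((- \<alpha> / \<beta>) *\<^sub>R y + (1 / \<beta>) *\<^sub>R T' y)" using g by simp
  moreover have "1 / \<beta> \<noteq> 0" using ab(1) by simp
  ultimately show ?thesis using link unfolding link_on_def igg by blast
qed

lemma linked_inv:
  assumes g: "isom g" and "linked T T' g"
  shows "linked T' T (iv g)"
proof -
  obtain \<X> where X: "span (\<Union>\<X>) = UNIV" "\<And>X. X \<in> \<X> \<Longrightarrow> link_on T T' g X"
    using assms(2) by (auto simp: linked_def)
  have "span (\<Union>((`) g ` \<X>)) = g ` span (\<Union>\<X>)"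
    by (simp add: linear_span_image[OF isom_linear[OF g], symmetric] image_Union)
  then have "span (\<Union>((`) g ` \<X>)) = UNIV" using X(1) isom_bij[OF g] by (simp add: bij_is_surj)
  moreover have "\<forall>Y\<in>(`) g ` \<X>. link_on T' T (iv g) Y" using X(2) link_on_inv[OF g] by blast
  ultimately show ?thesis unfolding linked_def by blast
qed

text \<open>On a subspace \<open>X\<close> of the family, \<open>T'\<close> is up to
  \<open>g\<close> a polynomial in \<open>T\<close>, and \<open>h\<close> commutes with
  \<open>T\<close> and maps \<open>X\<close> into itself; so the conjugate of \<open>h\<close>
  commutes with \<open>T'\<close> on the image of \<open>X\<close>. Since the subspaces span, it
  commutes everywhere.\<close>

lemma linked_centr:
  assumes T: "linear T" "linear T'" and g: "g \<in> ortho" and link: "linked T T' g" and h: "h \<in> centr T"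
  shows "g \<circ> h \<circ> iv g \<in> centr T'"
proof -
  note g1 = orthoD(1)[OF g] and ling = orthoD(2)[OF g]
  have ho: "h \<in> ortho" "\<And>v. h (T v) = T (h v)" using h by (auto simp: centr_def)
  note linh = orthoD(2)[OF ho(1)]
  let ?k = "g \<circ> h \<circ> iv g"
  have ko: "?k \<in> ortho" using g ho(1) by (intro ortho_comp ortho_inv)
  obtain \<X> where X: "span (\<Union>\<X>) = UNIV" "\<And>X. X \<in> \<X> \<Longrightarrow> link_on T T' g X"
    using link by (auto simp: linked_def)
  have "g (h (iv g (T' (g x)))) = T' (g (h x))" for x
  proof -
    have l: "linear (\<lambda>x. g (h (iv g (T' (g x)))))" "linear (\<lambda>x. T' (g (h x)))"
      using linear_compose[OF linear_compose[OF linear_compose[OF linear_compose[OF ling T(2)]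
            orthoD(2)[OF ortho_inv[OF g]]] linh] ling]
        linear_compose[OF linear_compose[OF linh ling] T(2)] by (simp_all add: o_def)
    have "g (h (iv g (T' (g x)))) = T' (g (h x))" if xU: "x \<in> \<Union>\<X>" for x
    proof -
      obtain X where x: "X \<in> \<X>" "x \<in> X" using xU by blast
      obtain \<alpha> \<beta> where ab: "\<And>x. x \<in> X \<Longrightarrow> T' (g x) = g (\<alpha> *\<^sub>R x + \<beta> *\<^sub>R T x)"
        using X(2)[OF x(1)] unfolding link_on_def by blast
      have "h x \<in> X" using X(2)[OF x(1)] h x(2) unfolding link_on_def by blast
      then have "T' (g (h x)) = g (\<alpha> *\<^sub>R h x + \<beta> *\<^sub>R T (h x))" by (rule ab)
      also have "\<dots> = g (h (\<alpha> *\<^sub>R x + \<beta> *\<^sub>R T x))"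
        using ho(2) by (simp add: linear_add[OF linh] linear_scale[OF linh])
      also have "\<dots> = g (h (iv g (T' (g x))))" unfolding ab[OF x(2)] using g1 by simp
      finally show ?thesis by simp
    qed
    then show ?thesis
      using linear_eq_on_span[OF l, of "\<Union>\<X>" x] X(1) by auto
  qed
  from this[of "iv g _"] have "?k (T' y) = T' (?k y)" for y using g1 by simp
  then show ?thesis using ko by (simp add: centr_def)
qed

lemma linked_zeq:
  assumes T: "linear T" "linear T'" and g: "g \<in> ortho" and link: "linked T T' g"
  shows "zeq T T'"
proof -
  note g1 = orthoD(1)[OF g] and gi = ortho_inv[OF g]
  have "centr T' = (\<lambda>h. g \<circ> h \<circ> iv g) ` centr T"
  proof
    show "(\<lambda>h. g \<circ> h \<circ> iv g) ` centr T \<subseteq> centr T'" using linked_centr[OF T g link] by blast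
    show "centr T' \<subseteq> (\<lambda>h. g \<circ> h \<circ> iv g) ` centr T"
    proof
      fix h assume "h \<in> centr T'"
      then have "iv g \<circ> h \<circ> iv (iv g) \<in> centr T"
        using linked_centr[OF T(2,1) gi linked_inv[OF g1 link]] by blast
      moreover have "h = g \<circ> (iv g \<circ> h \<circ> iv (iv g)) \<circ> iv g" using g1 isom_inv[OF g1] by (simp add: fun_eq_iff)
      ultimately show "h \<in> (\<lambda>h. g \<circ> h \<circ> iv g) ` centr T" by blast
    qed
  qed
  then show ?thesis using g by (auto simp: zeq_def)
qed


section \<open>Splitting off a negative definite subspace\<close>

text \<open>Generalized eigenvectors of \<open>T + T\<^sup>-\<^sup>1\<close> of order two are needed only for parabolic isometries.\<close>
definition Gen :: "('v \<Rightarrow> 'v) \<Rightarrow> real \<Rightarrow> 'v set" where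
  "Gen T k = {v. T v + iv T v - k *\<^sub>R v \<in> E T k}"

text \<open>One notion for all three types: \<open>k\<close> is 2 for a fixed line and for a
  parabolic block, and \<open>r + 1 / r > 2\<close> for a hyperbolic plane with eigenvalues
  \<open>r\<close> and \<open>1 / r\<close>.\<close>

definition splitting :: "('v \<Rightarrow> 'v) \<Rightarrow> 'v set \<Rightarrow> real \<Rightarrow> bool" where
  "splitting T P k \<longleftrightarrow>
     subspace P \<and> (\<exists>p\<in>P. B p p > 0) \<and> (\<forall>p\<in>P. T p \<in> P) \<and> 2 \<le> k \<and> P \<subseteq> Gen T k"

text \<open>The index is the eigenvalue of \<open>T + T\<^sup>-\<^sup>1\<close>, except that \<open>3\<close> is a dummy index for \<open>P\<close>.\<close>
definition piece :: "('v \<Rightarrow> 'v) \<Rightarrow> 'v set \<Rightarrow> real \<Rightarrow> 'v set" where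
  "piece T P c = (if c = 3 then P else if c = 2 then fixed T \<inter> oc P
     else if c = -2 then flipped T else E T c)"

text \<open>The indices 2 and -2 are present even when their pieces are zero, so that the pieces of
  two isometries can be matched without asking which of them vanish.\<close>

definition idx :: "('v \<Rightarrow> 'v) \<Rightarrow> real set" where
  "idx T = {3, 2, -2} \<union> rot T"

lemma rot_bounds: "c \<in> rot T \<Longrightarrow> \<bar>c\<bar> < 2"
  by (simp add: rot_def)

lemma rot_neq: "c \<in> rot T \<Longrightarrow> c \<noteq> 3 \<and> c \<noteq> 2 \<and> c \<noteq> -2"
  by (auto dest: rot_bounds)

lemma piece_simps [simp]:
  "piece T P 3 = P" "piece T P 2 = fixed T \<inter> oc P" "piece T P (-2) = flipped T"
  "c \<in> rot T' \<Longrightarrow> piece T P c = E T c"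
  using rot_neq[of c T'] by (auto simp: piece_def)

lemma linear_shift:
  assumes "isom T"
  shows "linear (\<lambda>x. T x + iv T x - c *\<^sub>R x)"
  using isom_linear[OF assms] isom_linear[OF isom_inv[OF assms]]
  by (intro linear_compose_sub linear_compose_add linear_scale_self)

lemma subspace_Gen:
  assumes "isom T"
  shows "subspace (Gen T c)"
  using linear_subspace_vimage[OF linear_shift[OF assms, of c] subspace_E[OF assms]]
  by (simp add: Gen_def vimage_def)

section \<open>The orthogonal decomposition belonging to a splitting\<close>

context
  fixes T P k
  assumes T: "T \<in> ortho" and spl: "splitting T P k"
begin

lemma split_subspace: "subspace P" and split_T: "p \<in> P \<Longrightarrow> T p \<in> P" and split_k: "2 \<le> k"
  and split_Gen: "P \<subseteq> Gen T k"
  using spl by (auto simp: splitting_def)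

lemma split_nondeg: "nondeg P" and split_negdef: "negdef (oc P)"
  using spl timelike_nondeg timelike_oc_negdef by (auto simp: splitting_def)

lemma split_inv: assumes "p \<in> P" shows "iv T p \<in> P"
proof -
  have "inj_on T (span P)" using isom_bij[OF orthoD(1)[OF T]] by (auto simp: bij_def inj_on_def)
  then have "dim (T ` P) = dim P" by (rule dim_image_eq[OF orthoD(2)[OF T]])
  then have "T ` P = P"
    using split_subspace split_T linear_subspace_image[OF orthoD(2)[OF T] split_subspace]
    by (intro subspace_dim_equal) auto
  then obtain q where "q \<in> P" "p = T q" using assms by blast
  then show ?thesis using isom_inv_f[OF orthoD(1)[OF T]] by simp
qed

lemma split_oc: assumes "w \<in> oc P" shows "T w \<in> oc P"
  unfolding oc_iff isom_adjoint[OF orthoD(1)[OF T]] using ocD(1)[OF assms] split_inv by blast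

lemma split_oc_inv: assumes "w \<in> oc P" shows "iv T w \<in> oc P"
  unfolding oc_iff sym[of "iv T w"] isom_adjoint[OF orthoD(1)[OF T], symmetric]
  using ocD(2)[OF assms] split_T by blast

lemma split_shift:
  "p \<in> P \<Longrightarrow> T p + iv T p - c *\<^sub>R p \<in> P" "w \<in> oc P \<Longrightarrow> T w + iv T w - c *\<^sub>R w \<in> oc P"
  using split_subspace subspace_oc split_T split_inv split_oc split_oc_inv
  by (auto intro!: subspace_diff subspace_add subspace_scale)

text \<open>Let \<open>p\<close> be the component of \<open>v\<close> in \<open>P\<close>. Both
  \<open>P\<close> and \<open>oc P\<close> are invariant, so \<open>p\<close> lies in
  \<open>E T c\<close>; as it also lies in \<open>Gen T k\<close>, the vector
  \<open>(c - k) p\<close> lies in \<open>E T k\<close> and in \<open>E T c\<close>, hence is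
  zero.\<close>

lemma split_E_oc: assumes "c \<noteq> k" shows "E T c \<subseteq> oc P"
proof
  fix v assume v: "v \<in> E T c"
  obtain p w where pw: "p \<in> P" "w \<in> oc P" "v = p + w" using nondeg_decompose[OF split_nondeg] .
  let ?N = "\<lambda>x. T x + iv T x - c *\<^sub>R x"
  have "?N p + ?N w = ?N v" using linear_add[OF linear_shift[OF orthoD(1)[OF T]], of p w] pw(3) by simp
  also have "\<dots> = 0" using v by (simp add: E_def)
  finally have "?N p = - ?N w" by (simp only: eq_neg_iff_add_eq_0)
  then have "?N p \<in> oc P" using subspace_neg[OF subspace_oc split_shift(2)[OF pw(2)]] by metis
  then have "?N p \<in> P \<inter> oc P" using split_shift(1)[OF pw(1)] by blast
  then have Np: "T p + iv T p = c *\<^sub>R p" using split_nondeg by (auto simp: nondeg_def)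
  define z where "z = (c - k) *\<^sub>R p"
  have "z \<in> E T k" using split_Gen pw(1) Np by (auto simp: Gen_def z_def algebra_simps)
  moreover have "z \<in> E T c"
    unfolding z_def using Np by (intro subspace_scale subspace_E orthoD(1)[OF T]) (simp add: E_def)
  ultimately have "k *\<^sub>R z = c *\<^sub>R z" by (simp add: E_def)
  then have "p = 0" using assms by (simp add: z_def)
  then show "v \<in> oc P" using pw by simp
qed

lemma split_eigen:
  assumes "w \<in> oc P" "w \<in> E T c" "w \<noteq> 0"
  shows "\<bar>c\<bar> \<le> 2" "c = 2 \<Longrightarrow> w \<in> fixed T" "c = -2 \<Longrightarrow> w \<in> flipped T"
  using negdef_eigen[OF orthoD(1)[OF T] split_negdef split_oc assms]
  by (simp_all add: fixed_def flipped_def)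

text \<open>On the definite space \<open>oc P\<close> the self-adjoint operator
  \<open>T + T^-1\<close> has no proper generalized eigenvectors: \<open>z\<close> satisfies
  \<open>B z z = 0\<close>. So \<open>w\<close> lies in \<open>E T k\<close>, and eigenvalues on
  \<open>oc P\<close> are at most 2 while \<open>k \<ge> 2\<close>.\<close>

lemma Gen_decompose:
  assumes v: "v \<in> Gen T k"
  obtains p w where "p \<in> P" "w \<in> oc P" "w \<in> fixed T" "v = p + w" "k \<noteq> 2 \<Longrightarrow> w = 0"
proof -
  obtain p w where pw: "p \<in> P" "w \<in> oc P" "v = p + w" using nondeg_decompose[OF split_nondeg] .
  have "w = v - p" using pw(3) by simp
  then have "w \<in> Gen T k" using v pw(1) split_Gen subspace_diff[OF subspace_Gen[OF orthoD(1)[OF T]]] by blast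
  define z where "z = T w + iv T w - k *\<^sub>R w"
  have z: "z \<in> E T k" "z \<in> oc P"
    using \<open>w \<in> Gen T k\<close> split_shift(2)[OF pw(2)] by (simp_all add: z_def Gen_def)
  have "B z y = B (T w + iv T w) y - k * B w y" for y by (simp add: z_def)
  then have "B z z = B (T w + iv T w) z - k * B w z" .
  also have "\<dots> = B w (T z + iv T z) - k * B w z" by (simp only: E_selfadjoint[OF orthoD(1)[OF T]])
  also have "T z + iv T z = k *\<^sub>R z" using z by (simp add: E_def)
  finally have "B z z = 0" by simp
  then have "z = 0" using negdef_zero[OF split_negdef z(2)] by simp
  then have w: "w \<in> E T k" by (simp add: z_def E_def)
  have w0: "w = 0" if "k \<noteq> 2"
  proof (rule ccontr)
    assume "w \<noteq> 0"
    then show False using split_eigen(1)[OF pw(2) w] split_k that by simp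
  qed
  have wf: "w \<in> fixed T"
  proof (cases "w = 0")
    case True
    then show ?thesis using subspace_0[OF subspace_fixed[OF orthoD(1)[OF T]]] by simp
  next
    case False
    then show ?thesis using split_eigen(2)[OF pw(2) w] w0 by blast
  qed
  show thesis by (rule that[OF pw(1,2) wf pw(3) w0])
qed

lemma piece_subset:
  assumes "c \<in> idx T" "c \<noteq> 3"
  shows "piece T P c \<subseteq> E T c \<inter> oc P"
proof -
  consider "c = 2" | "c = -2" | "c \<in> rot T" using assms by (auto simp: idx_def)
  then show ?thesis
  proof cases
    case 1
    then show ?thesis using fixed_subset_E[OF orthoD(1)[OF T]] by auto
  next
    case 2
    then show ?thesis using flipped_subset_E[OF orthoD(1)[OF T]] split_E_oc[of c] split_k by auto
  next
    case 3
    then show ?thesis using split_E_oc[of c] split_k rot_bounds[OF 3] by auto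
  qed
qed

lemma piece_subspace: "subspace (piece T P c)"
  using split_subspace subspace_oc subspace_fixed[OF orthoD(1)[OF T]] subspace_flipped[OF orthoD(1)[OF T]]
    subspace_E[OF orthoD(1)[OF T]] by (auto simp: piece_def intro: subspace_inter)

lemma piece_negdef: "c \<in> idx T \<Longrightarrow> c \<noteq> 3 \<Longrightarrow> negdef (piece T P c)"
  using negdef_mono[OF split_negdef piece_subspace] piece_subset by blast

lemma piece_nondeg: "c \<in> idx T \<Longrightarrow> nondeg (piece T P c)"
  using piece_negdef negdef_nondeg split_nondeg by (cases "c = 3") auto

lemma piece_orthogonal:
  assumes "c \<in> idx T" "d \<in> idx T" "c \<noteq> d" "x \<in> piece T P c" "y \<in> piece T P d"
  shows "B x y = 0"
proof -
  consider "c = 3" | "d = 3" | "c \<noteq> 3" "d \<noteq> 3" by blast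
  then show ?thesis
  proof cases
    case 1
    then have "y \<in> oc P" "x \<in> P" using piece_subset[OF assms(2)] assms by auto
    then show ?thesis using ocD(2) by blast
  next
    case 2
    then have "x \<in> oc P" "y \<in> P" using piece_subset[OF assms(1)] assms by auto
    then show ?thesis using ocD(1) by blast
  next
    case 3
    then have "x \<in> E T c" "y \<in> E T d" using piece_subset assms by blast+
    then show ?thesis using E_orthogonal[OF orthoD(1)[OF T]] assms(3) by blast
  qed
qed

text \<open>The spectral theorem is applied to \<open>T + T^-1\<close> on \<open>oc P\<close>; by
  definiteness its eigenvectors for 2 and -2 are already eigenvectors of \<open>T\<close>.\<close>

lemma piece_span: "span (\<Union>c\<in>idx T. piece T P c) = UNIV"
proof -
  let ?U = "\<Union>c\<in>idx T. piece T P c"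
  have "x \<in> span ?U" if x: "x \<in> oc P" "x \<in> E T c" for x c
  proof (cases "x = 0")
    case False
    have "c = 2 \<or> c = -2 \<or> \<bar>c\<bar> < 2" using split_eigen(1)[OF x False] by auto
    then have "\<exists>d\<in>idx T. x \<in> piece T P d"
    proof (elim disjE)
      assume "c = 2"
      then show ?thesis using split_eigen(2)[OF x False] x(1) by (intro bexI[of _ 2]) (auto simp: idx_def)
    next
      assume "c = -2"
      then show ?thesis using split_eigen(3)[OF x False] by (intro bexI[of _ "-2"]) (auto simp: idx_def)
    next
      assume "\<bar>c\<bar> < 2"
      then have "c \<in> rot T" using x(2) False by (auto simp: rot_def)
      then show ?thesis using x(2) by (intro bexI[of _ c]) (auto simp: idx_def)
    qed
    then show ?thesis by (auto intro: span_base)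
  qed (simp add: span_zero)
  then have "{x \<in> oc P. \<exists>c. T x + iv T x = c *\<^sub>R x} \<subseteq> span ?U" by (auto simp: E_def)
  moreover have "oc P \<subseteq> span {x \<in> oc P. \<exists>c. T x + iv T x = c *\<^sub>R x}"
  proof (rule selfadjoint_spectral[OF split_negdef])
    show "linear (\<lambda>x. T x + iv T x)" using linear_shift[OF orthoD(1)[OF T], of 0] by simp
    show "T x + iv T x \<in> oc P" if "x \<in> oc P" for x using split_shift(2)[OF that, of 0] by simp
    show "B (T x + iv T x) y = B x (T y + iv T y)" for x y by (rule E_selfadjoint[OF orthoD(1)[OF T]])
  qed
  ultimately have "oc P \<subseteq> span ?U" using span_minimal[OF _ subspace_span] by (rule_tac order_trans)
  moreover have "P \<subseteq> span ?U" unfolding idx_def by (rule subset_trans[OF _ span_superset]) auto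
  ultimately have "v \<in> span ?U" for v
    by (rule_tac nondeg_decompose[OF split_nondeg, of v]) (auto intro: span_add)
  then show ?thesis by blast
qed

lemma finite_idx: "finite (idx T)"
  using finite_rot[OF T] by (simp add: idx_def)

lemma sum_dim_rot: "(\<Sum>c\<in>rot T. dim (E T c)) = 2 * sum_mset (lam T)"
proof -
  have "dim (E T c) = 2 * (dim (E T c) div 2)" if "c \<in> rot T" for c
    using even_dim_cstruct[OF cstruct_E[OF T rot_bounds[OF that]]] by simp
  then have "(\<Sum>c\<in>rot T. dim (E T c)) = (\<Sum>c\<in>rot T. 2 * (dim (E T c) div 2))" by (intro sum.cong) auto
  then show ?thesis by (simp add: lam_def sum_unfold_sum_mset sum_mset_distrib_left sum_distrib_left[symmetric])
qed

text \<open>By this formula the dimension of the fixed vectors in \<open>oc P\<close> is determined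
  by the other data and is not a separate invariant.\<close>

lemma dim_formula:
  "dim P + dim (fixed T \<inter> oc P) + dim (flipped T) + 2 * sum_mset (lam T) = DIM('v)"
proof -
  have "dim (span (\<Union>c\<in>idx T. piece T P c)) = (\<Sum>c\<in>idx T. dim (piece T P c))"
    by (rule dim_orthogonal_sum) (auto intro: finite_idx piece_nondeg piece_orthogonal)
  then have "DIM('v) = (\<Sum>c\<in>idx T. dim (piece T P c))" by (simp add: piece_span)
  also have "\<dots> = (\<Sum>c\<in>{3,2,-2}. dim (piece T P c)) + (\<Sum>c\<in>rot T. dim (piece T P c))"
    unfolding idx_def using finite_rot[OF T] rot_neq by (intro sum.union_disjoint) auto
  also have "(\<Sum>c\<in>rot T. dim (piece T P c)) = (\<Sum>c\<in>rot T. dim (E T c))"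
    by (intro sum.cong) auto
  also have "\<dots> = 2 * sum_mset (lam T)" by (rule sum_dim_rot)
  finally show ?thesis by simp
qed

end

section \<open>Subspaces preserved by the centralizer\<close>

lemma centr_E: "isom T \<Longrightarrow> h \<in> centr T \<Longrightarrow> h ` E T c \<subseteq> E T c"
  using commute_E[of T h _ c] orthoD(1)[of h] by (auto simp: centr_def)

lemma centr_fixed: "h \<in> centr T \<Longrightarrow> h ` fixed T \<subseteq> fixed T"
  by (clarsimp simp: centr_def fixed_def) metis

lemma centr_flipped: "h \<in> centr T \<Longrightarrow> h ` flipped T \<subseteq> flipped T"
  by (clarsimp simp: centr_def flipped_def) (metis linear_neg orthoD(2))

lemma centr_Gen:
  assumes "isom T" "h \<in> centr T"
  shows "h ` Gen T k \<subseteq> Gen T k"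
proof clarify
  fix v assume v: "v \<in> Gen T k"
  have h: "h \<in> ortho" "\<And>v. h (T v) = T (h v)" using assms(2) by (auto simp: centr_def)
  have "h (iv T v) = iv T (h v)" by (rule commute_inv[OF assms(1)]) (rule h(2))
  then have "T (h v) + iv T (h v) - k *\<^sub>R h v = h (T v + iv T v - k *\<^sub>R v)"
    using h(2) orthoD(2)[OF h(1)] by (simp add: linear_add linear_diff linear_scale)
  then show "h v \<in> Gen T k" using v centr_E[OF assms, of k] by (auto simp: Gen_def)
qed


text \<open>A glued isometry may exchange the two sheets; its negative then preserves them and links
  the same subspaces with the same coefficients.\<close>

lemma linked_uminus:
  assumes T': "linear T'" and link: "linked T T' g"
  shows "linked T T' (\<lambda>x. - g x)"
proof -
  obtain \<X> where X: "span (\<Union>\<X>) = UNIV" "\<And>X. X \<in> \<X> \<Longrightarrow> link_on T T' g X"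
    using link by (auto simp: linked_def)
  have "link_on T T' (\<lambda>x. - g x) X" if XX: "X \<in> \<X>" for X
  proof -
    have "h ` (\<lambda>x. - g x) ` X \<subseteq> (\<lambda>x. - g x) ` X" if h: "h \<in> centr T'" for h
    proof clarify
      fix x assume "x \<in> X"
      then obtain y where "y \<in> X" "h (g x) = g y"
        using X(2)[OF XX] h unfolding link_on_def by blast
      moreover have "linear h" using h orthoD(2) by (simp add: centr_def)
      ultimately show "h (- g x) \<in> (\<lambda>x. - g x) ` X" by (simp add: linear_neg)
    qed
    moreover obtain \<alpha> \<beta> where "\<beta> \<noteq> 0" "\<And>x. x \<in> X \<Longrightarrow> T' (g x) = g (\<alpha> *\<^sub>R x + \<beta> *\<^sub>R T x)"
      using X(2)[OF XX] unfolding link_on_def by blast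
    then have "\<exists>\<alpha> \<beta>. \<beta> \<noteq> 0 \<and> (\<forall>x\<in>X. T' (- g x) = - g (\<alpha> *\<^sub>R x + \<beta> *\<^sub>R T x))"
      by (intro exI[of _ \<alpha>] exI[of _ \<beta>]) (simp add: linear_neg[OF T'])
    ultimately show ?thesis using X(2)[OF XX] unfolding link_on_def by blast
  qed
  then show ?thesis using X(1) by (auto simp: linked_def)
qed

lemma linked_isom_zeq:
  assumes "linear T" "linear T'" "isom g" "linked T T' g"
  shows "zeq T T'"
  using ortho_or_uminus[OF assms(3)] linked_zeq[OF assms(1,2) _ assms(4)]
    linked_zeq[OF assms(1,2) _ linked_uminus[OF assms(2,4)]] by blast

lemma E_subset_Gen: "isom T \<Longrightarrow> E T k \<subseteq> Gen T k"
  using subspace_0[OF subspace_E[of T k]] by (auto simp: Gen_def E_def)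

text \<open>The case \<open>e = -1\<close> exchanges the eigenvalues \<open>1\<close> and \<open>-1\<close>, which is impossible if \<open>k = 2\<close>
  because the eigenvalue \<open>1\<close> then also occurs on \<open>P\<close>.\<close>
theorem splitting_zeq:
  assumes T: "T \<in> ortho" and T': "T' \<in> ortho"
    and spl: "splitting T P k" and spl': "splitting T' P' k'"
    and fP: "linear fP" "fP ` P = P'" "\<And>x. x \<in> P \<Longrightarrow> B (fP x) (fP x) = B x x"
    and \<gamma>: "\<gamma> \<noteq> 0" "\<And>x. x \<in> P \<Longrightarrow> T' (fP x) = fP (\<delta> *\<^sub>R x + \<gamma> *\<^sub>R T x)"
    and lam: "lam T = lam T'"
    and e: "e = 1 \<or> e = (-1::real)"
    and dims: "dim (piece T P 2) = dim (piece T' P' (2 * e))"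
      "dim (piece T P (-2)) = dim (piece T' P' (-2 * e))"
    and kk': "k = 2 \<longleftrightarrow> k' = 2" and k2: "k = 2 \<Longrightarrow> e = 1 \<and> \<delta> = 0 \<and> \<gamma> = 1"
  shows "zeq T T'"
proof -
  note T1 = orthoD(1)[OF T] and T1' = orthoD(1)[OF T'] and lin' = orthoD(2)[OF T']
  obtain \<tau> where \<tau>: "bij_betw \<tau> (rot T) (rot T')"
    "\<And>c. c \<in> rot T \<Longrightarrow> dim (E T' (\<tau> c)) div 2 = dim (E T c) div 2"
    using image_mset_mset_set_eq_bij[OF finite_rot[OF T] finite_rot[OF T'] lam[unfolded lam_def]] by blast
  have \<tau>r: "\<tau> c \<in> rot T'" if "c \<in> rot T" for c using \<tau>(1) that by (auto simp: bij_betw_def)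
  \<comment> \<open>The matching of the pieces: \<open>e = -1\<close> exchanges the eigenspaces for
    1 and -1, and \<open>\<tau>\<close> pairs rotation spaces of equal dimension.\<close>
  define \<sigma> where "\<sigma> c = (if c = 3 then 3 else if c = 2 then 2 * e else if c = -2 then -2 * e else \<tau> c)" for c
  have \<sigma>: "\<sigma> 3 = 3" "\<sigma> 2 = 2 * e" "\<sigma> (-2) = -2 * e" "\<And>c. c \<in> rot T \<Longrightarrow> \<sigma> c = \<tau> c"
    using rot_neq by (auto simp: \<sigma>_def)
  have \<sigma>_idx: "\<sigma> c \<in> idx T'" if "c \<in> idx T" for c
    using that e \<tau>r by (auto simp: idx_def \<sigma>)
  have "inj_on \<sigma> (rot T)" using \<tau>(1) \<sigma>(4) by (auto simp: bij_betw_def inj_on_def)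
  moreover have "\<sigma> c \<in> rot T'" if "c \<in> rot T" for c using that \<tau>r \<sigma>(4) by simp
  then have "\<sigma> ` {3, 2, -2} \<inter> \<sigma> ` rot T = {}" using e rot_neq[of _ T'] by (auto simp: \<sigma>(1-3))
  moreover have "inj_on \<sigma> {3, 2, -2}" using e by (auto simp: \<sigma>(1-3))
  ultimately have inj: "inj_on \<sigma> (idx T)" unfolding idx_def inj_on_Un by blast
  \<comment> \<open>The last clause forces the coefficients 0 and 1 on both \<open>P\<close> and the
    fixed part when \<open>k = 2\<close>, because these two pieces will be linked only through their
    sum.\<close>
  define Q where "Q c f \<alpha> \<beta> \<longleftrightarrow> linear f \<and> f ` piece T P c = piece T' P' (\<sigma> c) \<and>
      (\<forall>x\<in>piece T P c. B (f x) (f x) = B x x) \<and> \<beta> \<noteq> 0 \<and>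
      (\<forall>x\<in>piece T P c. T' (f x) = f (\<alpha> *\<^sub>R x + \<beta> *\<^sub>R T x)) \<and>
      ((c = 3 \<or> c = 2) \<and> k = 2 \<longrightarrow> \<alpha> = 0 \<and> \<beta> = 1)" for c f \<alpha> \<beta>
  have "\<exists>f \<alpha> \<beta>. Q c f \<alpha> \<beta>" if c: "c \<in> idx T" for c
  proof -
    consider "c = 3" | "c = 2" | "c = -2" | "c \<in> rot T" using c by (auto simp: idx_def)
    then show ?thesis
    proof cases
      case 1
      then show ?thesis using fP \<gamma> k2 \<sigma>(1) unfolding Q_def by (intro exI[of _ fP] exI[of _ \<delta>] exI[of _ \<gamma>]) simp
    next
      case 2
      have "negdef (piece T P c)" "negdef (piece T' P' (\<sigma> c))"
        using piece_negdef[OF T spl c] piece_negdef[OF T' spl' \<sigma>_idx[OF c]] 2 e \<sigma>(2) by auto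
      moreover have "dim (piece T P c) = dim (piece T' P' (\<sigma> c))" using dims 2 \<sigma>(2) by simp
      ultimately obtain f where f: "linear f" "f ` piece T P c = piece T' P' (\<sigma> c)"
        "\<forall>x\<in>piece T P c. B (f x) (f x) = B x x" using negdef_isometry by blast
      have "T' y = e *\<^sub>R y" if "y \<in> piece T' P' (\<sigma> c)" for y
        using that e 2 by (auto simp: \<sigma> fixed_def flipped_def)
      then have "T' (f x) = f (0 *\<^sub>R x + e *\<^sub>R T x)" if "x \<in> piece T P c" for x
        using f(1,2) that 2 by (auto simp: fixed_def linear_scale)
      then show ?thesis using f e k2
        unfolding Q_def by (intro exI[of _ f] exI[of _ 0] exI[of _ e]) auto
    next
      case 3
      have "negdef (piece T P c)" "negdef (piece T' P' (\<sigma> c))"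
        using piece_negdef[OF T spl c] piece_negdef[OF T' spl' \<sigma>_idx[OF c]] 3 e \<sigma>(3) by auto
      moreover have "dim (piece T P c) = dim (piece T' P' (\<sigma> c))" using dims 3 \<sigma>(3) by simp
      ultimately obtain f where f: "linear f" "f ` piece T P c = piece T' P' (\<sigma> c)"
        "\<forall>x\<in>piece T P c. B (f x) (f x) = B x x" using negdef_isometry by blast
      have "T' y = - e *\<^sub>R y" if "y \<in> piece T' P' (\<sigma> c)" for y
        using that e 3 by (auto simp: \<sigma> fixed_def flipped_def)
      then have "T' (f x) = f (0 *\<^sub>R x + e *\<^sub>R T x)" if "x \<in> piece T P c" for x
        using f(1,2) that 3 by (auto simp: flipped_def linear_scale linear_neg)
      then show ?thesis using f e 3
        unfolding Q_def by (intro exI[of _ f] exI[of _ 0] exI[of _ e]) auto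
    next
      case 4
      have b: "\<bar>c\<bar> < 2" "\<bar>\<tau> c\<bar> < 2" using rot_bounds 4 \<tau>r by blast+
      have "dim (E T c) = dim (E T' (\<tau> c))"
        using even_dim_cstruct[OF cstruct_E[OF T b(1)]] even_dim_cstruct[OF cstruct_E[OF T' b(2)]] \<tau>(2)[OF 4]
        by (metis dvd_mult_div_cancel)
      from E_isometry[OF T b(1) T' b(2) this] obtain f \<alpha> \<beta> where
        "linear f \<and> f ` E T c = E T' (\<tau> c) \<and> (\<forall>x\<in>E T c. B (f x) (f x) = B x x) \<and>
          \<beta> \<noteq> 0 \<and> (\<forall>x\<in>E T c. T' (f x) = f (\<alpha> *\<^sub>R x + \<beta> *\<^sub>R T x))" by blast
      moreover have "piece T P c = E T c" by (rule piece_simps(4)[OF 4])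
      moreover have "piece T' P' (\<sigma> c) = E T' (\<tau> c)"
        unfolding \<sigma>(4)[OF 4] by (rule piece_simps(4)[OF \<tau>r[OF 4]])
      moreover have "c \<noteq> 3" "c \<noteq> 2" using rot_neq[OF 4] by simp_all
      ultimately show ?thesis unfolding Q_def by (intro exI[of _ f] exI[of _ \<alpha>] exI[of _ \<beta>]) simp
    qed
  qed
  then obtain f \<alpha> \<beta> where Q: "\<And>c. c \<in> idx T \<Longrightarrow> Q c (f c) (\<alpha> c) (\<beta> c)" by metis
  have f: "linear (f c)" "f c ` piece T P c = piece T' P' (\<sigma> c)"
    "\<And>x. x \<in> piece T P c \<Longrightarrow> B (f c x) (f c x) = B x x" "\<beta> c \<noteq> 0"
    "\<And>x. x \<in> piece T P c \<Longrightarrow> T' (f c x) = f c (\<alpha> c *\<^sub>R x + \<beta> c *\<^sub>R T x)"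
    "(c = 3 \<or> c = 2) \<and> k = 2 \<Longrightarrow> \<alpha> c = 0 \<and> \<beta> c = 1" if "c \<in> idx T" for c
    using Q[OF that] unfolding Q_def by blast+
  have orth': "B (f c x) (f d y) = 0"
    if "c \<in> idx T" "d \<in> idx T" "c \<noteq> d" "x \<in> piece T P c" "y \<in> piece T P d" for c d x y
  proof (rule piece_orthogonal[OF T' spl'])
    show "\<sigma> c \<in> idx T'" "\<sigma> d \<in> idx T'" using \<sigma>_idx that by auto
    show "\<sigma> c \<noteq> \<sigma> d" using inj that by (auto simp: inj_on_def)
    show "f c x \<in> piece T' P' (\<sigma> c)" "f d y \<in> piece T' P' (\<sigma> d)" using f(2) that by blast+
  qed
  have "\<exists>g. isom g \<and> (\<forall>c\<in>idx T. \<forall>x\<in>piece T P c. g x = f c x)"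
  proof (rule glue_isometries[of "idx T" "piece T P" f])
    show "finite (idx T)" by (rule finite_idx[OF T spl])
    show "nondeg (piece T P c)" if "c \<in> idx T" for c using that by (rule piece_nondeg[OF T spl])
    show "B x y = 0" if "c \<in> idx T" "d \<in> idx T" "c \<noteq> d" "x \<in> piece T P c" "y \<in> piece T P d" for c d x y
      using that by (rule piece_orthogonal[OF T spl])
    show "span (\<Union>c\<in>idx T. piece T P c) = UNIV" by (rule piece_span[OF T spl])
    show "linear (f c)" if "c \<in> idx T" for c using that by (rule f(1))
    show "B (f c x) (f c x) = B x x" if "c \<in> idx T" "x \<in> piece T P c" for c x using that by (rule f(3))
    show "B (f c x) (f d y) = 0" if "c \<in> idx T" "d \<in> idx T" "c \<noteq> d" "x \<in> piece T P c" "y \<in> piece T P d"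
      for c d x y using that by (rule orth')
    show ?thesis if "isom g" "\<And>c x. c \<in> idx T \<Longrightarrow> x \<in> piece T P c \<Longrightarrow> g x = f c x" for g
      using that by blast
  qed
  then obtain g where g: "isom g" "\<And>c x. c \<in> idx T \<Longrightarrow> x \<in> piece T P c \<Longrightarrow> g x = f c x" by blast
  note ling = isom_linear[OF g(1)]
  have g_image: "g ` piece T P c = piece T' P' (\<sigma> c)" if "c \<in> idx T" for c
    unfolding f(2)[OF that, symmetric] using g(2)[OF that] by (intro image_cong refl)
  have g_rel: "T' (g x) = g (\<alpha> c *\<^sub>R x + \<beta> c *\<^sub>R T x)" if c: "c \<in> idx T" and x: "x \<in> piece T P c" for c x
  proof -
    have "T x \<in> piece T P c"
    proof -
      consider "c = 3" | "c = 2" | "c = -2" | "c \<in> rot T" using c by (auto simp: idx_def)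
      then show ?thesis
      proof cases
        case 4
        then show ?thesis using x T_E[OF T1] by simp
      qed (use x split_T[OF T spl] linear_neg[OF orthoD(2)[OF T]] in \<open>auto simp: fixed_def flipped_def\<close>)
    qed
    then have "\<alpha> c *\<^sub>R x + \<beta> c *\<^sub>R T x \<in> piece T P c"
      using x piece_subspace[OF T spl] by (intro subspace_add subspace_scale) auto
    then show ?thesis using g(2)[OF c] x f(5)[OF c x] by simp
  qed
  have in_idx: "3 \<in> idx T" "2 \<in> idx T" "-2 \<in> idx T" "\<And>c. c \<in> rot T \<Longrightarrow> c \<in> idx T" by (auto simp: idx_def)
  have link_piece: "link_on T T' g (piece T P c)"
    if "c \<in> idx T" "\<And>h. h \<in> centr T \<Longrightarrow> h ` piece T P c \<subseteq> piece T P c"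
      "\<And>h. h \<in> centr T' \<Longrightarrow> h ` piece T' P' (\<sigma> c) \<subseteq> piece T' P' (\<sigma> c)" for c
    unfolding link_on_def g_image[OF that(1)] using that(2,3) g_rel[OF that(1)] f(4)[OF that(1)] by blast
  have link_rot: "link_on T T' g (E T c)" if "c \<in> rot T" for c
    using link_piece[OF in_idx(4)[OF that]]
    unfolding \<sigma>(4)[OF that] piece_simps(4)[OF that] piece_simps(4)[OF \<tau>r[OF that]]
    using centr_E[OF T1] centr_E[OF T1'] by blast
  \<comment> \<open>For \<open>k \<noteq> 2\<close> every fixed vector is orthogonal to
    \<open>P\<close>, so the piece of index 2 is the whole fixed space and hence invariant under the
    centralizer.\<close>
  have fixed_piece: "fixed T \<inter> oc P = fixed T" "fixed T' \<inter> oc P' = fixed T'" if "k \<noteq> 2"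
  proof -
    show "fixed T \<inter> oc P = fixed T"
      using split_E_oc[OF T spl, of 2] fixed_subset_E[OF T1] that by blast
    show "fixed T' \<inter> oc P' = fixed T'"
      using split_E_oc[OF T' spl', of 2] fixed_subset_E[OF T1'] that kk' by blast
  qed
  have e_cases: "\<sigma> (-2) = -2 \<and> \<sigma> 2 = 2 \<or> k \<noteq> 2 \<and> \<sigma> (-2) = 2 \<and> \<sigma> 2 = -2"
    using e k2 unfolding \<sigma>(2,3) by auto
  have "link_on T T' g (piece T P (-2))"
  proof (rule link_piece[OF in_idx(3)])
    show "h ` piece T P (-2) \<subseteq> piece T P (-2)" if "h \<in> centr T" for h
      using centr_flipped[OF that] by simp
    show "h ` piece T' P' (\<sigma> (-2)) \<subseteq> piece T' P' (\<sigma> (-2))" if "h \<in> centr T'" for h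
      using e_cases
    proof (elim disjE conjE)
      assume "\<sigma> (-2) = -2"
      then show ?thesis using centr_flipped[OF that] by simp
    next
      assume "k \<noteq> 2" "\<sigma> (-2) = 2"
      then show ?thesis using centr_fixed[OF that] fixed_piece(2) by simp
    qed
  qed
  then have link_flipped: "link_on T T' g (flipped T)" by simp
  have link_fixed: "link_on T T' g (fixed T)" if k2: "k \<noteq> 2"
  proof -
    have "link_on T T' g (piece T P 2)"
    proof (rule link_piece[OF in_idx(2)])
      show "h ` piece T P 2 \<subseteq> piece T P 2" if "h \<in> centr T" for h
        using centr_fixed[OF that] fixed_piece(1)[OF k2] by simp
      show "h ` piece T' P' (\<sigma> 2) \<subseteq> piece T' P' (\<sigma> 2)" if "h \<in> centr T'" for h
        using e_cases
      proof (elim disjE conjE)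
        assume "\<sigma> 2 = -2"
        then show ?thesis using centr_flipped[OF that] by simp
      next
        assume "\<sigma> 2 = 2"
        then show ?thesis using centr_fixed[OF that] fixed_piece(2)[OF k2] by simp
      qed
    qed
    then show ?thesis using fixed_piece(1)[OF k2] by simp
  qed
  have gP: "g ` P = P'" using g_image[OF in_idx(1)] by (simp add: \<sigma>(1))
  \<comment> \<open>For \<open>k \<noteq> 2\<close> this space is just \<open>P\<close>. For
    \<open>k = 2\<close> the centralizer may mix \<open>P\<close> with the fixed vectors orthogonal
    to it; what is invariant is their sum together, and this is \<open>Gen T 2\<close>.\<close>
  have link_Gen: "link_on T T' g (Gen T k)"
  proof (cases "k = 2")
    case False
    have "Gen T k = P" 
    proof
      show "Gen T k \<subseteq> P"
      proof
        fix v assume "v \<in> Gen T k"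
        then show "v \<in> P" by (rule Gen_decompose[OF T spl]) (use False in simp)
      qed
    qed (rule split_Gen[OF T spl])
    moreover have "Gen T' k' = P'"
    proof
      show "Gen T' k' \<subseteq> P'"
      proof
        fix v assume "v \<in> Gen T' k'"
        then show "v \<in> P'" by (rule Gen_decompose[OF T' spl']) (use False kk' in simp)
      qed
    qed (rule split_Gen[OF T' spl'])
    ultimately show ?thesis
      using link_piece[OF in_idx(1)] centr_Gen[OF T1, of _ k] centr_Gen[OF T1', of _ k'] by (simp add: \<sigma>(1))
  next
    case True
    then have k': "k' = 2" and \<sigma>2: "\<sigma> 2 = 2" using kk' e_cases by auto
    have dec: "\<exists>p\<in>P. \<exists>w\<in>piece T P 2. x = p + w" if "x \<in> Gen T 2" for x
      by (rule Gen_decompose[OF T spl that[folded True]]) auto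
    have dec': "\<exists>p\<in>P'. \<exists>w\<in>piece T' P' 2. x = p + w" if "x \<in> Gen T' 2" for x
      by (rule Gen_decompose[OF T' spl' that[folded k']]) auto
    have sub: "P \<subseteq> Gen T 2" "piece T P 2 \<subseteq> Gen T 2" "P' \<subseteq> Gen T' 2" "piece T' P' 2 \<subseteq> Gen T' 2"
      using split_Gen[OF T spl] split_Gen[OF T' spl'] E_subset_Gen[OF T1, of 2] E_subset_Gen[OF T1', of 2]
        fixed_subset_E[OF T1] fixed_subset_E[OF T1'] by (auto simp: True k')
    have "g ` Gen T 2 = Gen T' 2"
    proof
      show "g ` Gen T 2 \<subseteq> Gen T' 2"
      proof clarify
        fix x assume "x \<in> Gen T 2"
        then obtain p w where pw: "p \<in> P" "w \<in> piece T P 2" "x = p + w" using dec by blast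
        then have "g p \<in> Gen T' 2" "g w \<in> Gen T' 2"
          using gP g_image[OF in_idx(2)] sub \<sigma>2 by auto
        then show "g x \<in> Gen T' 2"
          using subspace_add[OF subspace_Gen[OF T1']] by (simp add: pw(3) linear_add[OF ling])
      qed
      show "Gen T' 2 \<subseteq> g ` Gen T 2"
      proof
        fix y assume "y \<in> Gen T' 2"
        then obtain p' w' where pw': "p' \<in> P'" "w' \<in> piece T' P' 2" "y = p' + w'" using dec' by blast
        then obtain p w where pw: "p \<in> P" "w \<in> piece T P 2" "p' = g p" "w' = g w"
          using gP g_image[OF in_idx(2)] \<sigma>2 by (metis imageE)
        then have "p + w \<in> Gen T 2" using sub subspace_add[OF subspace_Gen[OF T1]] by blast
        then show "y \<in> g ` Gen T 2" unfolding pw'(3) pw(3,4) linear_add[OF ling, symmetric] by (rule imageI)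
      qed
    qed
    moreover have "T' (g x) = g (0 *\<^sub>R x + 1 *\<^sub>R T x)" if x: "x \<in> Gen T 2" for x
    proof -
      obtain p w where pw: "p \<in> P" "w \<in> piece T P 2" "x = p + w" using dec[OF x] by blast
      have "T' (g p) = g (T p)" "T' (g w) = g (T w)"
        using g_rel[OF in_idx(1), of p] g_rel[OF in_idx(2) pw(2)] f(6)[OF in_idx(1)] f(6)[OF in_idx(2)] pw(1) True
        by simp_all
      then show ?thesis using orthoD(2)[OF T] lin' ling by (simp add: pw(3) linear_add)
    qed
    ultimately have "link_on T T' g (Gen T 2)"
      unfolding link_on_def using centr_Gen[OF T1, of _ 2] centr_Gen[OF T1', of _ 2]
      by (intro conjI ballI exI[of _ 0] exI[of _ 1]) simp_all
    then show ?thesis by (simp add: True)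
  qed
  \<comment> \<open>Taking all linked subspaces at once, it remains to see that every piece is
    contained in one of them; for \<open>k = 2\<close> the pieces 3 and 2 are covered by
    \<open>Gen T 2\<close>.\<close>
  define \<X> where "\<X> = {X. link_on T T' g X}"
  have "piece T P c \<subseteq> \<Union>\<X>" if c: "c \<in> idx T" for c
  proof -
    consider "c = 3" | "c = 2" | "c = -2" | "c \<in> rot T" using c by (auto simp: idx_def)
    then show ?thesis
    proof cases
      case 1
      then show ?thesis using link_Gen split_Gen[OF T spl] by (auto simp: \<X>_def)
    next
      case 2
      show ?thesis
      proof (cases "k = 2")
        case True
        then have "piece T P c \<subseteq> Gen T k" using 2 E_subset_Gen[OF T1] fixed_subset_E[OF T1] by auto
        then show ?thesis using link_Gen by (auto simp: \<X>_def)
      next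
        case False
        then show ?thesis using link_fixed 2 by (auto simp: \<X>_def)
      qed
    next
      case 3
      then show ?thesis using link_flipped by (auto simp: \<X>_def)
    next
      case 4
      then show ?thesis using link_rot by (auto simp: \<X>_def)
    qed
  qed
  then have "span (\<Union>c\<in>idx T. piece T P c) \<subseteq> span (\<Union>\<X>)" by (intro span_mono) blast
  then have "span (\<Union>\<X>) = UNIV" using piece_span[OF T spl] by blast
  then have "linked T T' g" unfolding linked_def by (intro exI[of _ \<X>]) (simp add: \<X>_def)
  then show ?thesis using linked_isom_zeq[OF orthoD(2)[OF T] lin' g(1)] by blast
qed

end

section \<open>Isometries with the same centralizer\<close>

lemma subspace_subset_Un:
  assumes "subspace A" "subspace C" "subspace D" "A \<subseteq> C \<union> D"
  shows "A \<subseteq> C \<or> A \<subseteq> D"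
proof (rule ccontr)
  assume "\<not> ?thesis"
  then obtain x y where xy: "x \<in> A" "x \<notin> C" "y \<in> A" "y \<notin> D" by blast
  then have "x \<in> D" "y \<in> C" using assms(4) by auto
  moreover have "x + y \<in> C \<or> x + y \<in> D" using assms xy by (meson UnE subsetD subspace_add)
  ultimately show False
    using subspace_diff[OF assms(2), of "x + y" y] subspace_diff[OF assms(3), of "x + y" x] xy by auto
qed

context lorentz
begin

section \<open>Behaviour under conjugation\<close>

lemma isom_conj: "isom g \<Longrightarrow> isom T \<Longrightarrow> isom (g \<circ> T \<circ> iv g)"
  by (intro isom_comp isom_inv)

lemma ortho_conj: "g \<in> ortho \<Longrightarrow> T \<in> ortho \<Longrightarrow> g \<circ> T \<circ> iv g \<in> ortho"
  by (intro ortho_comp ortho_inv)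

lemma iv_conj:
  assumes "isom g" "isom T"
  shows "iv (g \<circ> T \<circ> iv g) x = g (iv T (iv g x))"
  by (rule isom_inv_eqI[OF isom_conj[OF assms]]) (simp add: assms)

lemma isom_image_Collect: "isom g \<Longrightarrow> g ` {x. P x} = {x. P (iv g x)}"
  by (auto simp: image_iff) (metis isom_f_inv)

lemma conj_E:
  assumes g: "isom g" and T: "isom T"
  shows "E (g \<circ> T \<circ> iv g) c = g ` E T c"
proof -
  have "g (T (iv g x)) + g (iv T (iv g x)) = c *\<^sub>R x \<longleftrightarrow> T (iv g x) + iv T (iv g x) = c *\<^sub>R iv g x" for x
  proof -
    have "g (T (iv g x)) + g (iv T (iv g x)) = g (T (iv g x) + iv T (iv g x))" "c *\<^sub>R x = g (c *\<^sub>R iv g x)"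
      using g isom_linear[OF g] by (simp_all add: linear_add linear_scale)
    then show ?thesis using isom_bij[OF g] by (simp add: bij_def inj_eq)
  qed
  then show ?thesis unfolding E_def isom_image_Collect[OF g] iv_conj[OF g T] by simp
qed

lemma conj_fixed:
  assumes g: "isom g" shows "fixed (g \<circ> T \<circ> iv g) = g ` fixed T"
  unfolding fixed_def isom_image_Collect[OF g] using isom_inv_f[OF g] isom_f_inv[OF g] by (metis comp_apply)

lemma conj_flipped:
  assumes g: "isom g" shows "flipped (g \<circ> T \<circ> iv g) = g ` flipped T"
proof -
  have "g (T (iv g x)) = - x \<longleftrightarrow> T (iv g x) = - iv g x" for x
    using isom_inv_f[OF g, of "T (iv g x)"] isom_f_inv[OF g, of "- x"] 
      linear_neg[OF isom_linear[OF isom_inv[OF g]], of x] by metis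
  then show ?thesis unfolding flipped_def isom_image_Collect[OF g] by simp
qed

lemma dim_isom_image: "isom g \<Longrightarrow> dim (g ` X) = dim X"
  using isom_bij[of g] isom_linear[of g] by (intro dim_image_eq) (auto simp: bij_def intro: inj_on_subset)

lemma conj_lam:
  assumes g: "isom g" and T: "isom T"
  shows "lam (g \<circ> T \<circ> iv g) = lam T"
proof -
  have "g ` X = {0} \<longleftrightarrow> X = {0}" for X
    using isom_eq_0[OF g] by (auto simp: image_iff set_eq_iff) metis+
  then have "rot (g \<circ> T \<circ> iv g) = rot T" by (simp add: rot_def conj_E[OF g T])
  then show ?thesis by (simp add: lam_def conj_E[OF g T] dim_isom_image[OF g])
qed

lemma conj_centr_subset:
  assumes g: "g \<in> ortho" and h: "h \<in> centr T"
  shows "g \<circ> h \<circ> iv g \<in> centr (g \<circ> T \<circ> iv g)"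
  using ortho_conj[OF g, of h] h orthoD(1)[OF g] by (simp add: centr_def)

lemma conj_centr:
  assumes g: "g \<in> ortho"
  shows "centr (g \<circ> T \<circ> iv g) = (\<lambda>h. g \<circ> h \<circ> iv g) ` centr T"
proof
  show "(\<lambda>h. g \<circ> h \<circ> iv g) ` centr T \<subseteq> centr (g \<circ> T \<circ> iv g)" using conj_centr_subset[OF g] by blast
  show "centr (g \<circ> T \<circ> iv g) \<subseteq> (\<lambda>h. g \<circ> h \<circ> iv g) ` centr T"
  proof
    note g1 = orthoD(1)[OF g] and gi = isom_inv[OF orthoD(1)[OF g]]
    fix h assume "h \<in> centr (g \<circ> T \<circ> iv g)"
    then have "iv g \<circ> h \<circ> iv (iv g) \<in> centr (iv g \<circ> (g \<circ> T \<circ> iv g) \<circ> iv (iv g))"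
      by (rule conj_centr_subset[OF ortho_inv[OF g]])
    moreover have "iv g \<circ> (g \<circ> T \<circ> iv g) \<circ> iv (iv g) = T" using g1 gi by (simp add: fun_eq_iff)
    moreover have "h = g \<circ> (iv g \<circ> h \<circ> iv (iv g)) \<circ> iv g" using g1 gi by (simp add: fun_eq_iff)
    ultimately show "h \<in> (\<lambda>h. g \<circ> h \<circ> iv g) ` centr T" by (metis imageI)
  qed
qed

section \<open>Reflections and half-turns in the centralizer\<close>

definition reflection :: "'v \<Rightarrow> 'v \<Rightarrow> 'v" where
  "reflection x v = v - (2 * B v x / B x x) *\<^sub>R x"

text \<open>The sheet is preserved because the image of \<open>e0\<close> has product
  \<open>1 - 2 (B x e0)^2 / B x x \<ge> 1\<close> with \<open>e0\<close>.\<close>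

lemma reflection_ortho:
  assumes "B x x < 0"
  shows "reflection x \<in> ortho"
proof -
  have "linear (reflection x)" by (rule linearI) (simp_all add: reflection_def algebra_simps add_divide_distrib)
  moreover have "B (reflection x v) (reflection x v) = B v v" for v
    using assms sym[of x v] by (simp add: reflection_def field_simps)
  ultimately have "isom (reflection x)" by (rule isom_polarize)
  moreover have "B (reflection x e0) e0 = 1 - 2 * (B x e0)\<^sup>2 / B x x"
    using sym[of e0 x] e0 by (simp add: reflection_def power2_eq_square)
  moreover have "(B x e0)\<^sup>2 / B x x \<le> 0" using assms by (simp add: divide_nonneg_neg)
  ultimately show ?thesis by (simp add: ortho_def)
qed

text \<open>Evaluating the commutation at \<open>x\<close> shows that the reflection negates
  \<open>T x\<close>, so \<open>T x\<close> is a multiple of \<open>x\<close>, and isometry leaves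
  only the factors 1 and -1.\<close>

lemma reflection_centr:
  assumes x: "B x x < 0" and T: "T \<in> ortho"
  shows "reflection x \<in> centr T \<longleftrightarrow> T x = x \<or> T x = - x"
proof
  note T1 = orthoD(1)[OF T] and lin = orthoD(2)[OF T]
  assume "reflection x \<in> centr T"
  then have "reflection x (T x) = T (reflection x x)" by (simp add: centr_def)
  also have "reflection x x = - x" using x by (simp add: reflection_def scaleR_2)
  finally have "2 *\<^sub>R T x = (2 * B (T x) x / B x x) *\<^sub>R x"
    by (simp add: reflection_def linear_neg[OF lin] scaleR_2 algebra_simps)
  then have "(1/2) *\<^sub>R (2 *\<^sub>R T x) = (1/2) *\<^sub>R ((2 * B (T x) x / B x x) *\<^sub>R x)" by (rule arg_cong)
  moreover define r where "r = B (T x) x / B x x"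
  ultimately have r: "T x = r *\<^sub>R x" by simp
  have "B (T x) (T x) = B x x" by (rule isom_B[OF T1])
  then have "r * r = 1" using x unfolding r by (simp add: mult.assoc[symmetric])
  then have "r = 1 \<or> r = -1" by (simp add: square_eq_1_iff)
  then show "T x = x \<or> T x = - x" using r by auto
next
  note T1 = orthoD(1)[OF T] and lin = orthoD(2)[OF T]
  assume "T x = x \<or> T x = - x"
  then obtain e where e: "T x = e *\<^sub>R x" "iv T x = e *\<^sub>R x"
  proof
    assume "T x = x"
    then show ?thesis using that[of 1] isom_inv_eqI[OF T1, of x x] by simp
  next
    assume *: "T x = - x"
    then have "T (- x) = x" by (simp add: linear_neg[OF lin])
    then show ?thesis using that[of "-1"] isom_inv_eqI[OF T1, of "-x" x] * by simp
  qed
  have "reflection x (T v) = T (reflection x v)" for v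
    by (simp add: reflection_def linear_diff[OF lin] linear_scale[OF lin] isom_adjoint[OF T1] e)
  then show "reflection x \<in> centr T" using reflection_ortho[OF x] by (simp add: centr_def)
qed

text \<open>The product of the two reflections is the half-turn in the plane of \<open>x\<close> and \<open>T x\<close>. Whatever
  commutes with all these half-turns preserves every such plane.\<close>
lemma rotation_centr:
  assumes T: "T \<in> ortho" and c: "\<bar>c\<bar> < 2" and x: "x \<in> E T c" "x \<noteq> 0"
  defines "y \<equiv> T x - (c / 2) *\<^sub>R x"
  shows "reflection x \<circ> reflection y \<in> centr T" "B x x < 0" "B y y < 0" "B y x = 0"
    "reflection x (reflection y v) = v - (2 * B v x / B x x) *\<^sub>R x - (2 * B v y / B y y) *\<^sub>R y"
proof -
  note T1 = orthoD(1)[OF T] and lin = orthoD(2)[OF T]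
  note q = E_quadratic[OF T1 x(1)]
  \<comment> \<open>The squared sine of the rotation angle; it is the ratio of the squares of
    \<open>y\<close> and \<open>x\<close>.\<close>
  define m where "m = 1 - c\<^sup>2 / 4"
  have m: "m > 0" using rotJ_sin_pos[OF c] by (simp add: m_def)
  show xx: "B x x < 0" by (rule negdefD[OF E_negdef[OF T c] x])
  show yx: "B y x = 0" using q(3) by (simp add: y_def)
  have yy: "B y y = m * B x x"
  proof -
    have "B y y = B y (T x)" using yx by (simp add: y_def)
    also have "\<dots> = B (T x) (T x) - c / 2 * B x (T x)" by (simp add: y_def)
    also have "\<dots> = B x x - c / 2 * (c / 2 * B x x)" using q(3) sym[of x "T x"] isom_B[OF T1] by simp
    finally show ?thesis by (simp add: m_def algebra_simps power2_eq_square)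
  qed
  then show yy0: "B y y < 0" using m xx by (simp add: mult_pos_neg)
  show formula: "reflection x (reflection y v) = v - (2 * B v x / B x x) *\<^sub>R x - (2 * B v y / B y y) *\<^sub>R y" for v
    using yx by (simp add: reflection_def)
  have Tx: "T x = (c / 2) *\<^sub>R x + y" by (simp add: y_def)
  have Ty: "T y = (c / 2) *\<^sub>R y - m *\<^sub>R x"
  proof -
    have "T y = T (T x) - (c / 2) *\<^sub>R T x" by (simp add: y_def linear_diff[OF lin] linear_scale[OF lin])
    also have "\<dots> = (c / 2) *\<^sub>R T x - x" by (simp add: q(1) algebra_simps flip: scaleR_add_left)
    also have "\<dots> = (c / 2) *\<^sub>R y - m *\<^sub>R x" by (simp add: Tx m_def algebra_simps power2_eq_square)
    finally show ?thesis .
  qed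
  have ix: "iv T x = (c / 2) *\<^sub>R x - y" unfolding q(2) Tx by (simp add: algebra_simps flip: scaleR_add_left)
  have iy: "iv T y = m *\<^sub>R x + (c / 2) *\<^sub>R y"
  proof (rule isom_inv_eqI[OF T1])
    have "T (m *\<^sub>R x + (c / 2) *\<^sub>R y) = (m + c\<^sup>2 / 4) *\<^sub>R y"
      by (simp add: linear_add[OF lin] linear_scale[OF lin] Tx Ty algebra_simps power2_eq_square)
    then show "T (m *\<^sub>R x + (c / 2) *\<^sub>R y) = y" by (simp add: m_def)
  qed
  \<comment> \<open>Both sides are \<open>T v\<close> minus a vector in the plane of
    \<open>x\<close> and \<open>y\<close>; the coefficients agree because
    \<open>B y y = m * B x x\<close>.\<close>
  have "reflection x (reflection y (T v)) = T (reflection x (reflection y v))" for v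
  proof -
    define a where "a = B v x"
    define b where "b = B v y"
    have L: "reflection x (reflection y (T v)) = T v - (2 * (c / 2 * a - b) / B x x) *\<^sub>R x
        - (2 * (m * a + c / 2 * b) / B y y) *\<^sub>R y"
      unfolding formula isom_adjoint[OF T1] ix iy by (simp add: a_def b_def)
    have R: "T (reflection x (reflection y v)) = T v - (2 * a / B x x) *\<^sub>R ((c / 2) *\<^sub>R x + y)
        - (2 * b / B y y) *\<^sub>R ((c / 2) *\<^sub>R y - m *\<^sub>R x)"
      unfolding formula a_def b_def by (simp add: linear_diff[OF lin] linear_scale[OF lin] Tx Ty)
    have S: "(2 * a / B x x) *\<^sub>R ((c / 2) *\<^sub>R x + y) + (2 * b / B y y) *\<^sub>R ((c / 2) *\<^sub>R y - m *\<^sub>R x)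
      = (2 * a / B x x * (c / 2) - 2 * b / B y y * m) *\<^sub>R x + (2 * a / B x x + 2 * b / B y y * (c / 2)) *\<^sub>R y"
      by (simp add: algebra_simps)
    have coeffs: "2 * a / B x x * (c / 2) - 2 * b / B y y * m = 2 * (c / 2 * a - b) / B x x"
      "2 * a / B x x + 2 * b / B y y * (c / 2) = 2 * (m * a + c / 2 * b) / B y y"
      using m xx by (simp_all add: yy field_simps)
    show ?thesis unfolding L R diff_diff_eq S coeffs ..
  qed
  then show "reflection x \<circ> reflection y \<in> centr T"
    using ortho_comp[OF reflection_ortho[OF xx] reflection_ortho[OF yy0]] by (simp add: centr_def)
qed

section \<open>Recovering the rotation spaces from the centralizer\<close>

context
  fixes T T'
  assumes T: "T \<in> ortho" and T': "T' \<in> ortho" and same: "centr T = centr T'"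
begin

lemma same_commute: "T' (T v) = T (T' v)"
proof -
  have "T' \<in> centr T" using T' same by (simp add: centr_def)
  then show ?thesis by (simp add: centr_def)
qed

lemma same_E_invariant: "x \<in> E T c \<Longrightarrow> T' x \<in> E T c" "x \<in> E T c \<Longrightarrow> iv T' x \<in> E T c"
proof -
  show "x \<in> E T c \<Longrightarrow> T' x \<in> E T c"
    by (rule commute_E[OF orthoD(1)[OF T] orthoD(1)[OF T'] same_commute])
  show "x \<in> E T c \<Longrightarrow> iv T' x \<in> E T c"
  proof (rule commute_E[OF orthoD(1)[OF T] isom_inv[OF orthoD(1)[OF T']]])
    show "iv T' (T v) = T (iv T' v)" for v
      by (rule commute_inv[OF orthoD(1)[OF T'], symmetric]) (rule same_commute[symmetric])
  qed
qed

lemma same_reflection: "B x x < 0 \<Longrightarrow> T x = x \<or> T x = - x \<longleftrightarrow> T' x = x \<or> T' x = - x"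
  using reflection_centr[of x T] reflection_centr[of x T'] T T' same by simp

text \<open>The half-turn commutes with \<open>T'\<close>, hence with \<open>T' + T'^-1\<close>, and
  sends \<open>x\<close> to \<open>-x\<close>; so \<open>z\<close> lies in the plane of
  \<open>x\<close> and \<open>y\<close>. Since \<open>T' + T'^-1\<close> is self-adjoint and
  commutes with \<open>T\<close>, moving \<open>T\<close> across the form gives
  \<open>B z y = 0\<close>, which leaves a multiple of \<open>x\<close>.\<close>

lemma same_E_eigenvector:
  assumes c: "\<bar>c\<bar> < 2" and x: "x \<in> E T c" "x \<noteq> 0"
  obtains d where "x \<in> E T' d"
proof -
  define y where "y = T x - (c / 2) *\<^sub>R x"
  note rho = rotation_centr[OF T c x, folded y_def]
  note T1 = orthoD(1)[OF T] and T1' = orthoD(1)[OF T']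
  define z where "z = T' x + iv T' x"
  let ?\<rho> = "reflection x \<circ> reflection y"
  have "?\<rho> \<in> centr T'" using rho(1) same by simp
  then have \<rho>: "?\<rho> \<in> ortho" "\<And>v. ?\<rho> (T' v) = T' (?\<rho> v)" by (simp_all add: centr_def)
  have \<rho>i: "?\<rho> (iv T' v) = iv T' (?\<rho> v)" for v by (rule commute_inv[OF T1']) (rule \<rho>(2))
  note lin\<rho> = orthoD(2)[OF \<rho>(1)]
  have "?\<rho> x = - x" using rho(2,4) rho(5)[of x] sym[of x y] by (simp add: scaleR_2)
  then have "?\<rho> z = T' (- x) + iv T' (- x)"
    unfolding z_def linear_add[OF lin\<rho>] \<rho>(2) \<rho>i by simp
  also have "\<dots> = - z"
    using orthoD(2)[OF T'] orthoD(2)[OF ortho_inv[OF T']] by (simp add: z_def linear_neg)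
  finally have "z - (2 * B z x / B x x) *\<^sub>R x - (2 * B z y / B y y) *\<^sub>R y = - z" using rho(5) by simp
  moreover have "B z y = 0"
  proof -
    have sa: "B z v = B x (T' v + iv T' v)" for v unfolding z_def by (rule E_selfadjoint[OF T1'])
    have "iv T' (T v) = T (iv T' v)" for v
      by (rule commute_inv[OF T1', symmetric]) (rule same_commute[symmetric])
    then have Tz: "T' (T x) + iv T' (T x) = T z"
      by (simp add: same_commute z_def linear_add[OF orthoD(2)[OF T]])
    have "B z (T x) = B x (T z)" using sa[of "T x"] unfolding Tz .
    also have "\<dots> = B z (iv T x)" using isom_adjoint[OF T1, of z x] sym[of x "T z"] by simp
    also have "\<dots> = c * B z x - B z (T x)" unfolding E_quadratic(2)[OF T1 x(1)] by simp
    finally show ?thesis by (simp add: y_def)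
  qed
  ultimately have "2 *\<^sub>R z = (2 * B z x / B x x) *\<^sub>R x" by (simp add: scaleR_2 algebra_simps)
  then have "(1/2) *\<^sub>R (2 *\<^sub>R z) = (1/2) *\<^sub>R ((2 * B z x / B x x) *\<^sub>R x)" by (rule arg_cong)
  then have "z = (B z x / B x x) *\<^sub>R x" by simp
  then show thesis using that unfolding E_def z_def by blast
qed

text \<open>Every vector of \<open>E T c\<close> is an eigenvector of \<open>T' + T'^-1\<close>, so
  only one eigenvalue \<open>d\<close> occurs: vectors with different eigenvalues are orthogonal,
  and their sum could not be an eigenvector. Definiteness gives
  \<open>\<bar>d\<bar> \<le> 2\<close>, and \<open>d\<close> is neither 2 nor -2, since otherwise
  the reflection in \<open>x0\<close> would commute with \<open>T'\<close> but not with
  \<open>T\<close>.\<close>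

lemma same_E_subset:
  assumes c: "c \<in> rot T"
  obtains d where "d \<in> rot T'" "E T c \<subseteq> E T' d"
proof -
  note cb = rot_bounds[OF c] and T1' = orthoD(1)[OF T']
  note nd = E_negdef[OF T cb] and sub = subspace_E[OF orthoD(1)[OF T], of c]
  obtain x0 where x0: "x0 \<in> E T c" "x0 \<noteq> 0" using c subspace_0[OF sub] by (auto simp: rot_def)
  obtain d where d: "x0 \<in> E T' d" using same_E_eigenvector[OF cb x0] .
  have "x \<in> E T' d" if x: "x \<in> E T c" "x \<noteq> 0" "x \<noteq> - x0" for x
  proof -
    obtain d1 where d1: "x \<in> E T' d1" using same_E_eigenvector[OF cb x(1,2)] .
    have "x + x0 \<in> E T c" "x + x0 \<noteq> 0"
      using x x0 subspace_add[OF sub] by (auto simp: eq_neg_iff_add_eq_0)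
    then obtain d2 where d2: "x + x0 \<in> E T' d2" by (rule same_E_eigenvector[OF cb])
    have neg: "B x x < 0" "B x0 x0 < 0" using negdefD[OF nd x(1,2)] negdefD[OF nd x0] .
    have "d1 = d"
    proof (rule ccontr)
      assume "d1 \<noteq> d"
      then have o: "B x x0 = 0" "B x0 x = 0" using E_orthogonal[OF T1' d1 d] sym[of x0 x] by auto
      have "d2 = d1" using E_orthogonal[OF T1' d2 d1] o neg by fastforce
      moreover have "d2 = d" using E_orthogonal[OF T1' d2 d] o neg by fastforce
      ultimately show False using \<open>d1 \<noteq> d\<close> by simp
    qed
    then show ?thesis using d1 by simp
  qed
  moreover have "- x0 \<in> E T' d" "0 \<in> E T' d"
    using d subspace_neg[OF subspace_E[OF T1']] subspace_0[OF subspace_E[OF T1']] by auto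
  ultimately have subset: "E T c \<subseteq> E T' d" by blast
  have "\<bar>d\<bar> < 2"
  proof -
    have not_real: "\<not> (T' x0 = x0 \<or> T' x0 = - x0)"
    proof
      assume "T' x0 = x0 \<or> T' x0 = - x0"
      then have "T x0 = x0 \<or> T x0 = - x0" using same_reflection[OF negdefD[OF nd x0]] by blast
      then have "x0 \<in> E T 2 \<or> x0 \<in> E T (-2)"
        using fixed_subset_E[OF orthoD(1)[OF T]] flipped_subset_E[OF orthoD(1)[OF T]]
        by (auto simp: fixed_def flipped_def)
      then have "c *\<^sub>R x0 = 2 *\<^sub>R x0 \<or> c *\<^sub>R x0 = (-2) *\<^sub>R x0" using x0(1) by (auto simp: E_def)
      then show False using x0(2) cb by (auto simp: scaleR_cancel_right simp del: scaleR_minus_left)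
    qed
    note e = negdef_eigen[OF T1' nd same_E_invariant(1) x0(1) d x0(2)]
    show ?thesis using e not_real by fastforce
  qed
  then have "d \<in> rot T'" using d x0(2) by (auto simp: rot_def)
  then show thesis using that subset by blast
qed

end

lemma E_inj:
  assumes "x \<in> E T c" "x \<in> E T d" "x \<noteq> 0"
  shows "c = d"
  using assms by (auto simp: E_def)

text \<open>Applying the inclusion in both directions puts \<open>E T c\<close> inside some
  \<open>E T' d\<close> inside some \<open>E T c'\<close>; a common nonzero vector forces
  \<open>c = c'\<close>, so the two families of subspaces coincide.\<close>

lemma same_centr_lam:
  assumes T: "T \<in> ortho" and T': "T' \<in> ortho" and same: "centr T = centr T'"
  shows "lam T = lam T'"
proof -
  have rot_vec: "\<exists>x. x \<in> E S c \<and> x \<noteq> 0" if "S \<in> ortho" "c \<in> rot S" for S c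
    using that subspace_0[OF subspace_E[OF orthoD(1)[OF that(1)], of c]] by (auto simp: rot_def)
  have eq: "\<exists>d\<in>rot S'. E S c = E S' d"
    if S: "S \<in> ortho" "S' \<in> ortho" "centr S = centr S'" "c \<in> rot S" for S S' c
  proof -
    obtain d where d: "d \<in> rot S'" "E S c \<subseteq> E S' d" using same_E_subset[OF S] .
    obtain c' where c': "c' \<in> rot S" "E S' d \<subseteq> E S c'" using same_E_subset[OF S(2,1) S(3)[symmetric] d(1)] .
    obtain x where "x \<in> E S c" "x \<noteq> 0" using rot_vec[OF S(1,4)] by blast
    then have "c = c'" using d c' E_inj by blast
    then show ?thesis using d c' by blast
  qed
  obtain \<tau> where \<tau>: "\<And>c. c \<in> rot T \<Longrightarrow> \<tau> c \<in> rot T'" "\<And>c. c \<in> rot T \<Longrightarrow> E T c = E T' (\<tau> c)"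
    using eq[OF T T' same] by metis
  have "inj_on \<tau> (rot T)"
  proof (rule inj_onI)
    fix c d assume cd: "c \<in> rot T" "d \<in> rot T" "\<tau> c = \<tau> d"
    obtain x where "x \<in> E T c" "x \<noteq> 0" using rot_vec[OF T cd(1)] by blast
    then show "c = d" using \<tau>(2)[OF cd(1)] \<tau>(2)[OF cd(2)] cd(3) E_inj by metis
  qed
  moreover have "\<tau> ` rot T = rot T'"
  proof
    show "\<tau> ` rot T \<subseteq> rot T'" using \<tau>(1) by blast
    show "rot T' \<subseteq> \<tau> ` rot T"
    proof
      fix d assume d: "d \<in> rot T'"
      obtain c where c: "c \<in> rot T" "E T' d = E T c" using eq[OF T' T same[symmetric] d] by blast
      obtain x where "x \<in> E T' d" "x \<noteq> 0" using rot_vec[OF T' d] by blast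
      then have "d = \<tau> c" using c \<tau>(2)[OF c(1)] E_inj by metis
      then show "d \<in> \<tau> ` rot T" using c(1) by blast
    qed
  qed
  ultimately have "mset_set (rot T') = image_mset \<tau> (mset_set (rot T))" by (simp add: image_mset_mset_set)
  then show ?thesis
    using \<tau>(2) by (simp add: lam_def multiset.map_comp o_def) (auto intro: image_mset_cong simp: finite_rot[OF T])
qed

text \<open>If \<open>T v = - v\<close> but \<open>T' v = v\<close>, then \<open>T'\<close> fixes the negative vectors \<open>v + t p\<close> for small \<open>t > 0\<close>,
  so all of them are eigenvectors of \<open>T\<close> for \<open>\<plusminus>1\<close>; this is absurd.\<close>
lemma same_centr_flipped_subset:
  assumes T: "T \<in> ortho" and T': "T' \<in> ortho" and same: "centr T = centr T'"
    and p: "T' p = p" "p \<noteq> 0" "B p p \<ge> 0"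
  shows "flipped T \<subseteq> flipped T'"
proof
  fix v assume v: "v \<in> flipped T"
  note lin = orthoD(2)[OF T] and lin' = orthoD(2)[OF T']
  show "v \<in> flipped T'"
  proof (cases "v = 0")
    case True
    then show ?thesis using subspace_0[OF subspace_flipped[OF orthoD(1)[OF T']]] by simp
  next
    case False
    have Tv: "T v = - v" using v by (simp add: flipped_def)
    have neg: "B v v < 0" by (rule negdefD[OF flipped_negdef[OF T] v False])
    have "T' v \<noteq> v"
    proof
      assume T'v: "T' v = v"
      \<comment> \<open>This quadratic polynomial in \<open>t\<close> is the square of
        \<open>v + t p\<close>, and its value at 0 is \<open>B v v < 0\<close>.\<close>
      have "((\<lambda>t. B v v + 2 * t * B v p + t * t * B p p) \<longlongrightarrow> B v v + 2 * 0 * B v p + 0 * 0 * B p p) (at_right 0)"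
        by (intro tendsto_intros)
      then have "eventually (\<lambda>t. B v v + 2 * t * B v p + t * t * B p p < 0) (at_right 0)"
        using neg by (intro order_tendstoD(2)) auto
      then obtain b where b: "b > 0" "\<And>t. 0 < t \<Longrightarrow> t < b \<Longrightarrow> B v v + 2 * t * B v p + t * t * B p p < 0"
        by (auto simp: eventually_at_right_field)
      have Tp: "t *\<^sub>R (T p - p) = 2 *\<^sub>R v" if t: "0 < t" "t < b" for t
      proof -
        let ?u = "v + t *\<^sub>R p"
        have "B ?u ?u = B v v + 2 * t * B v p + t * t * B p p" using sym[of p v] by (simp add: algebra_simps)
        then have "B ?u ?u < 0" using b(2)[OF t] by simp
        moreover have "T' ?u = ?u" using p(1) T'v by (simp add: linear_add[OF lin'] linear_scale[OF lin'])
        ultimately have "T ?u = ?u \<or> T ?u = - ?u" using same_reflection[OF T T' same] by blast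
        moreover have Tu: "T ?u = t *\<^sub>R T p - v" by (simp add: linear_add[OF lin] linear_scale[OF lin] Tv)
        moreover have "T ?u \<noteq> - ?u"
        proof
          assume "T ?u = - ?u"
          then have "t *\<^sub>R (T p + p) = 0" unfolding Tu by (simp add: algebra_simps)
          then have "T p = (-1) *\<^sub>R p" using t(1) by (simp add: eq_neg_iff_add_eq_0)
          from ortho_causal_eigenvalue_pos[OF T p(3,2) this] show False by simp
        qed
        ultimately have "t *\<^sub>R T p - v = v + t *\<^sub>R p" by metis
        then show ?thesis by (simp add: algebra_simps scaleR_2)
      qed
      \<comment> \<open>The relation \<open>t (T p - p) = 2 v\<close> for two different
        \<open>t\<close> forces \<open>T p = p\<close> and then \<open>v = 0\<close>.\<close>
      have "(b / 2) *\<^sub>R (T p - p) = (b / 4) *\<^sub>R (T p - p)" using Tp[of "b / 2"] Tp[of "b / 4"] b(1) by simp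
      then have "T p - p = 0" using b(1) by simp
      then have "2 *\<^sub>R v = 0" using Tp[of "b / 2"] b(1) by simp
      then show False using False by simp
    qed
    then show ?thesis using same_reflection[OF T T' same neg] Tv by (auto simp: flipped_def)
  qed
qed

text \<open>A definite space of eigenvectors for 1 or for -1 consists of vectors whose reflections
  commute with \<open>T'\<close>, so it lies in the union of \<open>fixed T'\<close> and
  \<open>flipped T'\<close>, hence in one of them. Which one is left open, so only the maximum is
  controlled.\<close>

lemma same_centr_max_dim:
  assumes T: "T \<in> ortho" and T': "T' \<in> ortho" and same: "centr T = centr T'"
    and nd: "negdef (fixed T)"
  shows "max (dim (fixed T)) (dim (flipped T)) \<le> max (dim (fixed T')) (dim (flipped T'))"
proof -
  have "dim A \<le> max (dim (fixed T')) (dim (flipped T'))"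
    if A: "negdef A" "A \<subseteq> fixed T \<or> A \<subseteq> flipped T" for A
  proof -
    note sub = subspace_fixed[OF orthoD(1)[OF T']] subspace_flipped[OF orthoD(1)[OF T']]
    have "A \<subseteq> fixed T' \<union> flipped T'"
    proof
      fix x assume x: "x \<in> A"
      show "x \<in> fixed T' \<union> flipped T'"
      proof (cases "x = 0")
        case True
        then show ?thesis using subspace_0[OF sub(1)] by simp
      next
        case False
        have "T x = x \<or> T x = - x" using A(2) x by (auto simp: fixed_def flipped_def)
        then show ?thesis using same_reflection[OF T T' same negdefD[OF A(1) x False]] by (auto simp: fixed_def flipped_def)
      qed
    qed
    then have "A \<subseteq> fixed T' \<or> A \<subseteq> flipped T'"
      using subspace_subset_Un[OF negdef_subspace[OF A(1)] sub] by blast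
    then show ?thesis using dim_subset[of A] by (auto simp: le_max_iff_disj)
  qed
  from this[OF nd] this[OF flipped_negdef[OF T]] show ?thesis by simp
qed

end

section \<open>The three types of isometries\<close>

text \<open>The space is spanned by simple invariant subspaces \<open>span {x, T x}\<close>.\<close>
lemma semisimpleI:
  fixes T :: "'v::euclidean_space \<Rightarrow> 'v"
  assumes T: "linear T" and X: "span X = UNIV"
    and inv: "\<And>x. x \<in> X \<Longrightarrow> T (T x) \<in> span {x, T x}"
    and simple: "\<And>x y. x \<in> X \<Longrightarrow> y \<in> span {x, T x} \<Longrightarrow> y \<noteq> 0 \<Longrightarrow> x \<in> span {y, T y}"
  shows "semisimple T"
  unfolding semisimple_def
proof (intro allI impI)
  fix W assume W: "invariant_subspace T W"
  then have subW: "subspace W" and TW: "\<And>x. x \<in> W \<Longrightarrow> T x \<in> W" by (auto simp: invariant_subspace_def)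
  \<comment> \<open>Candidates for a complement; one of maximal dimension is taken. A simple piece
    not contained in \<open>W + U\<close> meets it only in 0 and could still be added to
    \<open>U\<close>.\<close>
  define C where "C U \<longleftrightarrow> invariant_subspace T U \<and> W \<inter> U = {0}" for U
  have "C {0}" using linear_0[OF T] subspace_0[OF subW] by (auto simp: C_def invariant_subspace_def)
  moreover have "\<forall>U. C U \<longrightarrow> dim U < Suc (DIM('v))" by (simp add: dim_subset_UNIV less_Suc_eq_le)
  ultimately have "\<exists>U. C U \<and> (\<forall>U'. C U' \<longrightarrow> dim U' \<le> dim U)" by (rule ex_has_greatest_nat)
  then obtain U where U: "C U" and U_max: "\<And>U'. C U' \<Longrightarrow> dim U' \<le> dim U" by blast
  have subU: "subspace U" and TU: "\<And>x. x \<in> U \<Longrightarrow> T x \<in> U" and WU: "W \<inter> U = {0}"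
    using U by (auto simp: C_def invariant_subspace_def)
  have "span (W \<union> U) = UNIV"
  proof (rule ccontr)
    assume "span (W \<union> U) \<noteq> UNIV"
    then have "\<not> X \<subseteq> span (W \<union> U)" using X by (metis span_minimal subspace_span top.extremum_uniqueI)
    then obtain x where x: "x \<in> X" "x \<notin> span (W \<union> U)" by blast
    let ?C = "span {x, T x}"
    have TC: "T y \<in> ?C" if "y \<in> ?C" for y
    proof -
      have "T ` {x, T x} \<subseteq> ?C" using inv[OF x(1)] by (auto intro: span_base)
      then have "span (T ` {x, T x}) \<subseteq> ?C" by (simp add: span_minimal)
      then show ?thesis using that linear_span_image[OF T, of "{x, T x}"] by blast
    qed
    have TS: "T y \<in> span (W \<union> U)" if "y \<in> span (W \<union> U)" for y
    proof -
      have "T ` (W \<union> U) \<subseteq> span (W \<union> U)" using TW TU by (auto intro: span_base)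
      then have "span (T ` (W \<union> U)) \<subseteq> span (W \<union> U)" by (simp add: span_minimal)
      then show ?thesis using that linear_span_image[OF T, of "W \<union> U"] by blast
    qed
    define U' where "U' = {a + y |a y. a \<in> U \<and> y \<in> ?C}"
    have subU': "subspace U'" unfolding U'_def by (rule subspace_sums[OF subU subspace_span])
    have "invariant_subspace T U'"
      using subU' TU TC by (force simp: invariant_subspace_def U'_def linear_add[OF T])
    moreover have "v = 0" if "v \<in> W" "v \<in> U'" for v
    proof -
      obtain a y where ay: "a \<in> U" "y \<in> ?C" "v = a + y" using \<open>v \<in> U'\<close> by (auto simp: U'_def)
      have "v - a \<in> span (W \<union> U)" using \<open>v \<in> W\<close> ay(1) by (intro span_diff span_base) auto
      then have yS: "y \<in> span (W \<union> U)" using ay(3) by simp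
      have "y = 0"
      proof (rule ccontr)
        assume "y \<noteq> 0"
        then have "x \<in> span {y, T y}" using simple[OF x(1) ay(2)] by blast
        moreover have "span {y, T y} \<subseteq> span (W \<union> U)" using yS TS by (intro span_minimal) auto
        ultimately show False using x(2) by blast
      qed
      then have "v \<in> W \<inter> U" using ay(1,3) \<open>v \<in> W\<close> by simp
      then show ?thesis using WU by blast
    qed
    ultimately have "C U'" using subspace_0[OF subW] subspace_0[OF subU'] by (auto simp: C_def)
    moreover have "dim U < dim U'"
    proof -
      have "a + 0 \<in> U'" if "a \<in> U" for a unfolding U'_def using that span_zero by blast
      then have "U \<subseteq> U'" by auto
      moreover have "0 + x \<in> U'"
        unfolding U'_def using subspace_0[OF subU] span_base[of x "{x, T x}"] by blast
      then have "x \<in> U'" by simp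
      moreover have "x \<notin> U" using x(2) by (auto intro: span_base)
      ultimately have "span U \<subset> span U'" using subU subU' by (simp add: span_eq_iff[THEN iffD2]) blast
      then show ?thesis by (rule dim_psubset)
    qed
    ultimately show False using U_max by fastforce
  qed
  then show "\<exists>W'. invariant_subspace T W' \<and> W \<inter> W' = {0} \<and> span (W \<union> W') = UNIV"
    using U by (auto simp: C_def)
qed

context lorentz
begin

lemma oc_oc_subspace:
  assumes "subspace X"
  shows "oc (oc X) = X"
proof -
  have "X \<subseteq> oc (oc X)" by (auto simp: oc_iff sym dest: ocD)
  moreover have "dim (oc (oc X)) = dim X" using dim_oc[OF assms] dim_oc[OF subspace_oc, of X] by simp
  ultimately show ?thesis using assms subspace_oc by (intro subspace_dim_equal[symmetric]) auto
qed

text \<open>The algebra generated by \<open>T\<close> on \<open>E T c\<close> is a copy of the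
  complex numbers. Writing \<open>y = (\<alpha> + \<beta> T) x\<close>, the number
  \<open>\<delta> = \<alpha>^2 + c \<alpha> \<beta> + \<beta>^2\<close> is the norm of the factor,
  and multiplying by the conjugate \<open>\<alpha> + c \<beta> - \<beta> T\<close> recovers
  \<open>\<delta> x\<close>.\<close>

lemma E_simple:
  assumes T: "isom T" and c: "\<bar>c\<bar> < 2" and x: "x \<in> E T c" and y: "y \<in> span {x, T x}" "y \<noteq> 0"
  shows "x \<in> span {y, T y}"
proof -
  note lin = isom_linear[OF T]
  obtain \<alpha> \<beta> where ab: "y = \<alpha> *\<^sub>R x + \<beta> *\<^sub>R T x"
    using y(1) by (auto simp: span_insert algebra_simps span_singleton)
  define \<delta> where "\<delta> = (\<alpha> + c / 2 * \<beta>)\<^sup>2 + (1 - c\<^sup>2 / 4) * \<beta>\<^sup>2"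
  have "\<alpha> \<noteq> 0 \<or> \<beta> \<noteq> 0" using y(2) ab by auto
  moreover define k where "k = 1 - c\<^sup>2 / 4"
  moreover have "k > 0" using rotJ_sin_pos[OF c] by (simp add: k_def)
  ultimately have "\<delta> > 0"
    unfolding \<delta>_def k_def[symmetric] by (cases "\<beta> = 0") (simp_all add: add_nonneg_pos)
  then have "\<delta> \<noteq> 0" by simp
  have Ty: "T y = (- \<beta>) *\<^sub>R x + (\<alpha> + c * \<beta>) *\<^sub>R T x"
    by (simp add: ab linear_add[OF lin] linear_scale[OF lin] E_quadratic(1)[OF T x] algebra_simps)
  have "(\<alpha> + c * \<beta>) *\<^sub>R y - \<beta> *\<^sub>R T y = \<delta> *\<^sub>R x"
    unfolding Ty by (simp add: ab \<delta>_def algebra_simps power2_eq_square)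
  then have "inverse \<delta> *\<^sub>R ((\<alpha> + c * \<beta>) *\<^sub>R y - \<beta> *\<^sub>R T y) = x" using \<open>\<delta> \<noteq> 0\<close> by simp
  moreover have "inverse \<delta> *\<^sub>R ((\<alpha> + c * \<beta>) *\<^sub>R y - \<beta> *\<^sub>R T y) \<in> span {y, T y}"
    by (intro span_scale span_diff) (auto intro: span_base)
  ultimately show ?thesis by simp
qed

text \<open>All pieces outside \<open>P\<close> consist of eigenvectors or of rotation planes, so
  the only possible obstruction to semisimplicity is \<open>P\<close>.\<close>

lemma splitting_semisimple:
  assumes T: "T \<in> ortho" and spl: "splitting T P k" and P: "P \<subseteq> span {x. \<exists>c. T x = c *\<^sub>R x}"
  shows "semisimple T"
proof (rule semisimpleI[OF orthoD(2)[OF T]])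
  note T1 = orthoD(1)[OF T]
  let ?EV = "{x. \<exists>c. T x = c *\<^sub>R x}"
  let ?X = "?EV \<union> (\<Union>c\<in>rot T. E T c)"
  have "piece T P c \<subseteq> span ?X" if c: "c \<in> idx T" for c
  proof -
    consider "c = 3" | "c = 2" | "c = -2" | "c \<in> rot T" using c by (auto simp: idx_def)
    then show ?thesis
    proof cases
      case 1
      then show ?thesis using P span_mono[of ?EV ?X] by auto
    next
      case 2
      then have "piece T P c \<subseteq> ?EV" by (auto simp: fixed_def intro: exI[of _ 1])
      then show ?thesis using span_superset[of ?X] by blast
    next
      case 3
      then have "piece T P c \<subseteq> ?EV" by (auto simp: flipped_def intro: exI[of _ "-1"])
      then show ?thesis using span_superset[of ?X] by blast
    next
      case 4
      then show ?thesis using span_superset[of ?X] by auto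
    qed
  qed
  then have "span (\<Union>c\<in>idx T. piece T P c) \<subseteq> span ?X" by (intro span_minimal) auto
  then show "span ?X = UNIV" using piece_span[OF T spl] by auto
  fix x assume x: "x \<in> ?X"
  show "T (T x) \<in> span {x, T x}"
  proof (cases "x \<in> ?EV")
    case True
    then show ?thesis by (auto simp: linear_scale[OF orthoD(2)[OF T]] intro!: span_scale intro: span_base)
  next
    case False
    then obtain c where "x \<in> E T c" using x by blast
    then show ?thesis unfolding E_quadratic(1)[OF T1 \<open>x \<in> E T c\<close>]
      by (intro span_diff span_scale) (auto intro: span_base)
  qed
  fix y assume y: "y \<in> span {x, T x}" "y \<noteq> 0"
  show "x \<in> span {y, T y}"
  proof (cases "x \<in> ?EV")
    case True
    then obtain c where "T x = c *\<^sub>R x" by blast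
    then have "{x, T x} \<subseteq> span {x}" by (auto intro: span_base span_scale)
    then have "y \<in> span {x}" using y(1) span_minimal[of _ "span {x}"] by blast
    then obtain t where t: "y = t *\<^sub>R x" by (auto simp: span_singleton)
    then have "x = inverse t *\<^sub>R y" using y(2) by auto
    then show ?thesis by (metis insertI1 span_base span_scale)
  next
    case False
    then show ?thesis using x E_simple[OF T1 rot_bounds] y by blast
  qed
qed

section \<open>Normal forms of the three types\<close>

definition ell_data :: "('v \<Rightarrow> 'v) \<Rightarrow> 'v \<Rightarrow> bool" where
  "ell_data T p \<longleftrightarrow> T p = p \<and> B p p = 1"

definition hyp_data :: "('v \<Rightarrow> 'v) \<Rightarrow> 'v \<Rightarrow> 'v \<Rightarrow> real \<Rightarrow> bool" where
  "hyp_data T u v r \<longleftrightarrow> r > 0 \<and> r \<noteq> 1 \<and> T u = r *\<^sub>R u \<and> T v = (1 / r) *\<^sub>R v \<and>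
     B u u = 0 \<and> B v v = 0 \<and> B u v = 1"

text \<open>With \<open>B b b = -1\<close> as scaling, isometry forces
  \<open>2 B w b + B b b = 0\<close> and \<open>B w u = - B b b\<close>, which gives the values 1/2
  and 1; \<open>B w w = 0\<close> is arranged by adding a multiple of \<open>u\<close> to
  \<open>w\<close>. All parabolic blocks thus have the same matrix and the same form.\<close>

definition par_data :: "('v \<Rightarrow> 'v) \<Rightarrow> 'v \<Rightarrow> 'v \<Rightarrow> 'v \<Rightarrow> bool" where
  "par_data T w b u \<longleftrightarrow> T w = w + b \<and> T b = b + u \<and> T u = u \<and>
     B w w = 0 \<and> B b b = -1 \<and> B u u = 0 \<and> B w b = 1 / 2 \<and> B w u = 1 \<and> B b u = 0"

lemma elliptic_ell_data:
  assumes T: "T \<in> ortho"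
  shows "elliptic (\<lambda>v. B v v) T \<longleftrightarrow> (\<exists>p. ell_data T p)"
proof
  assume "elliptic (\<lambda>v. B v v) T"
  then obtain v c where v: "v \<noteq> 0" "T v = c *\<^sub>R v" "B v v > 0" by (auto simp: elliptic_def)
  have "c > 0" by (rule ortho_causal_eigenvalue_pos[OF T _ v(1,2)]) (use v(3) in simp)
  have "B (T v) (T v) = B v v" by (rule isom_B[OF orthoD(1)[OF T]])
  then have "c * c = 1" using v by simp
  then have "c = 1" using \<open>c > 0\<close> by (simp add: square_eq_1_iff)
  then have "ell_data T ((1 / sqrt (B v v)) *\<^sub>R v)"
    using v(2,3) by (simp add: ell_data_def linear_scale[OF orthoD(2)[OF T]])
  then show "\<exists>p. ell_data T p" by blast
next
  assume "\<exists>p. ell_data T p"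
  then obtain p where p: "T p = p" "B p p = 1" by (auto simp: ell_data_def)
  then have "p \<noteq> 0 \<and> T p = 1 *\<^sub>R p \<and> B p p > 0" by auto
  then show "elliptic (\<lambda>v. B v v) T" unfolding elliptic_def by blast
qed

text \<open>\<open>u\<close> is null because \<open>r^2 \<noteq> 1\<close>. As \<open>r\<close> is
  an eigenvalue, \<open>T - r\<close> is not onto, and a nonzero vector \<open>v\<close> orthogonal
  to its range satisfies \<open>T^-1 v = r v\<close>, so it is a null eigenvector for
  \<open>1 / r\<close>. If \<open>B u v\<close> were 0, \<open>v\<close> would be a multiple of
  \<open>u\<close>, forcing \<open>r = 1 / r\<close>.\<close>

lemma hyperbolic_hyp_data:
  assumes T: "T \<in> ortho"
  shows "hyperbolic T \<longleftrightarrow> (\<exists>u v r. hyp_data T u v r)"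
proof
  note T1 = orthoD(1)[OF T] and lin = orthoD(2)[OF T]
  assume "hyperbolic T"
  then obtain u r where u: "u \<noteq> 0" "T u = r *\<^sub>R u" "r \<noteq> 1" "r \<noteq> -1" by (auto simp: hyperbolic_def)
  have null: "B x x = 0" if "T x = s *\<^sub>R x" "s \<noteq> 1" "s \<noteq> -1" for x s
  proof -
    have "s * s * B x x = B x x" using isom_B[OF T1, of x x] that(1) by simp
    moreover have "s * s \<noteq> 1" using that by (simp add: square_eq_1_iff)
    ultimately show ?thesis by simp
  qed
  have uu: "B u u = 0" using null u by blast
  have r: "r > 0" by (rule ortho_causal_eigenvalue_pos[OF T _ u(1,2)]) (simp add: uu)
  define N where "N x = T x - r *\<^sub>R x" for x
  have linN: "linear N" unfolding N_def by (intro linear_compose_sub linear_scale_self lin)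
  have "N u = 0" using u by (simp add: N_def)
  then have "\<not> inj N" using u(1) linN by (auto simp: linear_injective_0)
  then have "range N \<noteq> UNIV" using linear_surj_imp_inj[OF linN] by blast
  moreover have subR: "subspace (range N)" using linear_subspace_image[OF linN subspace_UNIV] .
  moreover have "oc {0} = UNIV" by (simp add: oc_def)
  ultimately have "oc (range N) \<noteq> {0}" using oc_oc_subspace[OF subR] by metis
  then obtain v where v: "v \<in> oc (range N)" "v \<noteq> 0" using subspace_0[OF subspace_oc] by blast
  have "B (iv T v - r *\<^sub>R v) x = 0" for x
  proof -
    have "B v (N x) = 0" using ocD(1)[OF v(1)] by blast
    moreover have "B v (T x) = B (iv T v) x" using isom_adjoint[OF T1, of x v] sym by metis
    ultimately show ?thesis by (simp add: N_def)
  qed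
  then have "iv T v - r *\<^sub>R v = 0" by (rule nondegenerate)
  then have "T (iv T v) = r *\<^sub>R T v" by (simp add: linear_scale[OF lin])
  then have v_eq: "v = r *\<^sub>R T v" unfolding isom_f_inv[OF T1] .
  have "(1 / r) *\<^sub>R v = (1 / r) *\<^sub>R (r *\<^sub>R T v)" by (subst v_eq) (rule HOL.refl)
  then have Tv: "T v = (1 / r) *\<^sub>R v" using r by simp
  have "1 / r > 0" using r by simp
  then have vv: "B v v = 0" using r u(3) by (intro null[OF Tv]) (simp, linarith)
  have "B u v \<noteq> 0"
  proof
    assume "B u v = 0"
    then obtain t where t: "v = t *\<^sub>R u" using causal_orthogonal_parallel[of u v] uu vv u(1) by auto
    have "t \<noteq> 0" using t v(2) by auto
    have "T v = r *\<^sub>R v" using t u(2) by (simp add: linear_scale[OF lin])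
    then have "r = 1 / r" using Tv v(2) by simp
    then have "r * r = 1" using r by (simp add: field_simps)
    then show False using u(3,4) by (simp add: square_eq_1_iff)
  qed
  then have "hyp_data T u ((1 / B u v) *\<^sub>R v) r"
    using r u Tv uu vv by (simp add: hyp_data_def linear_scale[OF lin])
  then show "\<exists>u v r. hyp_data T u v r" by blast
next
  assume "\<exists>u v r. hyp_data T u v r"
  then obtain u v r where "hyp_data T u v r" by blast
  then have "u \<noteq> 0 \<and> T u = r *\<^sub>R u \<and> r \<noteq> 1 \<and> r \<noteq> -1" by (auto simp: hyp_data_def)
  then show "hyperbolic T" unfolding hyperbolic_def by blast
qed


text \<open>On \<open>oc {e0}\<close> the form \<open>- B\<close> is positive definite, so by
  compactness of the unit sphere it dominates a multiple \<open>m\<close> of the squared norm; for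
  \<open>x\<close> in the section, \<open>y = x - e0\<close> satisfies
  \<open>- B y y \<le> 1\<close>.\<close>

lemma compact_future_section: "compact {x. B x e0 = 1 \<and> B x x \<ge> 0}"
proof -
  have cB: "continuous_on S (\<lambda>x. B x x)" "continuous_on S (\<lambda>x. B x e0)" for S
    by (intro bilinear_continuous_on_compose[OF _ _ bil] continuous_intros)+
  let ?K = "sphere 0 1 \<inter> oc {e0}"
  have "\<exists>m>0. \<forall>y\<in>oc {e0}. m * (norm y)\<^sup>2 \<le> - B y y"
  proof (cases "?K = {}")
    case True
    have "y = 0" if "y \<in> oc {e0}" for y
    proof (rule ccontr)
      assume "y \<noteq> 0"
      then have "(1 / norm y) *\<^sub>R y \<in> ?K" using that by (simp add: oc_iff)
      then show False using True by blast
    qed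
    then have "\<forall>y\<in>oc {e0}. 1 * (norm y)\<^sup>2 \<le> - B y y" by fastforce
    then show ?thesis using zero_less_one by blast
  next
    case False
    have "compact ?K" by (simp add: closed_subspace[OF subspace_oc] compact_Int_closed)
    then have "\<exists>x\<in>?K. \<forall>y\<in>?K. - B x x \<le> - B y y"
      by (rule continuous_attains_inf[OF _ False continuous_on_minus[OF cB(1)]])
    then obtain x where x: "x \<in> ?K" "\<And>y. y \<in> ?K \<Longrightarrow> - B x x \<le> - B y y" by blast
    have "norm x = 1" "B x e0 = 0" using x(1) by (simp_all add: oc_iff)
    then have "B x x < 0" by (intro neg_orth_e0) auto
    then have "- B x x > 0" by simp
    moreover have "- B x x * (norm y)\<^sup>2 \<le> - B y y" if y: "y \<in> oc {e0}" for y
    proof (cases "y = 0")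
      case False
      then have "(1 / norm y) *\<^sub>R y \<in> ?K" using y by (simp add: oc_iff)
      then have "- B x x \<le> - B ((1 / norm y) *\<^sub>R y) ((1 / norm y) *\<^sub>R y)" by (rule x(2))
      then have "- B x x \<le> - B y y / (norm y)\<^sup>2" by (simp add: power2_eq_square)
      then show ?thesis using False by (simp add: pos_divide_le_eq)
    qed simp
    ultimately show ?thesis by blast
  qed
  then obtain m where m: "m > 0" "\<And>y. y \<in> oc {e0} \<Longrightarrow> m * (norm y)\<^sup>2 \<le> - B y y" by blast
  have "bounded {x. B x e0 = 1 \<and> B x x \<ge> 0}"
  proof (rule boundedI)
    fix x assume x: "x \<in> {x. B x e0 = 1 \<and> B x x \<ge> 0}"
    define y where "y = x - e0"
    have "y \<in> oc {e0}" using x e0 by (simp add: y_def oc_iff)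
    moreover have "- B y y \<le> 1" using x e0 sym[of e0 x] by (simp add: y_def)
    ultimately have "m * (norm y)\<^sup>2 \<le> 1" using m(2) by fastforce
    then have "(norm y)\<^sup>2 \<le> 1 / m" using m(1) by (simp add: field_simps)
    then have "norm y \<le> sqrt (1 / m)" by (rule real_le_rsqrt)
    moreover have "norm x \<le> norm y + norm e0" unfolding y_def using norm_triangle_ineq[of "x - e0" e0] by simp
    ultimately show "norm x \<le> sqrt (1 / m) + norm e0" by simp
  qed
  moreover have "closed {x. B x e0 = 1 \<and> B x x \<ge> 0}"
    using cB[of UNIV] by (intro closed_Collect_conj closed_Collect_eq closed_Collect_le continuous_on_const)
  ultimately show ?thesis by (simp add: compact_eq_bounded_closed)
qed

text \<open>The set \<open>S\<close> is a compact convex base of the closed future cone, the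
  projective ball model of hyperbolic space with its boundary, and \<open>f\<close> is the action of
  \<open>T\<close> on it. A fixed point of \<open>f\<close> is an eigenvector of
  \<open>T\<close>.\<close>

lemma causal_eigenvector:
  assumes T: "T \<in> ortho"
  obtains x r where "x \<noteq> 0" "B x x \<ge> 0" "T x = r *\<^sub>R x"
proof -
  note T1 = orthoD(1)[OF T] and lin = orthoD(2)[OF T]
  define S where "S = {x. B x e0 = 1 \<and> B x x \<ge> 0}"
  define f where "f x = (1 / B (T x) e0) *\<^sub>R T x" for x
  have pos: "B (T x) e0 > 0" if "x \<in> S" for x using ortho_future[OF T] that by (simp add: S_def)
  have "compact S" unfolding S_def by (rule compact_future_section)
  moreover have "convex S"
    unfolding convex_def
  proof (intro ballI allI impI)
    fix x y and a b :: real
    assume xy: "x \<in> S" "y \<in> S" and ab: "0 \<le> a" "0 \<le> b" "a + b = 1"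
    have "B x y \<ge> 0" using xy by (auto simp: S_def intro: future_nonneg[of x y])
    moreover have "B (a *\<^sub>R x + b *\<^sub>R y) (a *\<^sub>R x + b *\<^sub>R y) = a * a * B x x + b * b * B y y + 2 * (a * b) * B x y"
      using sym[of y x] by (simp add: algebra_simps)
    ultimately have "B (a *\<^sub>R x + b *\<^sub>R y) (a *\<^sub>R x + b *\<^sub>R y) \<ge> 0"
      using xy ab by (simp add: S_def)
    then show "a *\<^sub>R x + b *\<^sub>R y \<in> S" using xy ab(3) by (simp add: S_def)
  qed
  moreover have "S \<noteq> {}" using e0 by (auto simp: S_def intro!: exI[of _ e0])
  moreover have "continuous_on S f"
  proof -
    have "continuous_on S T" by (simp add: lin linear_continuous_on linear_conv_bounded_linear[symmetric])
    moreover have "B (T x) e0 \<noteq> 0" if "x \<in> S" for x using pos[OF that] by simp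
    ultimately show ?thesis unfolding f_def
      by (intro continuous_on_scaleR continuous_on_divide continuous_on_const
          bilinear_continuous_on_compose[OF _ _ bil]) auto
  qed
  moreover have "f ` S \<subseteq> S"
  proof clarify
    fix x assume x: "x \<in> S"
    have "B (f x) e0 = 1" using pos[OF x] by (simp add: f_def)
    moreover have "B (f x) (f x) \<ge> 0" using x isom_B[OF T1] by (simp add: f_def S_def)
    ultimately show "f x \<in> S" by (simp add: S_def)
  qed
  ultimately obtain x where x: "x \<in> S" "f x = x" using brouwer[of S f] by blast
  have "B (T x) e0 *\<^sub>R f x = T x" using pos[OF x(1)] by (simp add: f_def)
  then have "T x = B (T x) e0 *\<^sub>R x" unfolding x(2) by simp
  moreover have "x \<noteq> 0" "B x x \<ge> 0" using x(1) by (auto simp: S_def)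
  ultimately show thesis using that by blast
qed

text \<open>The adjoint of \<open>T - 1\<close> is \<open>- T\<^sup>-\<^sup>1 (T - 1)\<close>, so the range and the kernel of \<open>(T - 1)\<^sup>3\<close> are
  orthogonal complements of each other.\<close>
lemma nilpotent_cube_duality:
  assumes T: "isom T" and u: "\<And>w. T (T (T w - w) - (T w - w)) - (T (T w - w) - (T w - w)) = 0 \<Longrightarrow> B u w = 0"
  defines "N \<equiv> \<lambda>x. T x - x"
  shows "u \<in> range (\<lambda>x. N (N (N x)))"
proof -
  note lin = isom_linear[OF T] and lini = isom_linear[OF isom_inv[OF T]]
  define M where "M x = iv T x - x" for x
  have linN: "linear N" unfolding N_def by (intro linear_compose_sub lin linear_ident)
  have linM: "linear M" unfolding M_def by (intro linear_compose_sub lini linear_ident)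
  have adj: "B v (N x) = B (M v) x" for v x
    using isom_adjoint[OF T, of x v] sym[of v "T x"] sym[of x "iv T v"] by (simp add: N_def M_def)
  have NM: "N x = - T (M x)" for x by (simp add: N_def M_def linear_diff[OF lin] T)
  have MN: "M (N x) = N (M x)" for x
    by (simp add: N_def M_def linear_diff[OF lin] linear_diff[OF lini] T)
  let ?N3 = "\<lambda>x. N (N (N x))"
  have "linear ?N3" using linear_compose[OF linear_compose[OF linN linN] linN] by (simp add: o_def)
  then have subR: "subspace (range ?N3)" by (rule linear_subspace_image) (rule subspace_UNIV)
  \<comment> \<open>Orthogonality to the range means \<open>M^3 v = 0\<close>; as \<open>M\<close>
    and \<open>N\<close> commute and \<open>N = - T M\<close>, the factors \<open>M\<close> can be
    exchanged for \<open>N\<close> one at a time.\<close>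
  have "?N3 v = 0" if v: "v \<in> oc (range ?N3)" for v
  proof -
    have "B (M (M (M v))) x = 0" for x
      using ocD(1)[OF v, of "?N3 x"] by (simp add: adj)
    then have 0: "M (M (M v)) = 0" by (rule nondegenerate)
    have "N (M (M v)) = 0" unfolding NM 0 by (simp add: linear_0[OF lin])
    then have 1: "M (M (N v)) = 0" unfolding MN .
    have "N (M (N v)) = 0" unfolding NM[of "M (N v)"] 1 by (simp add: linear_0[OF lin])
    then have "M (N (N v)) = 0" unfolding MN .
    then show ?thesis unfolding NM[of "N (N v)"] by (simp add: linear_0[OF lin])
  qed
  then have "B u w = 0" if "w \<in> oc (range ?N3)" for w using u[of w] that by (simp add: N_def)
  then have "u \<in> oc (oc (range ?N3))" by (simp add: oc_iff)
  then show ?thesis using oc_oc_subspace[OF subR] by simp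
qed

text \<open>The causal eigenvector \<open>u\<close> has eigenvalue 1 and is null. It is not in the
  range of \<open>(T - 1)^3\<close>: a Jordan chain \<open>y, q, p, u\<close> would have
  \<open>p\<close> negative and \<open>B q u = - B p p\<close>, although \<open>q = T y - y\<close>
  is orthogonal to the fixed vector \<open>u\<close>. By duality some \<open>w\<close> killed by
  \<open>(T - 1)^3\<close> satisfies \<open>B u w \<noteq> 0\<close>, and its chain
  \<open>w, b, u'\<close> is the block. Here \<open>b\<close> is negative, as otherwise
  \<open>w\<close> would be fixed and so would be some \<open>w + s u\<close> of positive
  length.\<close>

lemma par_data_exists:
  assumes T: "T \<in> ortho" and ne: "\<not> (\<exists>p. ell_data T p)" and nh: "\<not> hyperbolic T"
  shows "\<exists>w b u. par_data T w b u"
proof -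
  note T1 = orthoD(1)[OF T] and lin = orthoD(2)[OF T]
  have no_fixed: "\<not> B p p > 0" if "T p = p" for p
  proof
    assume "B p p > 0"
    then have "ell_data T ((1 / sqrt (B p p)) *\<^sub>R p)"
      using that by (simp add: ell_data_def linear_scale[OF lin])
    then show False using ne by blast
  qed
  have isoB: "B (T x) (T y) = B x y" for x y by (rule isom_B[OF T1])
  obtain u r where u: "u \<noteq> 0" "B u u \<ge> 0" "T u = r *\<^sub>R u" using causal_eigenvector[OF T] .
  have "r > 0" by (rule ortho_causal_eigenvalue_pos[OF T u(2,1,3)])
  then have "r = 1" using nh u unfolding hyperbolic_def by (metis less_minus_one_simps(3) not_less_iff_gr_or_eq zero_less_one)
  then have Tu: "T u = u" using u by simp
  then have uu: "B u u = 0" using no_fixed[OF Tu] u(2) by simp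
  have null_orth: "B x x < 0 \<or> (\<exists>t. x = t *\<^sub>R u)" if xu: "B x u = 0" for x
  proof (cases "B x x \<ge> 0")
    case True
    have "B u x = 0" using xu sym[of u x] by simp
    then obtain t where "x = t *\<^sub>R u" by (rule causal_orthogonal_parallel[OF u(2) True _ u(1)])
    then show ?thesis by blast
  qed simp
  define N where "N = (\<lambda>x. T x - x)"
  have "u \<notin> range (\<lambda>x. N (N (N x)))"
  proof
    assume "u \<in> range (\<lambda>x. N (N (N x)))"
    then obtain y where y: "u = N (N (N y))" by blast
    define q where "q = N y"
    define p where "p = N q"
    have Ty: "T y = y + q" and Tq: "T q = q + p" and Tp: "T p = p + u"
      using y by (simp_all add: N_def q_def p_def)
    have pu: "B p u = 0" "B u p = 0" using isoB[of p p] Tp uu sym[of u p] by auto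
    have pp: "B p p < 0"
    proof -
      have "T p \<noteq> p" using Tp u(1) by simp
      then have "\<not> (\<exists>t. p = t *\<^sub>R u)" using Tu by (auto simp: linear_scale[OF lin])
      then show ?thesis using null_orth[OF pu(1)] by blast
    qed
    have "B q u = - B p p" using isoB[of q p] unfolding Tq Tp by (simp add: pu)
    moreover have "B q u = 0" using isoB[of y u] unfolding Ty Tu by simp
    ultimately show False using pp by simp
  qed
  then obtain w where w: "N (N (N w)) = 0" "B u w \<noteq> 0"
    using nilpotent_cube_duality[OF T1, of u] unfolding N_def by blast
  define b where "b = N w"
  define u' where "u' = N b"
  have Tw: "T w = w + b" and Tb: "T b = b + u'" and Tu': "T u' = u'"
    using w by (simp_all add: N_def b_def u'_def)
  have u'u: "B u' u = 0" using isoB[of b u] unfolding Tb Tu by simp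
  have bu: "B b u = 0" using isoB[of w u] unfolding Tw Tu by simp
  have u'u': "B u' u' = 0" using isoB[of b u'] unfolding Tb Tu' by simp
  obtain \<mu> where \<mu>: "u' = \<mu> *\<^sub>R u" using null_orth[OF u'u] u'u' by auto
  have bu': "B b u' = 0" "B u' b = 0" using bu sym[of u b] by (simp_all add: \<mu>)
  have wb: "2 * B w b + B b b = 0" using isoB[of w w] sym[of b w] unfolding Tw by simp
  have wu: "B w u' = - B b b" using isoB[of w b] unfolding Tw Tb by (simp add: bu')
  have "B b b < 0"
  proof (rule ccontr)
    assume "\<not> B b b < 0"
    then obtain t where t: "b = t *\<^sub>R u" using null_orth[OF bu] by blast
    then have "B b b = 0" by (simp add: uu)
    then have "t * B w u = 0" using wb by (simp add: t uu)
    then have "b = 0" using w(2) sym[of u w] t by simp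
    then have "T w = w" using Tw by simp
    \<comment> \<open>The solution of \<open>B (w + s u) (w + s u) = 1\<close>, an equation linear
      in \<open>s\<close> because \<open>u\<close> is null.\<close>
    define s where "s = (1 - B w w) / (2 * B w u)"
    have "T (w + s *\<^sub>R u) = w + s *\<^sub>R u"
      by (simp add: linear_add[OF lin] linear_scale[OF lin] \<open>T w = w\<close> Tu)
    moreover have "B (w + s *\<^sub>R u) (w + s *\<^sub>R u) = B w w + s * (2 * B w u)"
      using sym[of u w] by (simp add: uu algebra_simps)
    moreover have "s * (2 * B w u) = 1 - B w w" using w(2) sym[of u w] by (simp add: s_def)
    ultimately show False using no_fixed[of "w + s *\<^sub>R u"] by simp
  qed
  \<comment> \<open>Rescaling the whole chain by \<open>s\<close> keeps the action of
    \<open>T\<close> and normalizes the square of \<open>b\<close> to -1.\<close>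
  define s where "s = 1 / sqrt (- B b b)"
  have ss: "s * s * B b b = -1" using \<open>B b b < 0\<close> by (simp add: s_def)
  have "B w b = - (B b b / 2)" using wb by simp
  then have ss': "s * (s * B w b) = 1 / 2" "s * (s * B w u') = 1"
    using ss wu by (simp_all add: mult.assoc)
  \<comment> \<open>Adding \<open>t\<close> times the fixed null vector makes the first vector null
    without changing its image under \<open>T - 1\<close>.\<close>
  define t where "t = - (s * s * B w w) / 2"
  have "par_data T (s *\<^sub>R w + t *\<^sub>R (s *\<^sub>R u')) (s *\<^sub>R b) (s *\<^sub>R u')"
    unfolding par_data_def
  proof (intro conjI)
    show "T (s *\<^sub>R w + t *\<^sub>R (s *\<^sub>R u')) = s *\<^sub>R w + t *\<^sub>R (s *\<^sub>R u') + s *\<^sub>R b"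
      "T (s *\<^sub>R b) = s *\<^sub>R b + s *\<^sub>R u'" "T (s *\<^sub>R u') = s *\<^sub>R u'"
      by (simp_all add: linear_add[OF lin] linear_scale[OF lin] Tw Tb Tu' algebra_simps)
    show "B (s *\<^sub>R b) (s *\<^sub>R b) = -1" using ss by (simp add: mult.assoc)
    show "B (s *\<^sub>R u') (s *\<^sub>R u') = 0" "B (s *\<^sub>R b) (s *\<^sub>R u') = 0" by (simp_all add: u'u' bu')
    show "B (s *\<^sub>R w + t *\<^sub>R (s *\<^sub>R u')) (s *\<^sub>R b) = 1 / 2"
      "B (s *\<^sub>R w + t *\<^sub>R (s *\<^sub>R u')) (s *\<^sub>R u') = 1"
      using ss' by (simp_all add: u'u' bu')
    have "B (s *\<^sub>R w + t *\<^sub>R (s *\<^sub>R u')) (s *\<^sub>R w + t *\<^sub>R (s *\<^sub>R u')) = s * s * B w w + 2 * t * (s * (s * B w u'))"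
      using sym[of u' w] by (simp add: u'u' algebra_simps)
    then show "B (s *\<^sub>R w + t *\<^sub>R (s *\<^sub>R u')) (s *\<^sub>R w + t *\<^sub>R (s *\<^sub>R u')) = 0"
      unfolding ss' by (simp add: t_def)
  qed
  then show ?thesis by blast
qed

text \<open>The line of \<open>u\<close> has no invariant complement \<open>W\<close>: modulo a
  multiple of \<open>u\<close>, \<open>w\<close> would lie in \<open>W\<close>, and applying
  \<open>T - 1\<close> twice would put first \<open>b\<close> and then \<open>u\<close> into
  \<open>W\<close>.\<close>

lemma par_data_not_semisimple:
  assumes lin: "linear T" and par: "par_data T w b u"
  shows "\<not> semisimple T"
proof
  have d: "T w = w + b" "T b = b + u" "T u = u" "u \<noteq> 0" using par by (auto simp: par_data_def)
  assume "semisimple T"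
  moreover have "invariant_subspace T (span {u})"
    unfolding invariant_subspace_def
    using d(3) by (intro conjI subspace_span) (auto simp: span_singleton linear_scale[OF lin])
  ultimately obtain W where W: "invariant_subspace T W" "span {u} \<inter> W = {0}" "span (span {u} \<union> W) = UNIV"
    unfolding semisimple_def by blast
  have subW: "subspace W" and TW: "\<And>x. x \<in> W \<Longrightarrow> T x \<in> W" using W(1) by (auto simp: invariant_subspace_def)
  have "w \<in> span (span {u} \<union> W)" using W(3) by blast
  then obtain a y where ay: "a \<in> span {u}" "y \<in> W" "w = a + y"
    using subW by (auto simp: span_Un span_span span_eq_iff[THEN iffD2])
  have "T a = a" using ay(1) d(3) by (auto simp: span_singleton linear_scale[OF lin])
  then have "T y - y = b" using d(1) by (simp add: ay(3) linear_add[OF lin])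
  then have "b \<in> W" using TW[OF ay(2)] ay(2) subspace_diff[OF subW] by blast
  then have "T b - b \<in> W" using TW subspace_diff[OF subW] by blast
  then have "u \<in> span {u} \<inter> W" using d(2) by (simp add: span_base)
  then show False using W(2) d(4) by blast
qed


section \<open>z-equivalence within each type\<close>

lemma isometric_on_span:
  assumes lin: "linear f" and X: "\<And>x y. x \<in> X \<Longrightarrow> y \<in> X \<Longrightarrow> B (f x) (f y) = B x y"
    and x: "x \<in> span X"
  shows "B (f x) (f x) = B x x"
proof -
  have "bilinear (\<lambda>x y. B (f x) (f y))"
    unfolding bilinear_def by (auto intro!: linearI simp: linear_add[OF lin] linear_scale[OF lin])
  then show ?thesis
    by (rule bilinear_eq[OF _ bil, where S = "span X" and T = "span X"]) (use X x in auto)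
qed

lemma intertwining_on_span:
  assumes lin: "linear f" "linear T" "linear T'"
    and X: "\<And>x. x \<in> X \<Longrightarrow> T' (f x) = f (\<delta> *\<^sub>R x + \<gamma> *\<^sub>R T x)" and x: "x \<in> span X"
  shows "T' (f x) = f (\<delta> *\<^sub>R x + \<gamma> *\<^sub>R T x)"
proof -
  have l: "linear (\<lambda>x. T' (f x))" "linear (\<lambda>x. f (\<delta> *\<^sub>R x + \<gamma> *\<^sub>R T x))"
    by (auto intro!: linearI simp: linear_add[OF lin(1)] linear_add[OF lin(2)] linear_add[OF lin(3)]
        linear_scale[OF lin(1)] linear_scale[OF lin(2)] linear_scale[OF lin(3)] algebra_simps)
  show ?thesis using linear_eq_on_span[OF l X x] .
qed

lemma splittingI:
  assumes "T \<in> ortho" "\<And>x. x \<in> X \<Longrightarrow> T x \<in> span X" "\<And>x. x \<in> X \<Longrightarrow> x \<in> Gen T k"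
    "p \<in> span X" "B p p > 0" "2 \<le> k"
  shows "splitting T (span X) k"
proof -
  have "T ` span X \<subseteq> span X"
    unfolding linear_span_image[OF orthoD(2)[OF assms(1)], symmetric] using assms(2) by (intro span_minimal) auto
  moreover have "span X \<subseteq> Gen T k"
    using assms(3) subspace_Gen[OF orthoD(1)[OF assms(1)]] by (intro span_minimal) auto
  ultimately show ?thesis using assms(4-6) by (auto simp: splitting_def)
qed

lemma ell_splitting:
  assumes T: "T \<in> ortho" and p: "ell_data T p"
  shows "splitting T (span {p}) 2" "dim (span {p}) = 1"
proof -
  have "p \<in> fixed T" using p by (simp add: ell_data_def fixed_def)
  then have "p \<in> Gen T 2" using fixed_subset_E E_subset_Gen orthoD(1)[OF T] by blast
  then show "splitting T (span {p}) 2"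
    using p by (intro splittingI[OF T, where p = p]) (auto simp: ell_data_def intro: span_base)
  have "p \<noteq> 0" using p by (auto simp: ell_data_def)
  then show "dim (span {p}) = 1" by (simp add: dim_insert)
qed

lemma hyp_splitting:
  assumes T: "T \<in> ortho" and uv: "hyp_data T u v r"
  shows "splitting T (span {u, v}) (r + 1 / r)" "dim (span {u, v}) = 2" "r + 1 / r > 2"
proof -
  note T1 = orthoD(1)[OF T] and lin = orthoD(2)[OF T]
  have d: "r > 0" "r \<noteq> 1" "T u = r *\<^sub>R u" "T v = (1 / r) *\<^sub>R v" "B u u = 0" "B v v = 0" "B u v = 1" "B v u = 1"
    using uv sym[of v u] by (auto simp: hyp_data_def)
  have "(r - 1)\<^sup>2 > 0" using d(2) by simp
  then have "(r - 1)\<^sup>2 / r > 0" using d(1) by simp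
  also have "(r - 1)\<^sup>2 / r = r + 1 / r - 2" using d(1) by (simp add: field_simps power2_eq_square)
  finally show gt: "r + 1 / r > 2" by simp
  have "iv T u = (1 / r) *\<^sub>R u" "iv T v = r *\<^sub>R v"
    using d(1,3,4) by (auto intro!: isom_inv_eqI[OF T1] simp: linear_scale[OF lin])
  then have "u \<in> E T (r + 1 / r)" "v \<in> E T (r + 1 / r)"
    using d(3,4) by (simp_all add: E_def algebra_simps)
  then have Gen: "u \<in> Gen T (r + 1 / r)" "v \<in> Gen T (r + 1 / r)" using E_subset_Gen[OF T1] by blast+
  have "B (u + v) (u + v) > 0" using d by simp
  moreover have "u + v \<in> span {u, v}" by (intro span_add) (auto intro: span_base)
  moreover have "T x \<in> span {u, v}" if "x \<in> {u, v}" for x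
    using that d(3,4) span_scale[OF span_base[of u "{u, v}"]] span_scale[OF span_base[of v "{u, v}"]] by auto
  ultimately show "splitting T (span {u, v}) (r + 1 / r)"
    using Gen gt by (intro splittingI[OF T, where p = "u + v"]) auto
  have "v \<noteq> 0" using d(7) by auto
  moreover have "u \<notin> span {v}" using d by (auto simp: span_singleton)
  ultimately show "dim (span {u, v}) = 2" by (simp add: dim_insert)
qed

text \<open>The operator \<open>T + T^-1 - 2\<close> equals \<open>T^-1 (T - 1)^2\<close>: it kills
  \<open>b\<close> and \<open>u\<close> and sends \<open>w\<close> to \<open>u\<close>. So a Jordan
  block of size three for \<open>T\<close> lies in \<open>Gen T 2\<close>, and order two is
  enough.\<close>

lemma par_splitting:
  assumes T: "T \<in> ortho" and wbu: "par_data T w b u"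
  shows "splitting T (span {w, b, u}) 2" "dim (span {w, b, u}) = 3"
proof -
  note T1 = orthoD(1)[OF T] and lin = orthoD(2)[OF T] and lini = orthoD(2)[OF ortho_inv[OF T]]
  have d: "T w = w + b" "T b = b + u" "T u = u" "B w w = 0" "B b b = -1" "B u u = 0"
    "B w b = 1/2" "B b w = 1/2" "B w u = 1" "B u w = 1" "B b u = 0" "B u b = 0"
    using wbu sym[of b w] sym[of u w] sym[of u b] by (auto simp: par_data_def)
  have iu: "iv T u = u" by (rule isom_inv_eqI[OF T1 d(3)])
  have ib: "iv T b = b - u" by (rule isom_inv_eqI[OF T1]) (simp add: linear_diff[OF lin] d)
  have iw: "iv T w = w - b + u" by (rule isom_inv_eqI[OF T1]) (simp add: linear_diff[OF lin] linear_add[OF lin] d)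
  have uE: "u \<in> E T 2" using d(3) iu by (simp add: E_def scaleR_2)
  have "b \<in> E T 2" using d(2) ib by (simp add: E_def scaleR_2)
  then have "u \<in> Gen T 2" "b \<in> Gen T 2" using uE E_subset_Gen[OF T1] by blast+
  moreover have "w \<in> Gen T 2" using d(1) iw uE by (simp add: Gen_def scaleR_2)
  moreover have "B (w + u) (w + u) > 0" using d by simp
  moreover have "w + u \<in> span {w, b, u}" by (intro span_add) (auto intro: span_base)
  moreover have "T x \<in> span {w, b, u}" if "x \<in> {w, b, u}" for x
    using that d(1-3) span_add[OF span_base[of _ "{w, b, u}"] span_base[of _ "{w, b, u}"]]
      span_base[of u "{w, b, u}"] by auto
  ultimately show "splitting T (span {w, b, u}) 2"
    by (intro splittingI[OF T, where p = "w + u"]) auto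
  have "u \<noteq> 0" using d(9) by auto
  moreover have "b \<notin> span {u}" using d by (auto simp: span_singleton)
  moreover have "w \<notin> span {b, u}"
  proof
    assume "w \<in> span {b, u}"
    moreover have "span {b, u} \<subseteq> oc {u}" using subspace_oc d by (intro span_minimal) (auto simp: oc_iff)
    ultimately show False using d(9) by (auto simp: oc_iff)
  qed
  ultimately show "dim (span {w, b, u}) = 3" by (simp add: dim_insert)
qed

section \<open>Invariants of z-equivalence and their completeness\<close>

lemma zeq_conj:
  assumes T: "T \<in> ortho" and zeq: "zeq T T'"
  obtains g where "g \<in> ortho" "g \<circ> T \<circ> iv g \<in> ortho" "centr (g \<circ> T \<circ> iv g) = centr T'"
proof -
  obtain g where "g \<in> ortho" "centr T' = (\<lambda>h. g \<circ> h \<circ> iv g) ` centr T" using zeq by (auto simp: zeq_def)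
  then show thesis using that[of g] conj_centr[of g T] ortho_conj[OF _ T] by simp
qed

lemma zeq_lam:
  assumes "T \<in> ortho" "T' \<in> ortho" "zeq T T'"
  shows "lam T = lam T'"
proof -
  obtain g where g: "g \<in> ortho" "g \<circ> T \<circ> iv g \<in> ortho" "centr (g \<circ> T \<circ> iv g) = centr T'"
    using zeq_conj[OF assms(1,3)] .
  show ?thesis
    using same_centr_lam[OF g(2) assms(2) g(3)] conj_lam[OF orthoD(1)[OF g(1)] orthoD(1)[OF assms(1)]] by simp
qed

text \<open>A nonzero causal fixed vector on either side tells the eigenvalue 1 from -1, so the
  inclusion of the -1-eigenspaces holds in both directions.\<close>

lemma zeq_flipped:
  assumes T: "T \<in> ortho" and T': "T' \<in> ortho" and zeq: "zeq T T'"
    and p: "T p = p" "p \<noteq> 0" "B p p \<ge> 0" and p': "T' p' = p'" "p' \<noteq> 0" "B p' p' \<ge> 0"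
  shows "dim (flipped T) = dim (flipped T')"
proof -
  obtain g where g: "g \<in> ortho" "g \<circ> T \<circ> iv g \<in> ortho" "centr (g \<circ> T \<circ> iv g) = centr T'"
    using zeq_conj[OF T zeq] .
  note g1 = orthoD(1)[OF g(1)]
  have gp: "(g \<circ> T \<circ> iv g) (g p) = g p" "g p \<noteq> 0" "B (g p) (g p) \<ge> 0"
    using p g1 isom_eq_0[OF g1] isom_B[OF g1] by auto
  have "flipped (g \<circ> T \<circ> iv g) = flipped T'"
    using same_centr_flipped_subset[OF g(2) T' g(3) p'] same_centr_flipped_subset[OF T' g(2) g(3)[symmetric] gp]
    by (rule subset_antisym)
  then show ?thesis using conj_flipped[OF g1, of T] dim_isom_image[OF g1] by metis
qed

lemma zeq_max_dim:
  assumes T: "T \<in> ortho" and T': "T' \<in> ortho" and zeq: "zeq T T'"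
    and nd: "negdef (fixed T)" "negdef (fixed T')"
  shows "max (dim (fixed T)) (dim (flipped T)) = max (dim (fixed T')) (dim (flipped T'))"
proof -
  obtain g where g: "g \<in> ortho" "g \<circ> T \<circ> iv g \<in> ortho" "centr (g \<circ> T \<circ> iv g) = centr T'"
    using zeq_conj[OF T zeq] .
  note g1 = orthoD(1)[OF g(1)]
  note cf = conj_fixed[OF g1, of T] and cn = conj_flipped[OF g1, of T]
  have nd1: "negdef (fixed (g \<circ> T \<circ> iv g))"
    unfolding negdef_def
  proof (intro conjI ballI impI subspace_fixed orthoD(1)[OF g(2)])
    fix x assume "x \<in> fixed (g \<circ> T \<circ> iv g)" "x \<noteq> 0"
    then obtain y where "y \<in> fixed T" "x = g y" "y \<noteq> 0" using isom_eq_0[OF g1] unfolding cf by blast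
    then show "B x x < 0" using negdefD[OF nd(1)] isom_B[OF g1] by simp
  qed
  show ?thesis
    using same_centr_max_dim[OF g(2) T' g(3) nd1] same_centr_max_dim[OF T' g(2) g(3)[symmetric] nd(2)]
    unfolding cf cn dim_isom_image[OF g1] by (rule antisym)
qed

lemma hyp_fixed:
  assumes T: "T \<in> ortho" and uv: "hyp_data T u v r"
  shows "fixed T \<subseteq> oc (span {u, v})" "negdef (fixed T)"
proof -
  note spl = hyp_splitting[OF T uv]
  show "fixed T \<subseteq> oc (span {u, v})"
    using split_E_oc[OF T spl(1), of 2] fixed_subset_E[OF orthoD(1)[OF T]] spl(3) by force
  then show "negdef (fixed T)"
    using negdef_mono[OF split_negdef[OF T spl(1)] subspace_fixed[OF orthoD(1)[OF T]]] by blast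
qed

theorem ell_zeq_iff:
  assumes T: "T \<in> ortho" "ell_data T p" and T': "T' \<in> ortho" "ell_data T' p'"
  shows "zeq T T' \<longleftrightarrow> dim (flipped T) = dim (flipped T') \<and> lam T = lam T'"
proof
  assume "zeq T T'"
  moreover have "T p = p" "p \<noteq> 0" "B p p \<ge> 0" "T' p' = p'" "p' \<noteq> 0" "B p' p' \<ge> 0"
    using T T' by (auto simp: ell_data_def)
  ultimately show "dim (flipped T) = dim (flipped T') \<and> lam T = lam T'"
    using zeq_lam[OF T(1) T'(1)] zeq_flipped[OF T(1) T'(1)] by blast
next
  assume same: "dim (flipped T) = dim (flipped T') \<and> lam T = lam T'"
  note spl = ell_splitting[OF T] and spl' = ell_splitting[OF T']
  have d: "T p = p" "B p p = 1" "T' p' = p'" "B p' p' = 1" using T T' by (auto simp: ell_data_def)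
  define f where "f x = B x p *\<^sub>R p'" for x
  have lin: "linear f" by (rule linearI) (simp_all add: f_def algebra_simps)
  have fp: "f p = p'" by (simp add: f_def d)
  show "zeq T T'"
  proof (rule splitting_zeq[OF T(1) T'(1) spl(1) spl'(1) lin, where \<delta> = 0 and \<gamma> = 1 and e = 1])
    show "f ` span {p} = span {p'}" unfolding linear_span_image[OF lin, symmetric] by (simp add: fp)
    show "B (f x) (f x) = B x x" if "x \<in> span {p}" for x
      by (rule isometric_on_span[OF lin _ that]) (simp add: fp d)
    show "T' (f x) = f (0 *\<^sub>R x + 1 *\<^sub>R T x)" if "x \<in> span {p}" for x
      by (rule intertwining_on_span[OF lin orthoD(2)[OF T(1)] orthoD(2)[OF T'(1)] _ that]) (simp add: fp d)
    \<comment> \<open>The dimension of the fixed vectors orthogonal to \<open>p\<close> follows from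
      the dimension formula.\<close>
    show "dim (piece T (span {p}) 2) = dim (piece T' (span {p'}) (2 * 1))"
      using dim_formula[OF T(1) spl(1)] dim_formula[OF T'(1) spl'(1)] spl(2) spl'(2) same by simp
  qed (use same in auto)
qed

theorem par_zeq_iff:
  assumes T: "T \<in> ortho" "par_data T w b u" and T': "T' \<in> ortho" "par_data T' w' b' u'"
  shows "zeq T T' \<longleftrightarrow> dim (flipped T) = dim (flipped T') \<and> lam T = lam T'"
proof
  assume "zeq T T'"
  moreover have "T u = u" "u \<noteq> 0" "B u u \<ge> 0" "T' u' = u'" "u' \<noteq> 0" "B u' u' \<ge> 0"
    using T T' by (auto simp: par_data_def)
  ultimately show "dim (flipped T) = dim (flipped T') \<and> lam T = lam T'"
    using zeq_lam[OF T(1) T'(1)] zeq_flipped[OF T(1) T'(1)] by blast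
next
  assume same: "dim (flipped T) = dim (flipped T') \<and> lam T = lam T'"
  note spl = par_splitting[OF T] and spl' = par_splitting[OF T']
  have d: "T w = w + b" "T b = b + u" "T u = u" "B w w = 0" "B b b = -1" "B u u = 0"
    "B w b = 1/2" "B b w = 1/2" "B w u = 1" "B u w = 1" "B b u = 0" "B u b = 0"
    using T(2) sym[of b w] sym[of u w] sym[of u b] by (auto simp: par_data_def)
  have d': "T' w' = w' + b'" "T' b' = b' + u'" "T' u' = u'" "B w' w' = 0" "B b' b' = -1" "B u' u' = 0"
    "B w' b' = 1/2" "B b' w' = 1/2" "B w' u' = 1" "B u' w' = 1" "B b' u' = 0" "B u' b' = 0"
    using T'(2) sym[of b' w'] sym[of u' w'] sym[of u' b'] by (auto simp: par_data_def)
  \<comment> \<open>the coefficients are the coordinates of \<open>x\<close> in the basis \<open>w, b, u\<close>\<close>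
  define f where "f x = B x u *\<^sub>R w' + (B x u / 2 - B x b) *\<^sub>R b' +
    (B x w - (B x u / 2 - B x b) / 2) *\<^sub>R u'" for x
  have lin: "linear f" by (rule linearI) (simp_all add: f_def algebra_simps add_divide_distrib diff_divide_distrib)
  have f: "f w = w'" "f b = b'" "f u = u'" by (simp_all add: f_def d)
  show "zeq T T'"
  proof (rule splitting_zeq[OF T(1) T'(1) spl(1) spl'(1) lin, where \<delta> = 0 and \<gamma> = 1 and e = 1])
    show "f ` span {w, b, u} = span {w', b', u'}" unfolding linear_span_image[OF lin, symmetric] by (simp add: f)
    show "B (f x) (f x) = B x x" if "x \<in> span {w, b, u}" for x
      by (rule isometric_on_span[OF lin _ that]) (auto simp: f d d')
    show "T' (f x) = f (0 *\<^sub>R x + 1 *\<^sub>R T x)" if "x \<in> span {w, b, u}" for x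
      by (rule intertwining_on_span[OF lin orthoD(2)[OF T(1)] orthoD(2)[OF T'(1)] _ that])
        (auto simp: f d d' linear_add[OF lin])
    show "dim (piece T (span {w, b, u}) 2) = dim (piece T' (span {w', b', u'}) (2 * 1))"
      using dim_formula[OF T(1) spl(1)] dim_formula[OF T'(1) spl'(1)] spl(2) spl'(2) same by simp
  qed (use same in auto)
qed

theorem hyp_zeq_iff:
  assumes T: "T \<in> ortho" "hyp_data T u v r" and T': "T' \<in> ortho" "hyp_data T' u' v' r'"
  shows "zeq T T' \<longleftrightarrow>
    min (dim (fixed T)) (dim (flipped T)) = min (dim (fixed T')) (dim (flipped T')) \<and> lam T = lam T'"
proof -
  note spl = hyp_splitting[OF T] and spl' = hyp_splitting[OF T']
  note fx = hyp_fixed[OF T] and fx' = hyp_fixed[OF T']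
  have fix_oc: "fixed T \<inter> oc (span {u, v}) = fixed T" "fixed T' \<inter> oc (span {u', v'}) = fixed T'"
    using fx(1) fx'(1) by auto
  have sum_dim: "dim (fixed T) + dim (flipped T) + 2 * sum_mset (lam T) + 2 = DIM('v)"
    "dim (fixed T') + dim (flipped T') + 2 * sum_mset (lam T') + 2 = DIM('v)"
    using dim_formula[OF T(1) spl(1)] dim_formula[OF T'(1) spl'(1)] spl(2) spl'(2) unfolding fix_oc by simp_all
  show ?thesis
  proof
    assume zeq: "zeq T T'"
    \<comment> \<open>The two eigenspace dimensions have the same sum for \<open>T\<close> and
      \<open>T'\<close>, so equal maxima give equal minima.\<close>
    note zeq_lam[OF T(1) T'(1) zeq] zeq_max_dim[OF T(1) T'(1) zeq fx(2) fx'(2)]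
    then show "min (dim (fixed T)) (dim (flipped T)) = min (dim (fixed T')) (dim (flipped T')) \<and> lam T = lam T'"
      using sum_dim by (simp add: min_def max_def split: if_splits)
  next
    assume same: "min (dim (fixed T)) (dim (flipped T)) = min (dim (fixed T')) (dim (flipped T')) \<and> lam T = lam T'"
    then have "dim (fixed T) + dim (flipped T) = dim (fixed T') + dim (flipped T')" using sum_dim by simp
    then have "dim (fixed T) = dim (fixed T') \<and> dim (flipped T) = dim (flipped T') \<or>
        dim (fixed T) = dim (flipped T') \<and> dim (flipped T) = dim (fixed T')"
      using same by (auto simp: min_def split: if_splits)
    then obtain e where e: "e = 1 \<or> e = (-1::real)"
      "dim (piece T (span {u, v}) 2) = dim (piece T' (span {u', v'}) (2 * e))"
      "dim (piece T (span {u, v}) (-2)) = dim (piece T' (span {u', v'}) (-2 * e))"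
    proof
      assume "dim (fixed T) = dim (fixed T') \<and> dim (flipped T) = dim (flipped T')"
      then show thesis by (intro that[of 1]) (auto simp: fix_oc)
    next
      assume "dim (fixed T) = dim (flipped T') \<and> dim (flipped T) = dim (fixed T')"
      then show thesis by (intro that[of "-1"]) (auto simp: fix_oc)
    qed
    have d: "r > 0" "r \<noteq> 1" "T u = r *\<^sub>R u" "T v = (1 / r) *\<^sub>R v" "B u u = 0" "B v v = 0" "B u v = 1" "B v u = 1"
      using T(2) sym[of v u] by (auto simp: hyp_data_def)
    have d': "r' > 0" "r' \<noteq> 1" "T' u' = r' *\<^sub>R u'" "T' v' = (1 / r') *\<^sub>R v'" "B u' u' = 0" "B v' v' = 0" "B u' v' = 1" "B v' u' = 1"
      using T'(2) sym[of v' u'] by (auto simp: hyp_data_def)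
    have ne: "x - 1 / x \<noteq> 0" if "x > 0" "x \<noteq> 1" for x :: real
    proof
      assume "x - 1 / x = 0"
      then have "x * x = 1" using that(1) by (simp add: field_simps)
      then show False using that by (auto simp: square_eq_1_iff)
    qed
    \<comment> \<open>The affine function \<open>\<delta> + \<gamma> x\<close> interpolates: it
      sends \<open>r\<close> to \<open>r'\<close> and \<open>1 / r\<close> to
      \<open>1 / r'\<close>.\<close>
    define \<gamma> where "\<gamma> = (r' - 1 / r') / (r - 1 / r)"
    define \<delta> where "\<delta> = r' - \<gamma> * r"
    have "\<gamma> \<noteq> 0" using ne[OF d(1,2)] ne[OF d'(1,2)] by (simp add: \<gamma>_def)
    have "\<gamma> * (r - 1 / r) = r' - 1 / r'" using ne[OF d(1,2)] by (simp add: \<gamma>_def)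
    then have coeffs: "\<delta> + \<gamma> * r = r'" "\<delta> + \<gamma> * (1 / r) = 1 / r'" by (simp_all add: \<delta>_def algebra_simps)
    \<comment> \<open>In the null basis the coordinate along \<open>u\<close> is
      \<open>B x v\<close> and the one along \<open>v\<close> is \<open>B x u\<close>.\<close>
    define f where "f x = B x v *\<^sub>R u' + B x u *\<^sub>R v'" for x
    have lin: "linear f" by (rule linearI) (simp_all add: f_def algebra_simps)
    have f: "f u = u'" "f v = v'" by (simp_all add: f_def d)
    show "zeq T T'"
    proof (rule splitting_zeq[OF T(1) T'(1) spl(1) spl'(1) lin, where \<delta> = \<delta> and \<gamma> = \<gamma> and e = e])
      show "f ` span {u, v} = span {u', v'}" unfolding linear_span_image[OF lin, symmetric] by (simp add: f)
      show "B (f x) (f x) = B x x" if "x \<in> span {u, v}" for x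
        by (rule isometric_on_span[OF lin _ that]) (auto simp: f d d')
      show "T' (f x) = f (\<delta> *\<^sub>R x + \<gamma> *\<^sub>R T x)" if "x \<in> span {u, v}" for x
      proof (rule intertwining_on_span[OF lin orthoD(2)[OF T(1)] orthoD(2)[OF T'(1)] _ that])
        fix x assume x: "x \<in> {u, v}"
        have "T' u' = (\<delta> + \<gamma> * r) *\<^sub>R u'" "T' v' = (\<delta> + \<gamma> * (1 / r)) *\<^sub>R v'" unfolding coeffs d' by auto
        then show "T' (f x) = f (\<delta> *\<^sub>R x + \<gamma> *\<^sub>R T x)"
          using x d(3,4) by (auto simp: f linear_add[OF lin] linear_scale[OF lin] scaleR_add_left)
      qed
      show "r + 1 / r = 2 \<longleftrightarrow> r' + 1 / r' = 2" using spl(3) spl'(3) by simp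
      show "e = 1 \<and> \<delta> = 0 \<and> \<gamma> = 1" if "r + 1 / r = 2" using that spl(3) by simp
    qed (use same e \<open>\<gamma> \<noteq> 0\<close> in auto)
  qed
qed

end

section \<open>Realizing and counting the invariants\<close>

lemma finite_partitions: "finite {M :: nat multiset. 0 \<notin># M \<and> sum_mset M = u}"
proof (rule finite_subset)
  show "{M :: nat multiset. 0 \<notin># M \<and> sum_mset M = u} \<subseteq> mset ` {xs. set xs \<subseteq> {..u} \<and> length xs \<le> u}"
  proof
    fix M :: "nat multiset" assume M: "M \<in> {M. 0 \<notin># M \<and> sum_mset M = u}"
    obtain xs where xs: "mset xs = M" using ex_mset by blast
    have "length xs \<le> sum_list xs" if "0 \<notin> set xs" for xs :: "nat list" using that by (induction xs) auto
    then have "length xs \<le> u" using M xs by (auto simp: sum_mset_sum_list[symmetric])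
    moreover have "x \<le> u" if "x \<in> set xs" for x
      using member_le_sum_list[OF that] M xs by (auto simp: sum_mset_sum_list[symmetric])
    ultimately show "M \<in> mset ` {xs. set xs \<subseteq> {..u} \<and> length xs \<le> u}" using xs by auto
  qed
  show "finite (mset ` {xs. set xs \<subseteq> {..u} \<and> length xs \<le> u})"
    by (simp add: finite_lists_length_le)
qed

lemma count_pairs:
  fixes K :: "nat set" and g :: "nat \<Rightarrow> nat"
  assumes K: "finite K"
  defines "S \<equiv> {(b :: nat, M :: nat multiset). 0 \<notin># M \<and> sum_mset M \<in> K \<and> b < g (sum_mset M)}"
  shows "finite S" "card S = (\<Sum>k\<in>K. g k * num_partitions k)"
proof -
  let ?P = "\<lambda>u. {M :: nat multiset. 0 \<notin># M \<and> sum_mset M = u}"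
  have S: "S = (\<Union>k\<in>K. {..<g k} \<times> ?P k)" by (auto simp: S_def)
  show "finite S" unfolding S using K finite_partitions by blast
  have "card S = (\<Sum>k\<in>K. card ({..<g k} \<times> ?P k))"
    unfolding S by (rule card_UN_disjoint) (use K finite_partitions in auto)
  then show "card S = (\<Sum>k\<in>K. g k * num_partitions k)"
    by (simp add: card_cartesian_product num_partitions_def)
qed

context lorentz
begin

lemma lam_pos:
  assumes T: "T \<in> ortho"
  shows "0 \<notin># lam T"
proof -
  have pos: "dim (E T c) div 2 \<noteq> 0" if c: "c \<in> rot T" for c
  proof -
    have "dim (E T c) \<noteq> 0"
      using c subspace_dim_0_iff[OF subspace_E[OF orthoD(1)[OF T]], of c] by (simp add: rot_def)
    then show ?thesis
      using even_dim_cstruct[OF cstruct_E[OF T rot_bounds[OF c]]] by (metis dvd_mult_div_cancel mult_0_right)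
  qed
  show ?thesis
  proof
    assume "0 \<in># lam T"
    then obtain c where "c \<in> rot T" "dim (E T c) div 2 = 0"
      using finite_rot[OF T] by (auto simp: lam_def)
    then show False using pos by blast
  qed
qed

lemma flipped_eq_E:
  assumes T: "T \<in> ortho" and spl: "splitting T P k"
  shows "flipped T = E T (-2)"
proof
  show "flipped T \<subseteq> E T (-2)" by (rule flipped_subset_E[OF orthoD(1)[OF T]])
  show "E T (-2) \<subseteq> flipped T"
  proof
    fix v assume v: "v \<in> E T (-2)"
    then have "v \<in> oc P" using split_E_oc[OF T spl, of "-2"] split_k[OF T spl] by auto
    then show "v \<in> flipped T"
      using split_eigen(3)[OF T spl _ v] subspace_0[OF subspace_flipped[OF orthoD(1)[OF T]]] by (cases "v = 0") auto
  qed
qed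

lemma twist:
  assumes T: "T \<in> ortho" and spl: "splitting T P k"
    and X: "subspace X" "X \<subseteq> fixed T" "X \<subseteq> oc P"
    and twisting: "isom A" "\<forall>x\<in>X. A x \<in> X" "\<forall>y\<in>oc X. A y = y" "\<forall>x\<in>X. A x + iv A x = c0 *\<^sub>R x"
    and c0: "\<bar>c0\<bar> \<le> 2" "c0 \<noteq> 2" "E T c0 = {0}"
  shows "T \<circ> A \<in> ortho" "splitting (T \<circ> A) P k" "\<And>p. p \<in> P \<Longrightarrow> (T \<circ> A) p = T p"
    "E (T \<circ> A) c0 = X" "\<And>c. c \<noteq> c0 \<Longrightarrow> c \<noteq> 2 \<Longrightarrow> E (T \<circ> A) c = E T c"
proof -
  note T1 = orthoD(1)[OF T] and lin = orthoD(2)[OF T]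
  have A: "isom A" "\<And>x. x \<in> X \<Longrightarrow> A x \<in> X" "\<And>y. y \<in> oc X \<Longrightarrow> A y = y"
    "\<And>x. x \<in> X \<Longrightarrow> A x + iv A x = c0 *\<^sub>R x" using twisting by auto
  let ?T = "T \<circ> A"
  have "x \<in> oc X" if "x \<in> P" for x unfolding oc_iff using ocD(2)[OF _ that] X(3) by blast
  then have PX: "P \<subseteq> oc X" by blast
  obtain p where p: "p \<in> P" "B p p > 0" using spl by (auto simp: splitting_def)
  have "A \<in> ortho"
  proof (rule isom_in_ortho[OF A(1)])
    show "B p p \<ge> 0" "p \<noteq> 0" using p(2) by auto
    show "A p = 1 *\<^sub>R p" using A(3) PX p(1) by auto
  qed simp
  then show ortho: "?T \<in> ortho" by (rule ortho_comp[OF T])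
  note T'1 = orthoD(1)[OF ortho] and lin' = orthoD(2)[OF ortho]
  have iA: "iv A y = y" if "y \<in> oc X" for y using isom_inv_eqI[OF A(1) A(3)[OF that]] .
  have iT: "iv ?T v = iv A (iv T v)" for v
    by (rule isom_inv_eqI[OF T'1]) (simp add: A(1) T1)
  have Tx: "T x = x" "iv T x = x" if "x \<in> X" for x
    using X(2) that isom_inv_eqI[OF T1, of x x] by (auto simp: fixed_def)
  have ocT: "iv T y \<in> oc X" if "y \<in> oc X" for y
  proof -
    have "B x (iv T y) = 0" if "x \<in> X" for x
      using isom_adjoint[OF T1, of x y] Tx(1)[OF that] ocD(2)[OF \<open>y \<in> oc X\<close> that] by simp
    then show ?thesis by (simp add: oc_iff sym)
  qed
  have on_X: "?T x + iv ?T x = c0 *\<^sub>R x" if "x \<in> X" for x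
    using A(4)[OF that] Tx(1)[OF A(2)[OF that]] Tx(2)[OF that] by (simp add: iT)
  have on_oc: "?T y = T y" "iv ?T y = iv T y" if "y \<in> oc X" for y
    using A(3)[OF that] iA[OF ocT[OF that]] by (simp_all add: iT)
  have ndX: "nondeg X" using negdef_nondeg[OF negdef_mono[OF split_negdef[OF T spl] X(1,3)]] .
  show eqP: "?T p = T p" if "p \<in> P" for p using on_oc(1) PX that by blast
  have P_E: "z \<in> E ?T c \<longleftrightarrow> z \<in> E T c" if "z \<in> oc X" for z c
    unfolding E_def mem_Collect_eq on_oc[OF that] ..
  show "splitting ?T P k"
    unfolding splitting_def
  proof (intro conjI ballI split_subspace[OF T spl] split_k[OF T spl])
    show "\<exists>p\<in>P. B p p > 0" using p by blast
    show "?T p \<in> P" if "p \<in> P" for p using eqP[OF that] split_T[OF T spl that] by simp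
    show "P \<subseteq> Gen ?T k"
    proof
      fix p assume pP: "p \<in> P"
      then have pX: "p \<in> oc X" using PX by blast
      have "T p + iv T p - k *\<^sub>R p \<in> E T k" using split_Gen[OF T spl] pP by (auto simp: Gen_def)
      moreover have "T p + iv T p - k *\<^sub>R p \<in> oc X" using split_shift(1)[OF T spl pP] PX by blast
      ultimately have "T p + iv T p - k *\<^sub>R p \<in> E ?T k" using P_E by blast
      then show "p \<in> Gen ?T k" unfolding Gen_def mem_Collect_eq on_oc[OF pX] .
    qed
  qed
  have X_E: "X \<subseteq> E ?T c0" using on_X by (auto simp: E_def)
  show "E ?T c0 = X"
  proof
    show "E ?T c0 \<subseteq> X"
    proof
      fix v assume v: "v \<in> E ?T c0"
      obtain x y where xy: "x \<in> X" "y \<in> oc X" "v = x + y" using nondeg_decompose[OF ndX] .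
      have "y = v - x" using xy by simp
      then have "y \<in> E ?T c0" using v xy(1) X_E subspace_diff[OF subspace_E[OF T'1]] by blast
      then have "y = 0" using P_E[OF xy(2)] c0(3) by blast
      then show "v \<in> X" using xy by simp
    qed
  qed (rule X_E)
  show "E ?T c = E T c" if c: "c \<noteq> c0" "c \<noteq> 2" for c
  proof -
    have "x \<in> oc X" if "x \<in> E ?T c" for x
      unfolding oc_iff using E_orthogonal[OF T'1 that _ c(1)] X_E by blast
    moreover have "X \<subseteq> E T 2" using X(2) fixed_subset_E[OF T1] by blast
    then have "x \<in> oc X" if "x \<in> E T c" for x
      unfolding oc_iff using E_orthogonal[OF T1 that _ c(2)] by blast
    ultimately show ?thesis using P_E by blast
  qed
qed

text \<open>On \<open>X\<close> the map is \<open>a + s J\<close> with \<open>a^2 + s^2 = 1\<close>,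
  extended by the identity; its inverse there is \<open>a - s J\<close>, so the two add up to
  \<open>2 a\<close>.\<close>

lemma partial_rotation:
  assumes J: "cstruct X J" and a: "\<bar>a\<bar> < (1::real)"
  obtains A where "isom A" "\<forall>x\<in>X. A x \<in> X" "\<forall>y\<in>oc X. A y = y"
    "\<forall>x\<in>X. A x + iv A x = (2 * a) *\<^sub>R x"
proof -
  have X: "negdef X" "subspace X" and linJ: "linear J"
    and JX: "\<And>x. x \<in> X \<Longrightarrow> J x \<in> X" "\<And>x. x \<in> X \<Longrightarrow> J (J x) = - x"
      "\<And>x. x \<in> X \<Longrightarrow> B (J x) (J x) = B x x" "\<And>x. x \<in> X \<Longrightarrow> B (J x) x = 0"
    using J negdef_subspace by (auto simp: cstruct_def)
  obtain \<pi> where \<pi>: "linear \<pi>" "\<And>v. \<pi> v \<in> X" "\<And>v. v - \<pi> v \<in> oc X"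
    "\<And>v. v \<in> X \<Longrightarrow> \<pi> v = v" "\<And>v. v \<in> oc X \<Longrightarrow> \<pi> v = 0" using nondeg_projection[OF negdef_nondeg[OF X(1)]] by metis
  define s where "s = sqrt (1 - a\<^sup>2)"
  have "a\<^sup>2 < 1" using a by (simp add: abs_square_less_1)
  then have s: "a * a + s * s = 1" by (simp add: s_def power2_eq_square)
  define A where "A v = (v - \<pi> v) + (a *\<^sub>R \<pi> v + s *\<^sub>R J (\<pi> v))" for v
  have A_X: "A x = a *\<^sub>R x + s *\<^sub>R J x" if "x \<in> X" for x using \<pi>(4)[OF that] by (simp add: A_def)
  have in_X: "a *\<^sub>R x + s *\<^sub>R J x \<in> X" if "x \<in> X" for x
    using that JX(1) X(2) by (intro subspace_add subspace_scale) auto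
  have "linear A"
    by (rule linearI)
      (simp_all add: A_def linear_add[OF \<pi>(1)] linear_scale[OF \<pi>(1)] linear_add[OF linJ] linear_scale[OF linJ] algebra_simps)
  moreover have "B (A v) (A v) = B v v" for v
  proof -
    define x y z where "x = \<pi> v" and "y = v - \<pi> v" and "z = a *\<^sub>R x + s *\<^sub>R J x"
    have x: "x \<in> X" using \<pi>(2) by (simp add: x_def)
    have y: "y \<in> oc X" using \<pi>(3) by (simp add: y_def)
    have z: "z \<in> X" unfolding z_def by (rule in_X[OF x])
    note 0 = ocD[OF y x] ocD[OF y z]
    have "B z z = (a * a + s * s) * B x x"
      using JX(3,4)[OF x] sym[of x "J x"] by (simp add: z_def algebra_simps)
    then have zz: "B z z = B x x" by (simp add: s)
    have "A v = y + z" "v = y + x" by (simp_all add: A_def x_def y_def z_def)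
    then show ?thesis by (simp only: B_simps(1,2) 0 zz add_0_left add_0_right)
  qed
  ultimately have isoA: "isom A" by (rule isom_polarize)
  moreover have "A x \<in> X" if "x \<in> X" for x using A_X[OF that] in_X[OF that] by simp
  moreover have "A y = y" if "y \<in> oc X" for y
    using \<pi>(5)[OF that] by (simp add: A_def linear_0[OF linJ])
  moreover have "A x + iv A x = (2 * a) *\<^sub>R x" if x: "x \<in> X" for x
  proof -
    have "a *\<^sub>R x - s *\<^sub>R J x \<in> X" using x JX(1) X(2) by (intro subspace_diff subspace_scale) auto
    then have "A (a *\<^sub>R x - s *\<^sub>R J x) = (a * a + s * s) *\<^sub>R x"
      using A_X x by (simp add: linear_diff[OF linJ] linear_scale[OF linJ] JX(2) algebra_simps)
    then have "iv A x = a *\<^sub>R x - s *\<^sub>R J x" using s by (intro isom_inv_eqI[OF isoA]) simp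
    then have "A x + iv A x = a *\<^sub>R x + a *\<^sub>R x" using A_X[OF x] by simp
    then show ?thesis by (simp flip: scaleR_left_distrib)
  qed
  ultimately show thesis by (intro that) blast+
qed

lemma partial_flip:
  assumes X: "negdef X"
  obtains A where "isom A" "\<forall>x\<in>X. A x \<in> X" "\<forall>y\<in>oc X. A y = y"
    "\<forall>x\<in>X. A x + iv A x = (-2) *\<^sub>R x"
proof -
  obtain \<pi> where \<pi>: "linear \<pi>" "\<And>v. \<pi> v \<in> X" "\<And>v. v - \<pi> v \<in> oc X"
    "\<And>v. v \<in> X \<Longrightarrow> \<pi> v = v" "\<And>v. v \<in> oc X \<Longrightarrow> \<pi> v = 0" using nondeg_projection[OF negdef_nondeg[OF X]] by metis
  define A where "A v = v - 2 *\<^sub>R \<pi> v" for v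
  have A_X: "A x = - x" if "x \<in> X" for x using \<pi>(4)[OF that] by (simp add: A_def scaleR_2)
  have "linear A"
    by (rule linearI) (simp_all add: A_def linear_add[OF \<pi>(1)] linear_scale[OF \<pi>(1)] algebra_simps)
  moreover have "B (A v) (A v) = B v v" for v
    using ocD[OF \<pi>(3)[of v] \<pi>(2)[of v]] sym[of v "\<pi> v"] by (simp add: A_def)
  ultimately have isoA: "isom A" by (rule isom_polarize)
  moreover have "A x \<in> X" if "x \<in> X" for x
    using A_X[OF that] that subspace_neg[OF negdef_subspace[OF X]] by simp
  moreover have "A y = y" if "y \<in> oc X" for y using \<pi>(5)[OF that] by (simp add: A_def)
  moreover have "A x + iv A x = (-2) *\<^sub>R x" if x: "x \<in> X" for x
  proof -
    have "iv A x = - x" using A_X[OF x] by (intro isom_inv_eqI[OF isoA]) (simp add: linear_neg[OF isom_linear[OF isoA]])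
    then show ?thesis using A_X[OF x] by (simp add: scaleR_2)
  qed
  ultimately show thesis by (intro that) blast+
qed

lemma subspace_of_dim:
  fixes S :: "'v set"
  assumes "subspace S" "m \<le> dim S"
  obtains X where "subspace X" "X \<subseteq> S" "dim X = m"
proof -
  obtain X where "subspace X" "X \<subseteq> span S" "dim X = m" by (rule choose_subspace_of_subspace[OF assms(2)])
  moreover have "span S = S" using assms(1) by (simp add: span_eq_iff)
  ultimately show thesis using that by simp
qed

text \<open>New pieces are carved out of the fixed vectors in \<open>oc P\<close>: a flip on a
  subspace of dimension \<open>b\<close>, then for each part \<open>m\<close> a rotation on a
  subspace of dimension \<open>2 m\<close>. The dimension formula guarantees enough room at every
  step.\<close>

lemma realize:
  assumes T0: "T0 \<in> ortho" and spl: "splitting T0 P k" and id: "\<And>w. w \<in> oc P \<Longrightarrow> T0 w = w"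
    and M: "0 \<notin># M" and b: "b + 2 * sum_mset M \<le> dim (oc P)"
  shows "\<exists>T. T \<in> ortho \<and> splitting T P k \<and> (\<forall>p\<in>P. T p = T0 p) \<and> dim (flipped T) = b \<and> lam T = M"
  using M b
proof (induction M)
  case empty
  have oc_fixed: "oc P \<subseteq> fixed T0" using id by (auto simp: fixed_def)
  have E0: "E T0 c = {0}" if "c < 2" for c
  proof -
    have "v = 0" if v: "v \<in> E T0 c" for v
    proof -
      have "v \<in> oc P" using split_E_oc[OF T0 spl, of c] split_k[OF T0 spl] \<open>c < 2\<close> v by auto
      then have "v \<in> E T0 2" using oc_fixed fixed_subset_E[OF orthoD(1)[OF T0]] by blast
      then show ?thesis using E_inj[OF v, of 2] \<open>c < 2\<close> by auto
    qed
    then show ?thesis using subspace_0[OF subspace_E[OF orthoD(1)[OF T0]]] by blast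
  qed
  have "b \<le> dim (oc P)" using empty.prems by simp
  then obtain X where X: "subspace X" "X \<subseteq> oc P" "dim X = b" by (rule subspace_of_dim[OF subspace_oc])
  obtain A where A: "isom A" "\<forall>x\<in>X. A x \<in> X" "\<forall>y\<in>oc X. A y = y" "\<forall>x\<in>X. A x + iv A x = (-2) *\<^sub>R x"
    by (rule partial_flip[OF negdef_mono[OF split_negdef[OF T0 spl] X(1,2)]])
  have "X \<subseteq> fixed T0" using X(2) oc_fixed by blast
  have c0: "\<bar>-2 :: real\<bar> \<le> 2" "-2 \<noteq> (2 :: real)" "E T0 (-2) = {0}" by (simp_all add: E0)
  note tw = twist[OF T0 spl X(1) \<open>X \<subseteq> fixed T0\<close> X(2) A c0]
  have "E (T0 \<circ> A) c = {0}" if "\<bar>c\<bar> < 2" for c using tw(5)[of c] E0[of c] that by force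
  then have "rot (T0 \<circ> A) = {}" by (simp add: rot_def)
  then have "lam (T0 \<circ> A) = {#}" by (simp add: lam_def)
  moreover have "dim (flipped (T0 \<circ> A)) = b" using flipped_eq_E[OF tw(1,2)] tw(4) X(3) by simp
  ultimately show ?case using tw(1-3) by blast
next
  case (add m M)
  then obtain T where T: "T \<in> ortho" "splitting T P k" "\<forall>p\<in>P. T p = T0 p" "dim (flipped T) = b" "lam T = M"
    by auto
  let ?F = "fixed T \<inter> oc P"
  have "dim (oc P) + dim P = DIM('v)" by (rule dim_oc[OF split_subspace[OF T0 spl]])
  then have "2 * m \<le> dim ?F" using dim_formula[OF T(1,2)] T(4,5) add.prems by simp
  then obtain X where X: "subspace X" "X \<subseteq> ?F" "dim X = 2 * m"
    by (rule subspace_of_dim[OF subspace_inter[OF subspace_fixed[OF orthoD(1)[OF T(1)]] subspace_oc]])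
  have XF: "X \<subseteq> fixed T" "X \<subseteq> oc P" using X(2) by auto
  have "negdef X" by (rule negdef_mono[OF split_negdef[OF T0 spl] X(1) XF(2)])
  then obtain J where J: "cstruct X J" using cstruct_exists X(3) by fastforce
  \<comment> \<open>Only finitely many rotation parameters are in use, so a fresh one exists; a used
    one would enlarge an old rotation space instead of adding a part.\<close>
  have "infinite {-2<..<2 :: real}" by (rule infinite_Ioo) simp
  then have "\<not> {-2<..<2} \<subseteq> rot T" using finite_subset[OF _ finite_rot[OF T(1)]] by blast
  then obtain c where "c \<in> {-2<..<2}" "c \<notin> rot T" by blast
  then have c: "\<bar>c\<bar> < 2" "c \<notin> rot T" by auto
  then have Ec: "E T c = {0}" by (simp add: rot_def)
  have "\<bar>c / 2\<bar> < 1" using c(1) by simp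
  then obtain A where A: "isom A" "\<forall>x\<in>X. A x \<in> X" "\<forall>y\<in>oc X. A y = y"
    "\<forall>x\<in>X. A x + iv A x = (2 * (c / 2)) *\<^sub>R x" by (rule partial_rotation[OF J])
  have A': "\<forall>x\<in>X. A x + iv A x = c *\<^sub>R x" using A(4) by simp
  have "\<bar>c\<bar> \<le> 2" "c \<noteq> 2" "-2 \<noteq> c" using c(1) by auto
  note tw = twist[OF T(1,2) X(1) XF A(1-3) A' this(1,2) Ec]
  have "dim X \<noteq> 0" using X(3) add.prems(1) by simp
  then have "X \<noteq> {0}" by auto
  then have "d \<in> rot (T \<circ> A) \<longleftrightarrow> d = c \<or> d \<in> rot T" for d
    using tw(4) tw(5)[of d] c(1) by (cases "d = c"; cases "d = 2") (simp_all add: rot_def)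
  then have rot': "rot (T \<circ> A) = insert c (rot T)" by blast
  have "lam (T \<circ> A) = add_mset (dim (E (T \<circ> A) c) div 2)
      (image_mset (\<lambda>d. dim (E (T \<circ> A) d) div 2) (mset_set (rot T)))"
    using c(2) finite_rot[OF T(1)] by (simp add: lam_def rot')
  also have "image_mset (\<lambda>d. dim (E (T \<circ> A) d) div 2) (mset_set (rot T)) = lam T"
    unfolding lam_def
  proof (rule image_mset_cong)
    fix d assume "d \<in># mset_set (rot T)"
    then have "d \<in> rot T" using finite_rot[OF T(1)] by simp
    then have "d \<noteq> c" "d \<noteq> 2" using c(2) rot_neq by auto
    then show "dim (E (T \<circ> A) d) div 2 = dim (E T d) div 2" using tw(5) by simp
  qed
  finally have lam': "lam (T \<circ> A) = add_mset (dim (E (T \<circ> A) c) div 2) (lam T)" .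
  have "2 * m div 2 = m" by simp
  then have "lam (T \<circ> A) = add_mset m M" unfolding lam' tw(4) X(3) T(5) by (rule arg_cong)
  moreover have "(-2 :: real) \<noteq> 2" by simp
  then have "flipped (T \<circ> A) = flipped T"
    unfolding flipped_eq_E[OF tw(1,2)] flipped_eq_E[OF T(1,2)] by (rule tw(5)[OF \<open>-2 \<noteq> c\<close>])
  then have "dim (flipped (T \<circ> A)) = b" using T(4) by (rule ssubst)
  moreover have "\<forall>p\<in>P. (T \<circ> A) p = T0 p" using tw(3) T(3) by metis
  ultimately show ?case using tw(1,2) by blast
qed


lemma ortho_units:
  assumes "m < DIM('v)" "subspace X" "dim X \<le> m" "e0 \<in> X"
  obtains y where "y \<in> oc X" "B y y = -1"
proof -
  have "dim (oc X) \<noteq> 0" using dim_oc[OF assms(2)] assms(1,3) by linarith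
  then have "oc X \<noteq> {0}" by auto
  moreover have "negdef (oc X)" by (rule timelike_oc_negdef[OF assms(4)]) (simp add: e0)
  ultimately show thesis using negdef_unit_vector that by blast
qed

section \<open>One model of each type\<close>

lemma ell_exists: "ell_data id e0"
  by (simp add: ell_data_def e0)

lemma hyp_exists:
  assumes "DIM('v) \<ge> 2"
  obtains T u v r where "T \<in> ortho" "hyp_data T u v r" "\<forall>w\<in>oc (span {u, v}). T w = w"
proof -
  obtain y where y: "y \<in> oc (span {e0})" "B y y = -1"
    using ortho_units[of 1 "span {e0}"] assms dim_le_card[of "span {e0}" "{e0}"] span_base[of e0 "{e0}"] by auto
  have ey: "B e0 y = 0" "B y e0 = 0" using y(1) ocD span_base[of e0 "{e0}"] by auto
  define u where "u = e0 + y"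
  define v where "v = (1/2) *\<^sub>R (e0 - y)"
  have uv: "B u u = 0" "B v v = 0" "B u v = 1" "B v u = 1" using ey y(2) e0 by (simp_all add: u_def v_def)
  \<comment> \<open>The eigenvalue is 2 on \<open>u\<close> and 1/2 on \<open>v\<close>, with the
    identity on the complement; \<open>B x v\<close> and \<open>B x u\<close> are the coordinates of
    \<open>x\<close> along \<open>u\<close> and \<open>v\<close>.\<close>
  define T where "T x = x + B x v *\<^sub>R u - (B x u / 2) *\<^sub>R v" for x
  have "T v = 1 *\<^sub>R v - (1 / 2) *\<^sub>R v" by (simp add: T_def uv)
  also have "\<dots> = (1 / 2) *\<^sub>R v" by (simp flip: scaleR_left_diff_distrib del: scaleR_one)
  finally have Tuv: "T u = 2 *\<^sub>R u" "T v = (1 / 2) *\<^sub>R v" by (simp_all add: T_def uv scaleR_2)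
  have "linear T" by (rule linearI) (simp_all add: T_def algebra_simps add_divide_distrib)
  moreover have "B (T x) (T x) = B x x" for x
    by (simp add: T_def uv sym[of u x] sym[of v x] algebra_simps)
  ultimately have iso: "isom T" by (rule isom_polarize)
  have u0: "u \<noteq> 0" using uv by auto
  have "T \<in> ortho" by (rule isom_in_ortho[OF iso _ u0 Tuv(1)]) (simp_all add: uv)
  moreover have "hyp_data T u v 2" using Tuv uv by (simp add: hyp_data_def)
  moreover have "T w = w" if "w \<in> oc (span {u, v})" for w
    using that unfolding oc_span by (simp add: T_def oc_iff)
  ultimately show thesis by (intro that) blast+
qed

lemma par_exists:
  assumes "DIM('v) \<ge> 3"
  obtains T w b u where "T \<in> ortho" "par_data T w b u" "\<forall>x\<in>oc (span {w, b, u}). T x = x"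
proof -
  obtain y where y: "y \<in> oc (span {e0})" "B y y = -1"
    using ortho_units[of 1 "span {e0}"] assms dim_le_card[of "span {e0}" "{e0}"] span_base[of e0 "{e0}"] by auto
  have "dim (span {e0, y}) \<le> card {e0, y}" by (rule dim_le_card) auto
  also have "\<dots> \<le> 2" by (simp add: card_insert_if)
  finally obtain b where b: "b \<in> oc (span {e0, y})" "B b b = -1"
    using ortho_units[of 2 "span {e0, y}"] assms span_base[of e0 "{e0, y}"] by auto
  have o: "B e0 y = 0" "B y e0 = 0" "B e0 b = 0" "B b e0 = 0" "B y b = 0" "B b y = 0"
    using y(1) b(1) unfolding oc_span oc_iff by (simp_all add: sym[of e0] sym[of y b])
  define u where "u = e0 + y"
  \<comment> \<open>The first summand is null and has product 1 with \<open>u\<close>;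
    \<open>- b / 2\<close> gives \<open>B w b = 1/2\<close> but adds -1/4 to the square, which the
    multiple 1/8 of \<open>u\<close> compensates.\<close>
  define w where "w = (1/2) *\<^sub>R (e0 - y) - (1/2) *\<^sub>R b + (1/8) *\<^sub>R u"
  have d: "B u u = 0" "B b u = 0" "B u b = 0" "B w u = 1" "B u w = 1" "B w b = 1/2" "B b w = 1/2" "B w w = 0"
    using o y(2) b(2) e0 by (simp_all add: u_def w_def)
  \<comment> \<open>an Eichler transvection\<close>
  define T where "T x = x + B x u *\<^sub>R b + (B x u / 2 - B x b) *\<^sub>R u" for x
  have "linear T" by (rule linearI) (simp_all add: T_def algebra_simps add_divide_distrib diff_divide_distrib)
  moreover have "B (T x) (T x) = B x x" for x
    by (simp add: T_def d b(2) sym[of u x] sym[of b x] algebra_simps)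
  ultimately have iso: "isom T" by (rule isom_polarize)
  have T: "T u = u" "T b = b + u" "T w = w + b" by (simp_all add: T_def d b(2))
  have u0: "u \<noteq> 0" using d by auto
  have "T \<in> ortho" by (rule isom_in_ortho[OF iso _ u0, of 1]) (simp_all add: d T)
  moreover have "par_data T w b u" using T d b(2) by (simp add: par_data_def)
  moreover have "T x = x" if "x \<in> oc (span {w, b, u})" for x
    using that unfolding oc_span by (simp add: T_def oc_iff)
  ultimately show thesis by (intro that) blast+
qed

section \<open>The values taken by the invariants\<close>

lemma ell_data_set:
  "(\<lambda>T. (dim (flipped T), lam T)) ` {T \<in> ortho. \<exists>p. ell_data T p} =
    {(b, M). 0 \<notin># M \<and> b + 2 * sum_mset M + 1 \<le> DIM('v)}" (is "?L = ?R")
proof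
  show "?L \<subseteq> ?R"
  proof clarify
    fix T p assume T: "T \<in> ortho" "ell_data T p"
    show "0 \<notin># lam T \<and> dim (flipped T) + 2 * sum_mset (lam T) + 1 \<le> DIM('v)"
      using lam_pos[OF T(1)] dim_formula[OF T(1) ell_splitting(1)[OF T]] ell_splitting(2)[OF T] by simp
  qed
  show "?R \<subseteq> ?L"
  proof clarify
    fix b M assume M: "0 \<notin># M" "b + 2 * sum_mset M + 1 \<le> DIM('v)"
    note spl = ell_splitting[OF ortho_id ell_exists]
    have "b + 2 * sum_mset M \<le> dim (oc (span {e0}))"
      using dim_oc[of "span {e0}"] spl(2) M(2) by simp
    from realize[OF ortho_id spl(1) id_apply M(1) this]
    obtain T where T: "T \<in> ortho" "splitting T (span {e0}) 2" "\<forall>p\<in>span {e0}. T p = id p"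
      "dim (flipped T) = b" "lam T = M" by blast
    then have "ell_data T e0" using ell_exists span_base[of e0 "{e0}"] by (simp add: ell_data_def)
    then have "T \<in> {T \<in> ortho. \<exists>p. ell_data T p}" using T(1) by blast
    then show "(b, M) \<in> ?L" by (rule image_eqI[rotated]) (simp add: T)
  qed
qed

lemma par_data_set:
  "(\<lambda>T. (dim (flipped T), lam T)) ` {T \<in> ortho. \<exists>w b u. par_data T w b u} =
    {(b, M). 0 \<notin># M \<and> b + 2 * sum_mset M + 3 \<le> DIM('v)}" (is "?L = ?R")
proof
  show "?L \<subseteq> ?R"
  proof clarify
    fix T w b u assume T: "T \<in> ortho" "par_data T w b u"
    show "0 \<notin># lam T \<and> dim (flipped T) + 2 * sum_mset (lam T) + 3 \<le> DIM('v)"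
      using lam_pos[OF T(1)] dim_formula[OF T(1) par_splitting(1)[OF T]] par_splitting(2)[OF T] by simp
  qed
  show "?R \<subseteq> ?L"
  proof clarify
    fix m M assume M: "0 \<notin># M" "m + 2 * sum_mset M + 3 \<le> DIM('v)"
    have "DIM('v) \<ge> 3" using M(2) by linarith
    then obtain T0 w b u where T0: "T0 \<in> ortho" "par_data T0 w b u" "\<forall>x\<in>oc (span {w, b, u}). T0 x = x"
      by (rule par_exists)
    note spl = par_splitting[OF T0(1,2)]
    have "m + 2 * sum_mset M \<le> dim (oc (span {w, b, u}))"
      using dim_oc[of "span {w, b, u}"] spl(2) M(2) by simp
    from realize[OF T0(1) spl(1) bspec[OF T0(3)] M(1) this]
      obtain T where T: "T \<in> ortho" "splitting T (span {w, b, u}) 2" "\<forall>p\<in>span {w, b, u}. T p = T0 p"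
      "dim (flipped T) = m" "lam T = M" by blast
    then have "T w = T0 w" "T b = T0 b" "T u = T0 u" by (auto intro: span_base)
    then have "par_data T w b u" using T0(2) by (simp add: par_data_def)
    then have "T \<in> {T \<in> ortho. \<exists>w b u. par_data T w b u}" using T(1) by blast
    then show "(m, M) \<in> ?L" by (rule image_eqI[rotated]) (simp add: T)
  qed
qed

text \<open>The bound contains \<open>2 * b\<close> because \<open>b\<close> is the smaller of two
  dimensions whose sum is given by the dimension formula.\<close>

lemma hyp_data_set:
  "(\<lambda>T. (min (dim (fixed T)) (dim (flipped T)), lam T)) ` {T \<in> ortho. \<exists>u v r. hyp_data T u v r} =
    {(b, M). 0 \<notin># M \<and> 2 * b + 2 * sum_mset M + 2 \<le> DIM('v)}" (is "?L = ?R")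
proof -
  have dims: "dim (fixed T) + dim (flipped T) + 2 * sum_mset (lam T) + 2 = DIM('v)"
    if T: "T \<in> ortho" "hyp_data T u v r" for T u v r
  proof -
    have "fixed T \<inter> oc (span {u, v}) = fixed T" using hyp_fixed(1)[OF T] by blast
    then show ?thesis using dim_formula[OF T(1) hyp_splitting(1)[OF T]] hyp_splitting(2)[OF T] by simp
  qed
  show ?thesis
  proof
    show "?L \<subseteq> ?R"
    proof clarify
      fix T u v r assume T: "T \<in> ortho" "hyp_data T u v r"
      show "0 \<notin># lam T \<and> 2 * min (dim (fixed T)) (dim (flipped T)) + 2 * sum_mset (lam T) + 2 \<le> DIM('v)"
        using lam_pos[OF T(1)] dims[OF T] by (simp add: min_def)
    qed
    show "?R \<subseteq> ?L"
    proof clarify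
      fix m M assume M: "0 \<notin># M" "2 * m + 2 * sum_mset M + 2 \<le> DIM('v)"
      have "DIM('v) \<ge> 2" using M(2) by linarith
    then obtain T0 u v r where T0: "T0 \<in> ortho" "hyp_data T0 u v r" "\<forall>x\<in>oc (span {u, v}). T0 x = x"
        by (rule hyp_exists)
      note spl = hyp_splitting[OF T0(1,2)]
      have "m + 2 * sum_mset M \<le> dim (oc (span {u, v}))"
        using dim_oc[of "span {u, v}"] spl(2) M(2) by simp
      from realize[OF T0(1) spl(1) bspec[OF T0(3)] M(1) this]
      obtain T where T: "T \<in> ortho" "splitting T (span {u, v}) (r + 1 / r)" "\<forall>p\<in>span {u, v}. T p = T0 p"
        "dim (flipped T) = m" "lam T = M" by blast
      then have "T u = T0 u" "T v = T0 v" by (auto intro: span_base)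
      then have h: "hyp_data T u v r" using T0(2) by (simp add: hyp_data_def)
      \<comment> \<open>The inequality leaves at least \<open>m\<close> dimensions for the fixed
        space, so the prescribed -1-eigenspace is not the larger one.\<close>
      have "min (dim (fixed T)) (dim (flipped T)) = m" using dims[OF T(1) h] T(4,5) M(2) by simp
      moreover have "T \<in> {T \<in> ortho. \<exists>u v r. hyp_data T u v r}" using T(1) h by blast
      ultimately show "(m, M) \<in> ?L" by (intro image_eqI[of _ _ T]) (simp add: T(5))
    qed
  qed
qed

section \<open>z-equivalence is an equivalence relation\<close>

lemma zeq_refl: "zeq T T"
  unfolding zeq_def
proof (rule bexI[OF _ ortho_id])
  have "iv id x = x" for x :: 'v by (rule isom_inv_eqI[OF isom_id]) simp
  then have "id \<circ> h \<circ> iv id = h" for h by (simp add: fun_eq_iff)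
  then show "centr T = (\<lambda>h. id \<circ> h \<circ> iv id) ` centr T" by simp
qed

lemma zeq_sym:
  assumes "zeq T T'"
  shows "zeq T' T"
proof -
  obtain g where g: "g \<in> ortho" "centr T' = (\<lambda>h. g \<circ> h \<circ> iv g) ` centr T" using assms by (auto simp: zeq_def)
  note g1 = orthoD(1)[OF g(1)] and gi = isom_inv[OF orthoD(1)[OF g(1)]]
  have "iv g \<circ> (g \<circ> h \<circ> iv g) \<circ> iv (iv g) = h" for h using g1 gi by (simp add: fun_eq_iff)
  then have "centr T = (\<lambda>h. iv g \<circ> h \<circ> iv (iv g)) ` centr T'" unfolding g(2) image_image by simp
  then show ?thesis using ortho_inv[OF g(1)] unfolding zeq_def by blast
qed

lemma zeq_trans:
  assumes "zeq T T'" "zeq T' T''"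
  shows "zeq T T''"
proof -
  obtain g where g: "g \<in> ortho" "centr T' = (\<lambda>h. g \<circ> h \<circ> iv g) ` centr T" using assms(1) by (auto simp: zeq_def)
  obtain k where k: "k \<in> ortho" "centr T'' = (\<lambda>h. k \<circ> h \<circ> iv k) ` centr T'" using assms(2) by (auto simp: zeq_def)
  note g1 = orthoD(1)[OF g(1)] and k1 = orthoD(1)[OF k(1)]
  have "iv (k \<circ> g) x = iv g (iv k x)" for x
    by (rule isom_inv_eqI[OF isom_comp[OF k1 g1]]) (simp add: g1 k1)
  then have "k \<circ> (g \<circ> h \<circ> iv g) \<circ> iv k = (k \<circ> g) \<circ> h \<circ> iv (k \<circ> g)" for h by (simp add: fun_eq_iff)
  then have "centr T'' = (\<lambda>h. (k \<circ> g) \<circ> h \<circ> iv (k \<circ> g)) ` centr T" unfolding k(2) g(2) image_image by simp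
  then show ?thesis using ortho_comp[OF k(1) g(1)] unfolding zeq_def by blast
qed

end

text \<open>Since \<open>f\<close> and \<open>d\<close> have the same fibres on \<open>A\<close>,
  sending a value of \<open>f\<close> to the value of \<open>d\<close> at any preimage is a
  bijection between the images.\<close>

lemma card_image_eq_kernel:
  assumes "\<And>x y. x \<in> A \<Longrightarrow> y \<in> A \<Longrightarrow> f x = f y \<longleftrightarrow> d x = d y"
  shows "card (f ` A) = card (d ` A)" "finite (f ` A) \<longleftrightarrow> finite (d ` A)"
proof -
  define h where "h z = d (SOME x. x \<in> A \<and> f x = z)" for z
  have h: "h (f x) = d x" if "x \<in> A" for x
  proof -
    have "(SOME y. y \<in> A \<and> f y = f x) \<in> A \<and> f (SOME y. y \<in> A \<and> f y = f x) = f x"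
      by (rule someI[of _ x]) (simp add: that)
    then show ?thesis unfolding h_def using assms that by blast
  qed
  have "inj_on h (f ` A)" using h assms by (auto simp: inj_on_def)
  moreover have "h ` f ` A = d ` A" using h by (auto simp: image_iff)
  ultimately have "bij_betw h (f ` A) (d ` A)" by (simp add: bij_betw_def)
  then show "card (f ` A) = card (d ` A)" "finite (f ` A) \<longleftrightarrow> finite (d ` A)"
    by (rule bij_betw_same_card, rule bij_betw_finite)
qed

context lorentz
begin

section \<open>Transfer to the abstract group\<close>

context
  fixes G :: "('v \<Rightarrow> 'v) monoid"
  assumes G: "carrier G = ortho" "mult G = (\<circ>)" "one G = id"
begin

lemma G_inv: assumes "g \<in> ortho" shows "inv\<^bsub>G\<^esub> g = iv g"
proof -
  note g1 = orthoD(1)[OF assms]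
  have i: "g \<circ> iv g = id" "iv g \<circ> g = id" using g1 by (simp_all add: fun_eq_iff)
  have "h = iv g" if "h \<circ> g = id" for h
  proof -
    have "h (g (iv g x)) = iv g x" for x using that by (simp add: fun_eq_iff)
    then show ?thesis using g1 by (simp add: fun_eq_iff)
  qed
  then show ?thesis
    unfolding m_inv_def G using ortho_inv[OF assms] i by (blast intro: the_equality)
qed

lemma G_centralizer: "T \<in> ortho \<Longrightarrow> centralizer G T = centr T"
  by (simp add: centralizer_def centr_def G fun_eq_iff)

lemma G_zeq:
  assumes "T \<in> ortho" "T' \<in> ortho"
  shows "z_equivalent G T T' \<longleftrightarrow> zeq T T'"
proof -
  have "(g <#\<^bsub>G\<^esub> centr T) #>\<^bsub>G\<^esub> inv\<^bsub>G\<^esub> g = (\<lambda>h. g \<circ> h \<circ> iv g) ` centr T" if "g \<in> ortho" for g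
    unfolding l_coset_def r_coset_def G G_inv[OF that] by auto
  then show ?thesis
    unfolding z_equivalent_def zeq_def G_centralizer[OF assms(1)] G_centralizer[OF assms(2)] G(1) by simp
qed

lemma z_class_eq_iff:
  assumes "T \<in> ortho" "T' \<in> ortho"
  shows "z_class G T = z_class G T' \<longleftrightarrow> zeq T T'"
proof -
  have z: "z_class G S = {S' \<in> ortho. zeq S S'}" if "S \<in> ortho" for S
    using G_zeq[OF that] by (auto simp: z_class_def G)
  show ?thesis
  proof
    assume "z_class G T = z_class G T'"
    moreover have "T' \<in> z_class G T'" unfolding z[OF assms(2)] using assms(2) zeq_refl by simp
    ultimately have "T' \<in> z_class G T" by simp
    then show "zeq T T'" unfolding z[OF assms(1)] by simp
  next
    assume "zeq T T'"
    then show "z_class G T = z_class G T'"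
      unfolding z[OF assms(1)] z[OF assms(2)] using zeq_sym zeq_trans by blast
  qed
qed

lemma card_z_classes:
  assumes iff: "\<And>T T'. T \<in> ortho \<Longrightarrow> P T \<Longrightarrow> T' \<in> ortho \<Longrightarrow> P T' \<Longrightarrow> zeq T T' \<longleftrightarrow> d T = d T'"
    and S: "d ` {T \<in> ortho. P T} = S" "finite S"
  shows "finite (z_classes_of G P) \<and> card (z_classes_of G P) = card S"
proof -
  have "z_class G T = z_class G T' \<longleftrightarrow> d T = d T'" if "T \<in> {T \<in> ortho. P T}" "T' \<in> {T \<in> ortho. P T}" for T T'
    using that z_class_eq_iff iff by simp
  note card_image_eq_kernel[of "{T \<in> ortho. P T}" "z_class G" d, OF this]
  then show ?thesis unfolding z_classes_of_def G using S by simp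
qed

end

end

section \<open>The hyperboloid\<close>

text \<open>The orthogonal basis has one positive vector \<open>a\<close>, and all others are
  negative. A vector orthogonal to \<open>a\<close> has no component along it, so its square is a
  sum of terms at most 0, and not all of them vanish.\<close>

lemma signature_lorentz:
  fixes Q :: "'v::euclidean_space \<Rightarrow> real"
  assumes Q: "quadratic_form Q" and sig: "has_signature Q 1 n" and dim: "DIM('v) = n + 1"
  shows "polar_form Q x x = Q x" "\<exists>e. lorentz (polar_form Q) e"
proof -
  define B where "B = polar_form Q"
  have bil: "bilinear B" and hom: "Q (c *\<^sub>R x) = c\<^sup>2 * Q x" for c x
    using Q by (auto simp: quadratic_form_def B_def)
  have BQ: "B x x = Q x" for x
    using hom[of 2 x] by (simp add: B_def polar_form_def scaleR_2)
  then show "polar_form Q x x = Q x" by (simp add: B_def)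
  have sym: "B x y = B y x" for x y by (simp add: B_def polar_form_def add.commute)
  note B_simps = bilinear_ladd[OF bil] bilinear_radd[OF bil] bilinear_lmul[OF bil] bilinear_rmul[OF bil]
  obtain X where X: "independent X" "span X = UNIV" "\<And>x y. x \<in> X \<Longrightarrow> y \<in> X \<Longrightarrow> x \<noteq> y \<Longrightarrow> B x y = 0"
    "card {x\<in>X. Q x > 0} = 1" "card {x\<in>X. Q x < 0} = n"
    using sig by (auto simp: has_signature_def B_def)
  have finX: "finite X" using X(1) by (rule independent_imp_finite)
  have "card X = n + 1" using X(1,2) dim by (metis dim_UNIV dim_eq_card_independent dim_span)
  \<comment> \<open>One positive and \<open>n\<close> negative vectors exhaust a basis of
    \<open>n + 1\<close> vectors, so no basis vector is isotropic.\<close>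
  moreover have "card ({x\<in>X. Q x > 0} \<union> {x\<in>X. Q x < 0}) = 1 + n"
    unfolding X(4,5)[symmetric] by (rule card_Un_disjoint) (use finX in auto)
  ultimately have "{x\<in>X. Q x > 0} \<union> {x\<in>X. Q x < 0} = X" using finX by (intro card_subset_eq) auto
  moreover obtain a where a: "{x\<in>X. Q x > 0} = {a}" using X(4) by (auto simp: card_1_singleton_iff)
  ultimately have negX: "Q x < 0" if "x \<in> X" "x \<noteq> a" for x using that by blast
  have aX: "a \<in> X" "Q a > 0" using a by auto
  define e where "e = (1 / sqrt (Q a)) *\<^sub>R a"
  have "lorentz B e"
  proof
    show "bilinear B" by (rule bil)
    show "B x y = B y x" for x y by (rule sym)
    show "B e e = 1" using aX(2) by (simp add: BQ hom e_def power_divide)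
    show "B v v < 0" if v: "B v e = 0" "v \<noteq> 0" for v
    proof -
      have "v \<in> span X" using X(2) by simp
      then obtain c where c: "v = (\<Sum>x\<in>X. c x *\<^sub>R x)" using span_finite[OF finX] by auto
      have Bsum: "B v y = (\<Sum>x\<in>X. c x * B x y)" for y
      proof -
        have lin: "linear (\<lambda>x. B x y)" using bil by (simp add: bilinear_def)
        show ?thesis unfolding c linear_sum[OF lin] by (simp add: linear_scale[OF lin])
      qed
      have Bvx: "B v x = c x * Q x" if x: "x \<in> X" for x
      proof -
        have "c y * B y x = (if y = x then c x * Q x else 0)" if "y \<in> X" for y
          using X(3)[OF that x] BQ by auto
        then have "B v x = (\<Sum>y\<in>X. if y = x then c x * Q x else 0)" unfolding Bsum by (rule sum.cong[OF refl])
        then show ?thesis using x finX by simp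
      qed
      have "B v a = 0" using v(1) aX(2) by (simp add: e_def B_simps)
      then have "c a = 0" using Bvx[OF aX(1)] aX(2) by simp
      have "B v v = (\<Sum>x\<in>X. c x * (c x * Q x))"
        unfolding Bsum[of v] by (rule sum.cong[OF refl]) (simp add: sym[of _ v] Bvx)
      moreover have "\<dots> < (\<Sum>x\<in>X. 0)"
      proof (rule sum_strict_mono_ex1[OF finX])
        have "c x * (c x * Q x) \<le> 0" if "x \<in> X" for x
          using negX[OF that] \<open>c a = 0\<close>
          by (cases "x = a") (auto simp: mult.assoc[symmetric] mult_le_0_iff)
        then show "\<forall>x\<in>X. c x * (c x * Q x) \<le> 0" by blast
        have "\<exists>x\<in>X. c x \<noteq> 0"
        proof (rule ccontr)
          assume "\<not> ?thesis"
          then have "v = 0" unfolding c by (intro sum.neutral) auto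
          then show False using v(2) by simp
        qed
        then obtain x where x: "x \<in> X" "c x \<noteq> 0" by blast
        then have "Q x < 0" using negX \<open>c a = 0\<close> by blast
        moreover have "c x * c x > 0" using x(2) by (simp add: zero_less_mult_iff) linarith
        ultimately have "c x * (c x * Q x) < 0" by (simp add: mult.assoc[symmetric] mult_pos_neg)
        then show "\<exists>x\<in>X. c x * (c x * Q x) < 0" using x(1) by blast
      qed
      ultimately show ?thesis by simp
    qed
  qed
  then show "\<exists>e. lorentz (polar_form Q) e" unfolding B_def by blast
qed

context lorentz
begin

definition sheet :: "'v set" where
  "sheet = {v. B v v = 1 \<and> B v e0 > 0}"

text \<open>The open future cone is convex, and normalization maps it continuously onto the
  sheet.\<close>

lemma connected_sheet: "connected sheet"
proof -
  let ?C = "{v. B v v > 0 \<and> B v e0 > 0}"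
  have "convex ?C"
    unfolding convex_def
  proof (intro ballI allI impI CollectI conjI)
    fix x y and a b :: real
    assume xy: "x \<in> ?C" "y \<in> ?C" and ab: "0 \<le> a" "0 \<le> b" "a + b = 1"
    have xy': "B x x > 0" "B y y > 0" "B x e0 > 0" "B y e0 > 0" using xy by auto
    then have "B x y \<ge> 0" using future_nonneg[of x y] by simp
    have expand: "B (a *\<^sub>R x + b *\<^sub>R y) (a *\<^sub>R x + b *\<^sub>R y) = a * a * B x x + b * b * B y y + 2 * (a * b * B x y)"
      using sym[of y x] by (simp add: algebra_simps)
    have nn: "a * a * B x x \<ge> 0" "b * b * B y y \<ge> 0" "a * b * B x y \<ge> 0"
      using ab xy' \<open>B x y \<ge> 0\<close> by simp_all
    consider "a > 0" | "b > 0" using ab by linarith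
    then show "B (a *\<^sub>R x + b *\<^sub>R y) (a *\<^sub>R x + b *\<^sub>R y) > 0"
    proof cases
      case 1
      then have "a * a * B x x > 0" using xy'(1) by simp
      then show ?thesis using expand nn by linarith
    next
      case 2
      then have "b * b * B y y > 0" using xy'(2) by simp
      then show ?thesis using expand nn by linarith
    qed
    have nn': "a * B x e0 \<ge> 0" "b * B y e0 \<ge> 0" using ab xy' by simp_all
    have "a > 0 \<or> b > 0" using ab by linarith
    then have "a * B x e0 > 0 \<or> b * B y e0 > 0" using xy' by auto
    then show "B (a *\<^sub>R x + b *\<^sub>R y) e0 > 0" using nn' by auto
  qed
  then have "connected ?C" by (rule convex_connected)
  moreover define f where "f v = (1 / sqrt (B v v)) *\<^sub>R v" for v
  have "continuous_on ?C (\<lambda>v. B v v)"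
    by (intro bilinear_continuous_on_compose[OF _ _ bil] continuous_intros)
  then have "continuous_on ?C f"
    unfolding f_def by (intro continuous_on_scaleR continuous_on_divide continuous_on_real_sqrt continuous_intros) auto
  ultimately have "connected (f ` ?C)" by (intro connected_continuous_image)
  moreover have "f ` ?C = sheet"
  proof
    show "f ` ?C \<subseteq> sheet" by (auto simp: f_def sheet_def)
    show "sheet \<subseteq> f ` ?C"
    proof
      fix v assume "v \<in> sheet"
      then have "v = f v" "v \<in> ?C" by (auto simp: f_def sheet_def)
      then show "v \<in> f ` ?C" by (rule image_eqI)
    qed
  qed
  ultimately show ?thesis by simp
qed

text \<open>In one direction the image of \<open>e0\<close> decides; in the other, both
  \<open>T\<close> and its inverse map the sheet into itself by \<open>ortho_future\<close>.\<close>

lemma ortho_iff_sheet: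
  assumes "isom T"
  shows "T ` sheet = sheet \<longleftrightarrow> T \<in> ortho"
proof
  assume "T ` sheet = sheet"
  moreover have "e0 \<in> sheet" by (simp add: sheet_def e0)
  ultimately have "T e0 \<in> sheet" by blast
  then show "T \<in> ortho" using assms by (simp add: ortho_def sheet_def)
next
  have sub: "S ` sheet \<subseteq> sheet" if S: "S \<in> ortho" for S
  proof clarify
    fix v assume v: "v \<in> sheet"
    then have "B (S v) e0 > 0" by (intro ortho_future[OF S]) (auto simp: sheet_def)
    then show "S v \<in> sheet" using v isom_B[OF orthoD(1)[OF S]] by (simp add: sheet_def)
  qed
  assume T: "T \<in> ortho"
  have "v \<in> T ` sheet" if "v \<in> sheet" for v
  proof -
    have "iv T v \<in> sheet" using sub[OF ortho_inv[OF T]] that by blast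
    then have "T (iv T v) \<in> T ` sheet" by (rule imageI)
    then show ?thesis using isom_f_inv[OF assms] by simp
  qed
  then show "T ` sheet = sheet" using sub[OF T] by blast
qed

end

text \<open>The hyperboloid is the union of the connected sheets of \<open>e\<close> and
  \<open>-e\<close>, which the hyperplane orthogonal to \<open>e\<close> separates. A component lies
  on one side and is maximal, so it is one of the two; for the second sheet the base vector is
  \<open>-e\<close>.\<close>

lemma component_sheet:
  fixes Q :: "'v::euclidean_space \<Rightarrow> real"
  assumes Q: "quadratic_form Q" and sig: "has_signature Q 1 n" and dim: "DIM('v) = n + 1"
    and comp: "\<H> \<in> components (hyperboloid Q)"
  shows "\<exists>e. lorentz (polar_form Q) e \<and> \<H> = lorentz.sheet (polar_form Q) e"
proof -
  note BQ = signature_lorentz(1)[OF Q sig dim]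
  obtain e where e: "lorentz (polar_form Q) e" using signature_lorentz(2)[OF Q sig dim] by blast
  interpret l: lorentz "polar_form Q" e by (rule e)
  have "lorentz (polar_form Q) (- e)"
    by unfold_locales (use l.bil l.sym l.e0 l.neg_orth_e0 in auto)
  then interpret m: lorentz "polar_form Q" "- e" .
  have hyp: "hyperboloid Q = l.sheet \<union> m.sheet"
  proof -
    have "polar_form Q v e \<noteq> 0" if "Q v = 1" for v
    proof (rule l.causal_e0)
      show "polar_form Q v v \<ge> 0" using that BQ by simp
      show "v \<noteq> 0" using that BQ[of v] by auto
    qed
    then show ?thesis by (auto simp: hyperboloid_def l.sheet_def m.sheet_def BQ not_less less_le)
  qed
  have cont: "continuous_on UNIV (\<lambda>v. polar_form Q v e)"
    by (intro bilinear_continuous_on_compose[OF _ _ l.bil] continuous_intros)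
  have op: "open {v. polar_form Q v e > 0}" "open {v. polar_form Q v e < 0}"
    using cont by (auto intro: open_Collect_less)
  obtain v where v: "v \<in> hyperboloid Q" "\<H> = connected_component_set (hyperboloid Q) v"
    using comp by (auto simp: components_def)
  have conn: "connected \<H>" "\<H> \<subseteq> hyperboloid Q" using v(2) by (auto simp: connected_component_subset)
  have max: "\<H> = S" if S: "connected S" "S \<subseteq> hyperboloid Q" "v \<in> S" "\<H> \<subseteq> S" for S
    using connected_component_maximal[OF S(3,1,2)] S(4) v(2) by blast
  have signs: "(\<forall>x\<in>\<H>. polar_form Q x e > 0) \<or> (\<forall>x\<in>\<H>. polar_form Q x e < 0)"
  proof (rule ccontr)
    assume "\<not> ?thesis"
    then obtain x y where xy: "x \<in> \<H>" "\<not> polar_form Q x e > 0" "y \<in> \<H>" "\<not> polar_form Q y e < 0" by blast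
    have sub: "\<H> \<subseteq> {v. polar_form Q v e > 0} \<union> {v. polar_form Q v e < 0}"
      using conn(2) hyp by (auto simp: l.sheet_def m.sheet_def)
    have "{v. polar_form Q v e > 0} \<inter> {v. polar_form Q v e < 0} \<inter> \<H> = {}" by auto
    from connectedD[OF conn(1) op this sub] show False using xy sub by blast
  qed
  have vH: "v \<in> \<H>" using v by simp
  from signs show ?thesis
  proof
    assume s: "\<forall>x\<in>\<H>. polar_form Q x e > 0"
    then have "\<H> \<subseteq> l.sheet" using conn(2) hyp by (force simp: m.sheet_def)
    then have "\<H> = l.sheet" using max[OF l.connected_sheet] hyp vH by blast
    then show ?thesis using e by blast
  next
    assume s: "\<forall>x\<in>\<H>. polar_form Q x e < 0"
    then have "\<H> \<subseteq> m.sheet" using conn(2) hyp by (force simp: l.sheet_def)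
    then have "\<H> = m.sheet" using max[OF m.connected_sheet] hyp vH by blast
    then show ?thesis using m.lorentz_axioms by blast
  qed
qed

theorem theorem1p3:
  fixes n :: nat
    and Q :: "'v::euclidean_space \<Rightarrow> real"
    and \<H> :: "'v set"
    and G :: "('v \<Rightarrow> 'v) monoid"
  assumes "n \<ge> 1"
    and "DIM('v) = n + 1"
    and "quadratic_form Q"
    and "has_signature Q 1 n"
    and "\<H> \<in> components (hyperboloid Q)"
    and "G = hyp_isometry_group Q \<H>"
  shows
    "(finite (z_classes_of G (elliptic Q)) \<and>
      card (z_classes_of G (elliptic Q)) =
        (\<Sum>k = 0..n div 2. (n + 1 - 2 * k) * num_partitions k)) \<and>
     (finite (z_classes_of G hyperbolic) \<and>
      card (z_classes_of G hyperbolic) =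
        (\<Sum>k = 0..(n - 1) div 2. ((n - 1) div 2 + 1 - k) * num_partitions k)) \<and>
     (finite (z_classes_of G parabolic) \<and>
      card (z_classes_of G parabolic) =
        (\<Sum>k | int k \<le> (int n - 2) div 2. (n - 1 - 2 * k) * num_partitions k))"
proof -
  note Q_sig = assms(3,4,2)
  obtain e where e: "lorentz (polar_form Q) e" "\<H> = lorentz.sheet (polar_form Q) e"
    using component_sheet[OF Q_sig assms(5)] by blast
  interpret lorentz "polar_form Q" e by (rule e(1))
  have BQ: "Q = (\<lambda>v. polar_form Q v v)" using signature_lorentz(1)[OF Q_sig] by (simp add: fun_eq_iff)
  have iso: "linear T \<and> bij T \<and> (\<forall>v. Q (T v) = Q v) \<longleftrightarrow> isom T" for T
  proof
    assume "linear T \<and> bij T \<and> (\<forall>v. Q (T v) = Q v)"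
    then show "isom T" by (intro isom_polarize) (simp_all add: signature_lorentz(1)[OF Q_sig])
  next
    assume T: "isom T"
    have "Q (T v) = Q v" for v using isom_B[OF T, of v v] by (simp add: signature_lorentz(1)[OF Q_sig])
    then show "linear T \<and> bij T \<and> (\<forall>v. Q (T v) = Q v)" using isom_linear[OF T] isom_bij[OF T] by blast
  qed
  have "carrier G = {T. isom T \<and> T ` sheet = sheet}"
    unfolding assms(6) hyp_isometry_group_def isometry_group_def e(2) by (simp add: iso)
  also have "\<dots> = ortho" using ortho_iff_sheet orthoD(1) by blast
  finally have G: "carrier G = ortho" "mult G = (\<circ>)" "one G = id"
    by (simp_all add: assms(6) hyp_isometry_group_def isometry_group_def)
  have elliptic: "elliptic Q T \<longleftrightarrow> (\<exists>p. ell_data T p)" if "T \<in> ortho" for T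
    using elliptic_ell_data[OF that] BQ by simp
  have hyperbolic: "hyperbolic T \<longleftrightarrow> (\<exists>u v r. hyp_data T u v r)" if "T \<in> ortho" for T
    by (rule hyperbolic_hyp_data[OF that])
  \<comment> \<open>Isometries with elliptic or hyperbolic data are semisimple, since there
    \<open>P\<close> is spanned by eigenvectors; whatever is left has parabolic data.\<close>
  have parabolic: "parabolic T \<longleftrightarrow> (\<exists>w b u. par_data T w b u)" if T: "T \<in> ortho" for T
  proof
    assume "parabolic T"
    then have ns: "\<not> semisimple T" by (simp add: parabolic_def)
    have "\<not> ell_data T p" for p
    proof
      assume p: "ell_data T p"
      have "T p = 1 *\<^sub>R p" using p by (simp add: ell_data_def)
      then have "{p} \<subseteq> {x. \<exists>c. T x = c *\<^sub>R x}" by blast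
      then have "span {p} \<subseteq> span {x. \<exists>c. T x = c *\<^sub>R x}" by (rule span_mono)
      then show False using splitting_semisimple[OF T ell_splitting(1)[OF T p]] ns by blast
    qed
    moreover have "\<not> hyp_data T u v r" for u v r
    proof
      assume h: "hyp_data T u v r"
      have "T u = r *\<^sub>R u" "T v = (1 / r) *\<^sub>R v" using h by (simp_all add: hyp_data_def)
      then have "{u, v} \<subseteq> {x. \<exists>c. T x = c *\<^sub>R x}" by blast
      then have "span {u, v} \<subseteq> span {x. \<exists>c. T x = c *\<^sub>R x}" by (rule span_mono)
      then show False using splitting_semisimple[OF T hyp_splitting(1)[OF T h]] ns by blast
    qed
    ultimately show "\<exists>w b u. par_data T w b u" using par_data_exists[OF T] hyperbolic[OF T] by blast
  next
    assume "\<exists>w b u. par_data T w b u"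
    then show "parabolic T" using par_data_not_semisimple[OF orthoD(2)[OF T]] by (auto simp: parabolic_def)
  qed
  have ell: "finite (z_classes_of G (elliptic Q)) \<and> card (z_classes_of G (elliptic Q)) =
      (\<Sum>k = 0..n div 2. (n + 1 - 2 * k) * num_partitions k)"
  proof -
    let ?S = "{(b, M). 0 \<notin># M \<and> sum_mset M \<in> {0..n div 2} \<and> b < n + 1 - 2 * sum_mset M}"
    have "{T \<in> ortho. elliptic Q T} = {T \<in> ortho. \<exists>p. ell_data T p}" using elliptic by blast
    moreover have "{(b, M). 0 \<notin># M \<and> b + 2 * sum_mset M + 1 \<le> DIM('v)} = ?S"
      using assms(2) by auto
    ultimately have "(\<lambda>T. (dim (flipped T), lam T)) ` {T \<in> ortho. elliptic Q T} = ?S" using ell_data_set by simp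
    moreover have "zeq T T' \<longleftrightarrow> (dim (flipped T), lam T) = (dim (flipped T'), lam T')"
      if "T \<in> ortho" "elliptic Q T" "T' \<in> ortho" "elliptic Q T'" for T T'
      using that elliptic ell_zeq_iff by auto
    ultimately show ?thesis
      using card_z_classes[OF G, of "elliptic Q" "\<lambda>T. (dim (flipped T), lam T)" ?S]
        count_pairs[of "{0..n div 2}" "\<lambda>k. n + 1 - 2 * k"] by simp
  qed
  have hyp: "finite (z_classes_of G hyperbolic) \<and> card (z_classes_of G hyperbolic) =
      (\<Sum>k = 0..(n - 1) div 2. ((n - 1) div 2 + 1 - k) * num_partitions k)"
  proof -
    \<comment> \<open>Dividing \<open>2 b + 2 k + 2 \<le> n + 1\<close> by 2 gives
      \<open>b + k \<le> (n - 1) div 2\<close>, regardless of parity.\<close>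
    let ?S = "{(b, M). 0 \<notin># M \<and> sum_mset M \<in> {0..(n - 1) div 2} \<and> b < (n - 1) div 2 + 1 - sum_mset M}"
    let ?d = "\<lambda>T. (min (dim (fixed T)) (dim (flipped T)), lam T)"
    have "{T \<in> ortho. hyperbolic T} = {T \<in> ortho. \<exists>u v r. hyp_data T u v r}" using hyperbolic by blast
    moreover have "{(b, M). 0 \<notin># M \<and> 2 * b + 2 * sum_mset M + 2 \<le> DIM('v)} = ?S"
      using assms(1,2) by auto
    ultimately have "?d ` {T \<in> ortho. hyperbolic T} = ?S" using hyp_data_set by simp
    moreover have "zeq T T' \<longleftrightarrow> ?d T = ?d T'"
      if "T \<in> ortho" "hyperbolic T" "T' \<in> ortho" "hyperbolic T'" for T T'
      using that hyperbolic hyp_zeq_iff by auto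
    ultimately show ?thesis
      using card_z_classes[OF G, of hyperbolic ?d ?S]
        count_pairs[of "{0..(n - 1) div 2}" "\<lambda>k. (n - 1) div 2 + 1 - k"] by simp
  qed
  have par: "finite (z_classes_of G parabolic) \<and> card (z_classes_of G parabolic) =
      (\<Sum>k | int k \<le> (int n - 2) div 2. (n - 1 - 2 * k) * num_partitions k)"
  proof -
    \<comment> \<open>The integer quotient is -1 for \<open>n = 1\<close>, which leaves no term, as
      a parabolic block requires dimension at least three.\<close>
    let ?K = "{k. int k \<le> (int n - 2) div 2}"
    have K: "k \<in> ?K \<longleftrightarrow> 2 * k + 2 \<le> n" for k by auto
    then have finK: "finite ?K" by (intro finite_subset[of ?K "{..n}"]) auto
    let ?S = "{(b, M). 0 \<notin># M \<and> sum_mset M \<in> ?K \<and> b < n - 1 - 2 * sum_mset M}"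
    have "{T \<in> ortho. parabolic T} = {T \<in> ortho. \<exists>w b u. par_data T w b u}" using parabolic by blast
    moreover have "{(b, M). 0 \<notin># M \<and> b + 2 * sum_mset M + 3 \<le> DIM('v)} = ?S"
      unfolding K using assms(2) by auto
    ultimately have "(\<lambda>T. (dim (flipped T), lam T)) ` {T \<in> ortho. parabolic T} = ?S" using par_data_set by simp
    moreover have "zeq T T' \<longleftrightarrow> (dim (flipped T), lam T) = (dim (flipped T'), lam T')"
      if "T \<in> ortho" "parabolic T" "T' \<in> ortho" "parabolic T'" for T T'
      using that parabolic par_zeq_iff by auto
    ultimately show ?thesis
      using card_z_classes[OF G, of parabolic "\<lambda>T. (dim (flipped T), lam T)" ?S]
        count_pairs[OF finK, of "\<lambda>k. n - 1 - 2 * k"] by simp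
  qed
  show ?thesis using ell hyp par by blast
qed

end
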